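(* Assume that we are in the one branch, non-ramified case: $\mathbf L$ is a field, the maximal ideal of $\mathbf A$ is $t\mathbf A$, and $\mathbf A/t\mathbf A=\mathbf k[\bar\theta]$ is a cubic field extension of $\mathbf k$. For integers $r\ge 0$ and $\alpha\in\mathbf A^\times\setminus\mathbf D$ put $$\mathbf C_r(\alpha)=\mathbf D+t^r\alpha\mathbf D+t^{2r}\mathbf A$$ (with $\mathbf C_0(\alpha)=\mathbf A$). Then: (1) every over-ring of $\mathbf A_m$ coincides with $t^k\mathbf C_r(\alpha)+\mathbf D$ for some $k,r$ and $\alpha$ with $2r+k\le m$; (2) the rings $\mathbf C_r(\alpha)$ are just all plane curve singularities in this case (i.e. among the cubic rings over $\mathbf D$ in $\mathbf L$).
   Context: $\mathbf D$ is a complete discrete valuation ring with field of fractions $\mathbf K$, maximal ideal $t\mathbf D$ and residue field $\mathbf k=\mathbf D/t\mathbf D$. $\mathbf L$ is a $3$-dimensional (commutative) semisimple $\mathbf K$-algebra. A cubic ring over $\mathbf D$ (in $\mathbf L$) is a $\mathbf D$-subalgebra of $\mathbf L$ that is a free $\mathbf D$-module of rank $3$. $\mathbf A$ is the integral closure of $\mathbf D$ in $\mathbf L$; it is assumed to be a finitely generated $\mathbf D$-module. For $m\ge0$, $\mathbf A_m=t^m\mathbf A+\mathbf D$ (so $\mathbf A_0=\mathbf A$). An over-ring of a cubic ring $\mathbf C$ is a cubic ring $\mathbf B$ with $\mathbf C\subseteq\mathbf B\subset\mathbf L$. The embedding dimension of a local noetherian ring $\mathbf C$ with maximal ideal $\mathbf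 J$ is $\dim_{\mathbf C/\mathbf J}\mathbf J/\mathbf J^2$; a local noetherian ring of Krull dimension $1$ and embedding dimension $2$ is called a plane curve singularity.
   Formalization: Part (2) is stated for r ≥ 1 and units α of A outside D + tA (residue not in k), since as written it fails: C_0(α) = A has embedding dimension 1, and α = 1 + tβ, r = 1 gives D + t²A, of embedding dimension 3 for β outside D + tA. *)

theory Defs
  imports
    "HOL-Algebra.Finite_Extensions"
    "HOL-Algebra.Ideal_Product"
    "HOL-Library.Extended_Nat"
    "Jordan_Normal_Form.Missing_VectorSpace"
begin

section \<open>Local rings, Krull dimension, embedding dimension\<close>

definition local_ring :: "('a, 'm) ring_scheme \<Rightarrow> bool" where
  "local_ring R \<longleftrightarrow> cring R \<and> (\<exists>!J. maximalideal J R)"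

text \<open>Only meaningful for local rings.\<close>

definition max_ideal :: "('a, 'm) ring_scheme \<Rightarrow> 'a set" where
  "max_ideal R = (THE J. maximalideal J R)"

definition krull_dim :: "('a, 'm) ring_scheme \<Rightarrow> enat" where
  "krull_dim R = Sup {enat n | n. \<exists>P. (\<forall>i\<le>n. primeideal (P i) R) \<and> (\<forall>i<n. P i \<subset> P (Suc i))}"

text \<open>
  The module \<open>J/J\<^sup>2\<close> over \<open>R/J\<close>, for an ideal \<open>J\<close>. Its elements are cosets of \<open>J\<^sup>2\<close>.
  The scalar multiple of \<open>y + J\<^sup>2\<close> by \<open>a + J\<close> is the union of the cosets \<open>a'y' + J\<^sup>2\<close> over all
  representatives, i.e. the single coset \<open>ay + J\<^sup>2\<close>. The fields \<open>mult\<close> and \<open>one\<close>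
  of the record play no role in a module.
\<close>

definition cotangent_space ::
    "('a, 'm) ring_scheme \<Rightarrow> 'a set \<Rightarrow> ('a set, 'a set) module" where
  "cotangent_space R J =
     \<lparr>carrier = (\<lambda>x. (J \<cdot>\<^bsub>R\<^esub> J) +>\<^bsub>R\<^esub> x) ` J,
      mult = rcoset_mult R (J \<cdot>\<^bsub>R\<^esub> J),
      one = undefined,
      zero = J \<cdot>\<^bsub>R\<^esub> J,
      add = set_add R,
      smult = rcoset_mult R (J \<cdot>\<^bsub>R\<^esub> J)\<rparr>"

lemma cotangent_space_vectorspace:
  fixes R (structure)
  assumes "cring R" "maximalideal J R"
  shows "vectorspace (R Quot J) (cotangent_space R J)"
proof -
  interpret cring R by fact
  interpret J: maximalideal J R by fact
  let ?I = "J \<cdot> J"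
  have I: "ideal ?I R" by (rule ideal_prod_is_ideal) (rule J.is_ideal)+
  interpret I: ideal ?I R by (rule I)
  have IJ: "?I \<subseteq> J" using ideal_prod_inter[OF J.is_ideal J.is_ideal] by auto
  have F: "field (R Quot J)" using J.quotient_is_field[OF is_cring] .
  interpret Q: cring "R Quot ?I" by (rule I.quotient_is_cring[OF is_cring])
  have mulQ: "rcoset_mult R ?I (J +> a) (?I +> y) = ?I +> (a \<otimes> y)" if a: "a \<in> carrier R" and y: "y \<in> J" for a y
  proof -
    have yc: "y \<in> carrier R" using y J.Icarr by auto
    have eq: "?I +> (a' \<otimes> y') = ?I +> (a \<otimes> y)" if m1: "a' \<in> J +> a" and m2: "y' \<in> ?I +> y" for a' y'
    proof -
      obtain j where j: "j \<in> J" "a' = j \<oplus> a" using m1 by (auto simp: a_r_coset_def')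
      obtain i where i: "i \<in> ?I" "y' = i \<oplus> y" using m2 by (auto simp: a_r_coset_def')
      have jc: "j \<in> carrier R" and ic: "i \<in> carrier R" using j i J.Icarr I.Icarr by auto
      have "a' \<otimes> y' = (j \<otimes> i \<oplus> j \<otimes> y \<oplus> a \<otimes> i) \<oplus> a \<otimes> y"
        unfolding j i using jc ic a yc by algebra
      moreover have "j \<otimes> i \<oplus> j \<otimes> y \<oplus> a \<otimes> i \<in> ?I"
        using i j y jc a by (intro I.a_closed I.I_l_closed ideal_prod.prod) auto
      ultimately have "a' \<otimes> y' \<in> ?I +> (a \<otimes> y)" by (auto simp: a_r_coset_def')
      then show ?thesis using I.a_repr_independence'[of "a' \<otimes> y'" "a \<otimes> y"] a yc by simp
    qed
    have "a \<in> J +> a" "y \<in> ?I +> y" using a yc J.a_rcos_self I.a_rcos_self by auto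
    moreover have "rcoset_mult R ?I (J +> a) (?I +> y) =
        (\<Union>a'\<in>J +> a. \<Union>y'\<in>?I +> y. ?I +> (a \<otimes> y))"
      unfolding rcoset_mult_def by (intro SUP_cong refl eq)
    ultimately show ?thesis by blast
  qed
  have addI: "set_add R (?I +> x) (?I +> y) = ?I +> (x \<oplus> y)" if "x \<in> carrier R" "y \<in> carrier R" for x y
    using I.a_rcos_sum that by blast
  have addJ: "set_add R (J +> x) (J +> y) = J +> (x \<oplus> y)" if "x \<in> carrier R" "y \<in> carrier R" for x y
    using J.a_rcos_sum that by blast
  have z: "?I +> \<zero> = ?I" using I.a_rcos_const[OF I.zero_closed] .
  have "abelian_group (cotangent_space R J)"
  proof (rule abelian_groupI)
    fix x assume x: "x \<in> carrier (cotangent_space R J)"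
    then obtain a where a: "a \<in> J" "x = ?I +> a" by (auto simp: cotangent_space_def)
    have "?I +> (\<ominus> a) \<in> carrier (cotangent_space R J)" using a by (auto simp: cotangent_space_def)
    moreover have "(?I +> (\<ominus> a)) \<oplus>\<^bsub>cotangent_space R J\<^esub> x = \<zero>\<^bsub>cotangent_space R J\<^esub>"
      using a J.Icarr[of a] addI[of "\<ominus> a" a] by (auto simp: cotangent_space_def l_neg z)
    ultimately show "\<exists>y\<in>carrier (cotangent_space R J). y \<oplus>\<^bsub>cotangent_space R J\<^esub> x = \<zero>\<^bsub>cotangent_space R J\<^esub>" by blast
    show "\<zero>\<^bsub>cotangent_space R J\<^esub> \<oplus>\<^bsub>cotangent_space R J\<^esub> x = x"
      using a J.Icarr[of a] addI[of \<zero> a] by (auto simp: cotangent_space_def z)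
  next
    show "\<zero>\<^bsub>cotangent_space R J\<^esub> \<in> carrier (cotangent_space R J)"
      using z J.zero_closed by (force simp: cotangent_space_def)
  qed (auto simp: cotangent_space_def addI J.Icarr a_ac)
  then show ?thesis
    unfolding vectorspace_def module_def module_axioms_def
    using F fieldE(1)[OF F]
    by (auto simp: cotangent_space_def FactRing_def A_RCOSETS_def' addI addJ mulQ J.Icarr J.rcoset_mult_add
         l_distr r_distr m_assoc J.I_l_closed)
qed

definition embedding_dim :: "('a, 'm) ring_scheme \<Rightarrow> nat" where
  "embedding_dim R =
     vectorspace.dim (R Quot (max_ideal R)) (cotangent_space R (max_ideal R))"

definition plane_curve_singularity :: "('a, 'm) ring_scheme \<Rightarrow> bool" where
  "plane_curve_singularity R \<longleftrightarrow>
     local_ring R \<and> noetherian_ring R \<and> krull_dim R = 1 \<and> embedding_dim R = 2"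


section \<open>Complete discrete valuation rings\<close>

definition discrete_valuation_ring :: "('a, 'm) ring_scheme \<Rightarrow> bool" where
  "discrete_valuation_ring R \<longleftrightarrow> principal_domain R \<and> local_ring R \<and> \<not> field R"

text \<open>
  Convergence of Cauchy sequences for the \<open>t\<close>-adic topology, after passing to subsequences with
  \<open>x (n + 1) - x n \<in> t\<^sup>n R\<close>.
  The \<open>t\<close>-adic topology of a discrete valuation ring is automatically separated.
\<close>

definition adically_complete :: "('a, 'm) ring_scheme \<Rightarrow> 'a \<Rightarrow> bool" where
  "adically_complete R t \<longleftrightarrow>
     (\<forall>x. (\<forall>n::nat. x n \<in> carrier R \<and> x (Suc n) \<ominus>\<^bsub>R\<^esub> x n \<in> PIdl\<^bsub>R\<^esub> (t [^]\<^bsub>R\<^esub> n)) \<longrightarrow>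
       (\<exists>y\<in>carrier R. \<forall>n. y \<ominus>\<^bsub>R\<^esub> x n \<in> PIdl\<^bsub>R\<^esub> (t [^]\<^bsub>R\<^esub> n)))"


section \<open>Cubic rings in a field extension\<close>

definition fractions :: "('a, 'm) ring_scheme \<Rightarrow> 'a set \<Rightarrow> 'a set" where
  "fractions L D = {a \<otimes>\<^bsub>L\<^esub> inv\<^bsub>L\<^esub> b | a b. a \<in> D \<and> b \<in> D - {\<zero>\<^bsub>L\<^esub>}}"

definition integral_closure :: "('a, 'm) ring_scheme \<Rightarrow> 'a set \<Rightarrow> 'a set" where
  "integral_closure L D =
     {x \<in> carrier L. \<exists>p \<in> carrier (univ_poly L D).
        p \<noteq> [] \<and> lead_coeff p = \<one>\<^bsub>L\<^esub> \<and> ring.eval L p x = \<zero>\<^bsub>L\<^esub>}"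

definition fin_gen_module :: "('a, 'm) ring_scheme \<Rightarrow> 'a set \<Rightarrow> 'a set \<Rightarrow> bool" where
  "fin_gen_module L D M \<longleftrightarrow> (\<exists>Us. set Us \<subseteq> carrier L \<and> M = ring.Span L D Us)"

text \<open>
  \<^const>\<open>ring.independent\<close> is linear independence only over a field, so that freeness over the ring
  \<open>D\<close> is stated as existence and uniqueness of coordinates.
\<close>

definition free_of_rank ::
    "('a, 'm) ring_scheme \<Rightarrow> 'a set \<Rightarrow> nat \<Rightarrow> 'a set \<Rightarrow> bool" where
  "free_of_rank L D n M \<longleftrightarrow>
     (\<exists>Us. set Us \<subseteq> carrier L \<and> length Us = n \<and>
        bij_betw (\<lambda>Ks. ring.combine L Ks Us) {Ks. set Ks \<subseteq> D \<and> length Ks = n} M)"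

definition cubic_ring :: "('a, 'm) ring_scheme \<Rightarrow> 'a set \<Rightarrow> 'a set \<Rightarrow> bool" where
  "cubic_ring L D C \<longleftrightarrow> subring C L \<and> D \<subseteq> C \<and> free_of_rank L D 3 C"

definition over_ring ::
    "('a, 'm) ring_scheme \<Rightarrow> 'a set \<Rightarrow> 'a set \<Rightarrow> 'a set \<Rightarrow> bool" where
  "over_ring L D C B \<longleftrightarrow> cubic_ring L D B \<and> C \<subseteq> B"

definition A_ring ::
    "('a, 'm) ring_scheme \<Rightarrow> 'a set \<Rightarrow> 'a set \<Rightarrow> 'a \<Rightarrow> nat \<Rightarrow> 'a set" where
  "A_ring L D A t m = ((t [^]\<^bsub>L\<^esub> m) <#\<^bsub>L\<^esub> A) <+>\<^bsub>L\<^esub> D"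

text \<open>
  For \<open>r = 0\<close> this is \<open>A\<close>, provided that \<open>D \<subseteq> A\<close> and \<open>\<alpha> \<in> A\<close>. If \<open>\<alpha> \<in> D + tA\<close>,
  i.e. the residue of \<open>\<alpha>\<close> lies in the residue field \<open>k\<close> of \<open>D\<close>, then for \<open>r > 0\<close> the
  ring is not a plane curve singularity, even if \<open>\<alpha>\<close> is a unit outside \<open>D\<close>: for instance
  \<open>\<alpha> = 1 + t\<beta>\<close> and \<open>r = 1\<close> give \<open>D + t\<^sup>2A\<close>, of embedding dimension 3. The rings
  \<open>C\<^sub>r(\<alpha>)\<close> that are plane curve singularities are those with \<open>r > 0\<close> and \<open>\<alpha>\<close> a unit
  outside \<open>D + tA\<close>.
\<close>

definition C_ring ::
    "('a, 'm) ring_scheme \<Rightarrow> 'a set \<Rightarrow> 'a set \<Rightarrow> 'a \<Rightarrow> nat \<Rightarrow> 'a \<Rightarrow> 'a set" where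
  "C_ring L D A t r \<alpha> =
     D <+>\<^bsub>L\<^esub> ((t [^]\<^bsub>L\<^esub> r \<otimes>\<^bsub>L\<^esub> \<alpha>) <#\<^bsub>L\<^esub> D)
       <+>\<^bsub>L\<^esub> ((t [^]\<^bsub>L\<^esub> (2 * r)) <#\<^bsub>L\<^esub> A)"

text \<open>
  The residue field \<open>k\<close> of \<open>D\<close> is identified with its image in \<open>A/tA\<close>, i.e. the set of cosets
  \<open>d + tA\<close> with \<open>d \<in> D\<close>.
\<close>

definition residue_image ::
    "('a, 'm) ring_scheme \<Rightarrow> 'a set \<Rightarrow> 'a set \<Rightarrow> 'a set \<Rightarrow> 'a set set" where
  "residue_image L D A I = (\<lambda>d. I +>\<^bsub>L\<lparr>carrier := A\<rparr>\<^esub> d) ` D"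

definition one_branch_nonramified ::
    "('a, 'm) ring_scheme \<Rightarrow> 'a set \<Rightarrow> 'a set \<Rightarrow> 'a \<Rightarrow> bool" where
  "one_branch_nonramified L D A t \<longleftrightarrow>
     field L \<and>
     local_ring (L\<lparr>carrier := A\<rparr>) \<and>
     max_ideal (L\<lparr>carrier := A\<rparr>) = t <#\<^bsub>L\<^esub> A \<and>
     (let F = L\<lparr>carrier := A\<rparr> Quot (t <#\<^bsub>L\<^esub> A);
          k = residue_image L D A (t <#\<^bsub>L\<^esub> A)
      in ring.dimension F 3 k (carrier F) \<and>
         (\<exists>\<theta> \<in> carrier F. carrier F = ring.simple_extension F k \<theta>))"

end

theory Submission
  imports Defs
begin

text \<open>
  The residue field \<open>k\<close> of \<open>D\<close> has prime degree in \<open>A/tA\<close>, hence \<open>1, \<alpha>, \<alpha>\<^sup>2\<close> is a \<open>D\<close>-basis of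
  \<open>A\<close> whenever \<open>\<alpha> \<in> A\<close> lies outside \<open>D + tA\<close>. For an order \<open>B\<close> with \<open>t\<^sup>mA \<subseteq> B \<subseteq> A\<close> let \<open>s\<close> be maximal
  with \<open>B \<subseteq> D + t\<^sup>sA\<close> and \<open>l\<close> minimal with \<open>t\<^sup>lA \<subseteq> B\<close>. Then \<open>B\<close> contains some \<open>t\<^sup>s\<alpha>\<close> as above, its
  square gives \<open>l \<le> 2s\<close>, and minimality of \<open>l\<close> forces \<open>B = D + t\<^sup>s\<alpha>D + t\<^sup>lA\<close>. This is
  \<open>t\<^sup>kC\<^sub>r(\<alpha>) + D\<close> with \<open>r = l - s\<close> and \<open>k = 2s - l\<close>. Its maximal ideal has the \<open>D\<close>-basis
  \<open>t, t\<^sup>s\<alpha>, t\<^sup>l\<alpha>\<^sup>2\<close> if \<open>s > 0\<close>; the last generator is redundant modulo \<open>J\<^sup>2\<close> exactly when \<open>l = 2s\<close>, so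
  the embedding dimension is 1 for \<open>s = 0\<close>, 2 for \<open>l = 2s > 0\<close> and 3 otherwise.
\<close>

section \<open>Discrete valuation rings inside a field\<close>

text \<open>The field \<open>A/tA\<close> serves only to extract one arithmetic statement: a
  relation a + b \<alpha> + c \<alpha>^2 in tA with a, b, c in \<open>D\<close> forces a, b, c into
  tD. Dividing by t and repeating turns divisibility by t^n in \<open>A\<close> into divisibility of
  the three coordinates, so that the basis of \<open>A\<close>, its valuation and the shape of its
  subrings become questions about powers of t in \<open>D\<close>. A cubic ring is given by an
  abstract basis somewhere in \<open>L\<close>, so the inclusions t^m A \<subseteq> B \<subseteq> A
  have to be earned. The left one holds because a \<open>D\<close>-basis of length 3 is a
  \<open>K\<close>-basis of \<open>L\<close> and powers of t are enough as denominators. The right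
  one holds because the denominators in \<open>B\<close> are bounded, whereas the powers of an
  element outside \<open>A\<close> would need arbitrarily large ones. The bound l \<le> 2s has a
  converse role: it makes D + t^s \<alpha> D + t^l A closed under multiplication, so the normal
  forms are themselves cubic rings. For the embedding dimension no exact description of J^2 is
  computed; an upper bound shows which generators of J survive.\<close>

lemma mem_l_coset: "x \<in> a <#\<^bsub>G\<^esub> S \<longleftrightarrow> (\<exists>s\<in>S. x = a \<otimes>\<^bsub>G\<^esub> s)"
  by (auto simp: l_coset_def)

lemma mem_set_add: "x \<in> S <+>\<^bsub>G\<^esub> T \<longleftrightarrow> (\<exists>s\<in>S. \<exists>u\<in>T. x = s \<oplus>\<^bsub>G\<^esub> u)"
  by (auto simp: set_add_def')

lemma set_addI: "\<lbrakk>s \<in> S; u \<in> T\<rbrakk> \<Longrightarrow> s \<oplus>\<^bsub>G\<^esub> u \<in> S <+>\<^bsub>G\<^esub> T"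
  unfolding mem_set_add by (intro bexI) simp_all

lemma l_cosetI: "s \<in> S \<Longrightarrow> a \<otimes>\<^bsub>G\<^esub> s \<in> a <#\<^bsub>G\<^esub> S"
  unfolding mem_l_coset by (intro bexI) simp_all

lemma set_addE:
  assumes "x \<in> S <+>\<^bsub>G\<^esub> T"
  obtains s u where "s \<in> S" "u \<in> T" "x = s \<oplus>\<^bsub>G\<^esub> u"
  using assms unfolding mem_set_add by blast

lemma l_cosetE:
  assumes "x \<in> a <#\<^bsub>G\<^esub> S"
  obtains s where "s \<in> S" "x = a \<otimes>\<^bsub>G\<^esub> s"
  using assms unfolding mem_l_coset by blast

text \<open>\<open>D\<close> is described by elementwise facts in the operations of
  \<open>L\<close>: a unit of \<open>D\<close> is an element outside \<open>t <# D\<close>, its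
  inverse is taken in \<open>L\<close>, and the valuation is the exponent in d = t^n u. Most later
  arguments then take place in \<open>L\<close> alone.\<close>

locale dvr_in_field = field L for L (structure) +
  fixes D :: "'a set" and t :: 'a
  assumes D_sub: "subring D L"
    and t_D: "t \<in> D" and t_nonzero: "t \<noteq> \<zero>"
    and D_unit: "\<lbrakk>d \<in> D; d \<notin> t <# D\<rbrakk> \<Longrightarrow> inv d \<in> D"
    and D_val: "\<lbrakk>d \<in> D; d \<noteq> \<zero>\<rbrakk> \<Longrightarrow> \<exists>n::nat. \<exists>u\<in>D. u \<notin> t <# D \<and> d = t [^] n \<otimes> u"
    and one_notin: "\<one> \<notin> t <# D"
begin

lemmas D_props = subringE[OF D_sub]

lemma D_carrier: "d \<in> D \<Longrightarrow> d \<in> carrier L"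
  using D_props(1) by auto

lemma t_carrier [simp]: "t \<in> carrier L"
  using t_D D_carrier by auto

lemma tpow_carrier [simp]: "t [^] (n::nat) \<in> carrier L"
  by simp

lemma tpow_D: "t [^] (n::nat) \<in> D"
  by (induction n) (auto simp: D_props t_D)

lemma tpow_nonzero: "t [^] (n::nat) \<noteq> \<zero>"
  by (induction n) (simp_all add: t_nonzero integral_iff)

lemma inv_mult: "\<lbrakk>x \<in> Units L; y \<in> Units L\<rbrakk> \<Longrightarrow> inv (x \<otimes> y) = inv x \<otimes> inv y"
proof (rule comm_inv_char)
  assume xy: "x \<in> Units L" "y \<in> Units L"
  then have c: "x \<in> carrier L" "y \<in> carrier L" "inv x \<in> carrier L" "inv y \<in> carrier L" by auto
  have "x \<otimes> y \<otimes> (inv x \<otimes> inv y) = (x \<otimes> inv x) \<otimes> (y \<otimes> inv y)" using c by algebra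
  then show "x \<otimes> y \<otimes> (inv x \<otimes> inv y) = \<one>" using xy by simp
qed auto

lemma tpow_cancel: "\<lbrakk>x \<in> carrier L; y \<in> carrier L; t [^] (n::nat) \<otimes> x = t [^] n \<otimes> y\<rbrakk> \<Longrightarrow> x = y"
  using m_lcancel[of "t [^] n" x y] tpow_nonzero by auto

lemma t_cancel: "\<lbrakk>x \<in> carrier L; y \<in> carrier L; t \<otimes> x = t \<otimes> y\<rbrakk> \<Longrightarrow> x = y"
  using m_lcancel[of t x y] t_nonzero by auto

lemma tpow_add: "x \<in> carrier L \<Longrightarrow> t [^] (m + n :: nat) \<otimes> x = t [^] m \<otimes> (t [^] n \<otimes> x)"
  by (simp add: nat_pow_mult[symmetric] m_assoc)

lemma tpow_Suc: "x \<in> carrier L \<Longrightarrow> t [^] Suc n \<otimes> x = t \<otimes> (t [^] n \<otimes> x)"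
  using tpow_add[of x 1 n] by simp

section \<open>The fraction field of \<open>D\<close> and its denominators\<close>

lemma fractions_subfield: "subfield (fractions L D) L"
proof (rule subfieldI')
  have mem: "a \<otimes> inv b \<in> fractions L D" if "a \<in> D" "b \<in> D" "b \<noteq> \<zero>" for a b
    using that unfolding fractions_def by blast
  have D1: "\<one> \<noteq> \<zero>" by simp
  show "subring (fractions L D) L"
  proof (rule subringI)
    show "fractions L D \<subseteq> carrier L"
      using D_carrier by (auto simp: fractions_def field_Units)
    show "\<one> \<in> fractions L D" using mem[of \<one> \<one>] D_props D1 by auto
  next
    fix x assume "x \<in> fractions L D"
    then obtain a b where x: "a \<in> D" "b \<in> D" "b \<noteq> \<zero>" "x = a \<otimes> inv b" by (auto simp: fractions_def)
    then have c: "a \<in> carrier L" "inv b \<in> carrier L" using D_carrier by (auto simp: field_Units)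
    show "\<ominus> x \<in> fractions L D"
      using mem[of "\<ominus> a" b] x c D_props by (simp add: l_minus)
  next
    fix x y assume "x \<in> fractions L D" "y \<in> fractions L D"
    then obtain a b a' b' where x: "a \<in> D" "b \<in> D" "b \<noteq> \<zero>" "x = a \<otimes> inv b"
      and y: "a' \<in> D" "b' \<in> D" "b' \<noteq> \<zero>" "y = a' \<otimes> inv b'" by (auto simp: fractions_def)
    have c: "a \<in> carrier L" "inv b \<in> carrier L" "b \<in> carrier L" "b \<in> Units L"
        "a' \<in> carrier L" "inv b' \<in> carrier L" "b' \<in> carrier L" "b' \<in> Units L"
      using D_carrier x y by (auto simp: field_Units)
    have i: "b \<otimes> inv b = \<one>" "b' \<otimes> inv b' = \<one>" "inv (b \<otimes> b') = inv b \<otimes> inv b'"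
      using c by (simp_all add: inv_mult m_comm)
    have bb: "b \<otimes> b' \<noteq> \<zero>" using x y c integral by blast
    have "x \<otimes> y = (a \<otimes> a') \<otimes> inv (b \<otimes> b')" unfolding i x y using c by algebra
    then show "x \<otimes> y \<in> fractions L D" using mem[OF _ _ bb] x y D_props by simp
    have "x \<oplus> y = a \<otimes> inv b \<otimes> \<one> \<oplus> a' \<otimes> inv b' \<otimes> \<one>" using x y c by simp
    also have "\<dots> = a \<otimes> inv b \<otimes> (b' \<otimes> inv b') \<oplus> a' \<otimes> inv b' \<otimes> (b \<otimes> inv b)" using i by simp
    also have "\<dots> = (a \<otimes> b' \<oplus> a' \<otimes> b) \<otimes> inv (b \<otimes> b')" unfolding i(3) using c by algebra
    finally show "x \<oplus> y \<in> fractions L D" using mem[OF _ _ bb] x y D_props by simp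
  qed
next
  fix x assume "x \<in> fractions L D - {\<zero>}"
  then obtain a b where x: "a \<in> D" "b \<in> D" "b \<noteq> \<zero>" "x = a \<otimes> inv b" "x \<noteq> \<zero>"
    by (auto simp: fractions_def)
  have c: "a \<in> carrier L" "b \<in> Units L" using x D_carrier by (auto simp: field_Units)
  then have "a \<noteq> \<zero>" using x by auto
  then have "a \<in> Units L" using c by (auto simp: field_Units)
  then have "inv x = b \<otimes> inv a" using x c m_comm[OF Units_closed[OF c(2)], of "inv a"] by (simp add: inv_mult Units_inv_Units)
  then show "inv x \<in> fractions L D" using x \<open>a \<noteq> \<zero>\<close> unfolding fractions_def by blast
qed

text \<open>A nonzero denominator is t^n times a unit of \<open>D\<close>, and the unit is absorbed
  into the numerator.\<close>

lemma fractions_denom: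
  assumes "x \<in> fractions L D"
  shows "\<exists>n::nat. t [^] n \<otimes> x \<in> D"
proof -
  obtain a b where x: "a \<in> D" "b \<in> D" "b \<noteq> \<zero>" "x = a \<otimes> inv b"
    using assms by (auto simp: fractions_def)
  obtain n :: nat and u where u: "u \<in> D" "u \<notin> t <# D" "b = t [^] n \<otimes> u"
    using D_val x by blast
  have "u \<noteq> \<zero>" using u x by auto
  then have un: "u \<in> Units L" "t [^] n \<in> Units L"
    using u D_carrier tpow_nonzero by (auto simp: field_Units)
  have ac: "a \<in> carrier L" using x D_carrier by auto
  have inv: "inv b = inv (t [^] n) \<otimes> inv u" unfolding u using un by (subst inv_mult) (auto simp: m_comm)
  have "t [^] n \<otimes> x = (t [^] n \<otimes> inv (t [^] n)) \<otimes> (a \<otimes> inv u)"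
    unfolding x inv using ac Units_inv_closed[OF un(1)] Units_inv_closed[OF un(2)] Units_closed[OF un(2)]
    by algebra
  also have "\<dots> = a \<otimes> inv u" using un ac by simp
  also have "\<dots> \<in> D" using x u D_unit D_props by auto
  finally show ?thesis by blast
qed

lemma tpow_mult_mono: "\<lbrakk>t [^] (n::nat) \<otimes> x \<in> D; x \<in> carrier L; n \<le> m\<rbrakk> \<Longrightarrow> t [^] m \<otimes> x \<in> D"
  using tpow_add[of x "m - n" n] tpow_D D_props(6) by simp

lemma fractions_common_denom:
  "set Ks \<subseteq> fractions L D \<Longrightarrow> \<exists>n::nat. \<forall>x\<in>set Ks. t [^] n \<otimes> x \<in> D"
proof (induction Ks)
  case (Cons k Ks)
  then obtain n m :: nat where "\<forall>x\<in>set Ks. t [^] n \<otimes> x \<in> D" "t [^] m \<otimes> k \<in> D"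
    using fractions_denom by force
  then have "\<forall>x\<in>set (k # Ks). t [^] (max n m) \<otimes> x \<in> D"
    using tpow_mult_mono Cons.prems subfieldE(3)[OF fractions_subfield] by (auto simp: subset_iff)
  then show ?case by blast
qed auto

lemma combine_scale:
  assumes "c \<in> carrier L" "set Ks \<subseteq> carrier L" "set Us \<subseteq> carrier L"
  shows "combine (map (\<lambda>k. c \<otimes> k) Ks) Us = c \<otimes> combine Ks Us"
  using assms
proof (induction Ks Us rule: combine.induct)
  case (1 k Ks u Us)
  then show ?case by (simp add: r_distr m_assoc)
qed auto

text \<open>A relation over the fraction field becomes a relation over \<open>D\<close> after
  multiplication by a power of t. So a \<open>D\<close>-independent list of length dim L is a basis
  of \<open>L\<close>, and clearing the denominators of the coordinates of x gives the claim. It is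
  applied to 1, \<alpha>, \<alpha>^2 and to the basis of a cubic ring.\<close>

lemma rank_dense:
  assumes dim: "dimension (length Us) (fractions L D) (carrier L)"
    and Us: "set Us \<subseteq> carrier L"
    and ind: "\<And>Ks. \<lbrakk>set Ks \<subseteq> D; length Ks = length Us; combine Ks Us = \<zero>\<rbrakk> \<Longrightarrow> set Ks \<subseteq> {\<zero>}"
    and x: "x \<in> carrier L"
  shows "\<exists>n::nat. \<exists>Ks. set Ks \<subseteq> D \<and> length Ks = length Us \<and> t [^] n \<otimes> x = combine Ks Us"
proof -
  let ?K = "fractions L D"
  note sf = fractions_subfield
  have Kc: "?K \<subseteq> carrier L" using subfieldE(3)[OF sf] .
  have "independent ?K Us"
  proof (rule trivial_combine_imp_independent[OF sf Us])
    fix Ks assume Ks: "set Ks \<subseteq> ?K" "combine Ks Us = \<zero>"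
    \<comment> \<open>\<open>combine\<close> stops at the shorter list, so a relation may come with
      any number of coefficients; padding with zeros and truncating gives exactly one per
      vector.\<close>
    define Ks' where "Ks' = take (length Us) (Ks @ replicate (length Us) \<zero>)"
    have z: "\<zero> \<in> ?K" using subringE(2)[OF subfieldE(1)[OF sf]] .
    have Ks': "set Ks' \<subseteq> ?K" using Ks z set_take_subset[of "length Us" "Ks @ replicate (length Us) \<zero>"]
      unfolding Ks'_def by fastforce
    have len: "length Ks' = length Us" by (simp add: Ks'_def)
    have "combine Ks' Us = \<zero>"
      unfolding Ks'_def combine_take combine_append_replicate[OF Us] by (rule Ks(2))
    obtain n :: nat where n: "\<forall>k\<in>set Ks'. t [^] n \<otimes> k \<in> D" using fractions_common_denom[OF Ks'] by blast
    have "combine (map (\<lambda>k. t [^] n \<otimes> k) Ks') Us = \<zero>"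
      using combine_scale[of "t [^] n" Ks' Us] Ks' Kc Us \<open>combine Ks' Us = \<zero>\<close> by auto
    then have "set (map (\<lambda>k. t [^] n \<otimes> k) Ks') \<subseteq> {\<zero>}"
      using ind[of "map (\<lambda>k. t [^] n \<otimes> k) Ks'"] n len by auto
    then have "k = \<zero>" if "k \<in> set Ks'" for k
      using that integral[of "t [^] n" k] tpow_nonzero[of n] Ks' Kc by auto
    moreover have "set (take (length Us) Ks) \<subseteq> set Ks'" unfolding Ks'_def by auto
    ultimately show "set (take (length Us) Ks) \<subseteq> {\<zero>}" by blast
  qed
  then have "Span ?K Us = carrier L"
    using independent_length_eq_dimension[OF sf dim] Us by auto
  then obtain Ks where Ks: "set Ks \<subseteq> ?K" "length Ks = length Us" "x = combine Ks Us"
    using Span_eq_combine_set_length_version[OF sf Us] x by auto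
  obtain n :: nat where n: "\<forall>k\<in>set Ks. t [^] n \<otimes> k \<in> D" using fractions_common_denom[OF Ks(1)] by blast
  have "t [^] n \<otimes> x = combine (map (\<lambda>k. t [^] n \<otimes> k) Ks) Us"
    using combine_scale[of "t [^] n" Ks Us] Ks Kc Us by auto
  then show ?thesis using n Ks(2)
    by (intro exI[of _ n] exI[of _ "map (\<lambda>k. t [^] n \<otimes> k) Ks"]) auto
qed

end

section \<open>The integral closure in the unramified case\<close>

text \<open>\<open>A_prime\<close> records the maximal ideal tA of \<open>A\<close> through its
  primality; \<open>gen_ex\<close> and \<open>indep\<close> record the cubic residue extension,
  where D + tA is the preimage of k in \<open>A\<close>.\<close>

locale nonramified_cubic = dvr_in_field +
  fixes A :: "'a set"
  assumes dim3: "dimension 3 (fractions L D) (carrier L)"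
    and A_sub: "subring A L" and D_A: "D \<subseteq> A"
    and A_prime: "\<lbrakk>x \<in> A; y \<in> A; x \<otimes> y \<in> t <# A\<rbrakk> \<Longrightarrow> x \<in> t <# A \<or> y \<in> t <# A"
    and gen_ex: "\<exists>\<alpha>\<in>A. \<alpha> \<notin> D <+>\<^bsub>L\<^esub> (t <# A)"
    and indep: "\<lbrakk>\<alpha> \<in> A; \<alpha> \<notin> D <+>\<^bsub>L\<^esub> (t <# A); a \<in> D; b \<in> D; c \<in> D;
          a \<oplus> b \<otimes> \<alpha> \<oplus> c \<otimes> (\<alpha> \<otimes> \<alpha>) \<in> t <# A\<rbrakk> \<Longrightarrow> a \<in> t <# D \<and> b \<in> t <# D \<and> c \<in> t <# D"
begin

text \<open>These are the elements whose residue generates \<open>A/tA\<close> over k: the residue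
  lies outside k, and an extension of degree 3 has no intermediate field.\<close>

definition generator :: "'a \<Rightarrow> bool" where
  "generator \<alpha> \<longleftrightarrow> \<alpha> \<in> A \<and> \<alpha> \<notin> D <+>\<^bsub>L\<^esub> (t <# A)"

definition comb :: "'a \<Rightarrow> 'a \<Rightarrow> 'a \<Rightarrow> 'a \<Rightarrow> 'a" where
  "comb \<alpha> a b c = a \<oplus> b \<otimes> \<alpha> \<oplus> c \<otimes> (\<alpha> \<otimes> \<alpha>)"

lemmas A_props = subringE[OF A_sub]

lemma A_carrier: "x \<in> A \<Longrightarrow> x \<in> carrier L"
  using A_props(1) by auto

lemma D_in_A: "x \<in> D \<Longrightarrow> x \<in> A"
  using D_A by auto

lemma tpow_A: "t [^] (n::nat) \<in> A"
  using tpow_D D_in_A by auto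

lemma generator_A: "generator \<alpha> \<Longrightarrow> \<alpha> \<in> A"
  by (simp add: generator_def)

lemma comb_A: "\<lbrakk>generator \<alpha>; a \<in> D; b \<in> D; c \<in> D\<rbrakk> \<Longrightarrow> comb \<alpha> a b c \<in> A"
  by (auto simp: comb_def A_props D_in_A generator_A)

lemma comb_scale:
  assumes "generator \<alpha>" "a \<in> D" "b \<in> D" "c \<in> D" "x \<in> carrier L"
  shows "x \<otimes> comb \<alpha> a b c = comb \<alpha> (x \<otimes> a) (x \<otimes> b) (x \<otimes> c)"
  using assms D_carrier A_carrier[OF generator_A[OF assms(1)]] unfolding comb_def
  by (simp add: r_distr m_assoc)

section \<open>Coordinates with respect to 1, \<alpha>, \<alpha>^2\<close>

lemma indepD:
  assumes "generator \<alpha>" "a \<in> D" "b \<in> D" "c \<in> D" "comb \<alpha> a b c \<in> t <# A"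
  shows "a \<in> t <# D" "b \<in> t <# D" "c \<in> t <# D"
  using indep[OF _ _ assms(2-4)] assms(1,5) unfolding comb_def generator_def by blast+

lemma one_notin_tA: "\<one> \<notin> t <# A"
proof
  assume 1: "\<one> \<in> t <# A"
  obtain \<alpha> where \<alpha>: "generator \<alpha>" using gen_ex unfolding generator_def by auto
  have "comb \<alpha> \<one> \<zero> \<zero> = \<one>" using A_carrier[OF generator_A[OF \<alpha>]] by (simp add: comb_def)
  then show False using indepD(1)[OF \<alpha>, of \<one> \<zero> \<zero>] 1 D_props one_notin by auto
qed

text \<open>Independence modulo t yields one factor t in every coordinate; this factor is cancelled
  in \<open>L\<close>, which leaves the same statement for the next smaller exponent.\<close>

lemma coords_divisible:
  assumes \<alpha>: "generator \<alpha>"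
  shows "\<lbrakk>a \<in> D; b \<in> D; c \<in> D; comb \<alpha> a b c \<in> t [^] (n::nat) <# A\<rbrakk> \<Longrightarrow>
    a \<in> t [^] n <# D \<and> b \<in> t [^] n <# D \<and> c \<in> t [^] n <# D"
proof (induction n arbitrary: a b c)
  case 0
  then show ?case using D_carrier by (auto simp: mem_l_coset)
next
  case (Suc n)
  obtain x where x: "x \<in> A" "comb \<alpha> a b c = t \<otimes> (t [^] n \<otimes> x)"
    using Suc.prems(4) tpow_Suc A_carrier unfolding mem_l_coset by metis
  have "comb \<alpha> a b c \<in> t <# A" using x tpow_A A_props by (auto simp: mem_l_coset)
  then obtain a' b' c' where *: "a' \<in> D" "b' \<in> D" "c' \<in> D" "a = t \<otimes> a'" "b = t \<otimes> b'" "c = t \<otimes> c'"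
    using indepD[OF \<alpha> Suc.prems(1-3)] unfolding mem_l_coset by metis
  have "t \<otimes> comb \<alpha> a' b' c' = t \<otimes> (t [^] n \<otimes> x)"
    using x(2) comb_scale[OF \<alpha> *(1-3)] * by simp
  then have "comb \<alpha> a' b' c' = t [^] n \<otimes> x"
    using t_cancel comb_A[OF \<alpha> *(1-3)] A_carrier x(1) by simp
  then have "comb \<alpha> a' b' c' \<in> t [^] n <# A" using x(1) by (auto simp: mem_l_coset)
  from Suc.IH[OF *(1-3) this] show ?case
    using * tpow_Suc D_carrier unfolding mem_l_coset by metis
qed

text \<open>A nonzero d = t^n u with u outside tD is not in t^(n+1) D, since cancelling t^n would
  put u into tD.\<close>

lemma D_separated:
  assumes "d \<in> D" "\<And>n::nat. d \<in> t [^] n <# D"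
  shows "d = \<zero>"
proof (rule ccontr)
  assume "d \<noteq> \<zero>"
  then obtain n :: nat and u where u: "u \<in> D" "u \<notin> t <# D" "d = t [^] n \<otimes> u"
    using D_val assms(1) by blast
  obtain e where e: "e \<in> D" "d = t [^] Suc n \<otimes> e" using assms(2)[of "Suc n"] by (auto simp: mem_l_coset)
  have "t [^] n \<otimes> u = t [^] n \<otimes> (t \<otimes> e)" using u e D_carrier tpow_add[of e n 1] by simp
  then have "u = t \<otimes> e" using tpow_cancel[of u "t \<otimes> e" n] u e D_carrier by simp
  then show False using u e by (auto simp: mem_l_coset)
qed

lemma zero_in_tpowA: "\<zero> \<in> t [^] (n::nat) <# A"
  using A_props(2) by (force simp: mem_l_coset)

text \<open>Zero lies in t^n A for every n, so each coordinate is divisible by every power of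
  t.\<close>

lemma comb_eq_zero:
  assumes "generator \<alpha>" "a \<in> D" "b \<in> D" "c \<in> D" "comb \<alpha> a b c = \<zero>"
  shows "a = \<zero>" "b = \<zero>" "c = \<zero>"
proof -
  have "a \<in> t [^] n <# D \<and> b \<in> t [^] n <# D \<and> c \<in> t [^] n <# D" for n :: nat
    using coords_divisible[OF assms(1-4)] zero_in_tpowA assms(5) by simp
  then show "a = \<zero>" "b = \<zero>" "c = \<zero>" using D_separated assms(2-4) by blast+
qed

lemma combine3: "combine [a, b, c] [x, y, z] = a \<otimes> x \<oplus> (b \<otimes> y \<oplus> (c \<otimes> z \<oplus> \<zero>))"
  by simp

lemma list3: "length Ks = 3 \<longleftrightarrow> (\<exists>a b c. Ks = [a, b, c])"
  by (auto simp: numeral_3_eq_3 length_Suc_conv)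

lemma span_tpow:
  assumes \<alpha>: "generator \<alpha>" and x: "x \<in> carrier L"
  shows "\<exists>n::nat. \<exists>a\<in>D. \<exists>b\<in>D. \<exists>c\<in>D. t [^] n \<otimes> x = comb \<alpha> a b c"
proof -
  have ac: "\<alpha> \<in> carrier L" using \<alpha> generator_A A_carrier by auto
  have eq: "combine [a, b, c] [\<one>, \<alpha>, \<alpha> \<otimes> \<alpha>] = comb \<alpha> a b c" if "a \<in> D" "b \<in> D" "c \<in> D" for a b c
    using that D_carrier ac by (simp add: comb_def a_assoc)
  have "\<exists>n::nat. \<exists>Ks. set Ks \<subseteq> D \<and> length Ks = length [\<one>, \<alpha>, \<alpha> \<otimes> \<alpha>] \<and>
      t [^] n \<otimes> x = combine Ks [\<one>, \<alpha>, \<alpha> \<otimes> \<alpha>]"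
  proof (rule rank_dense[OF _ _ _ x])
    show "dimension (length [\<one>, \<alpha>, \<alpha> \<otimes> \<alpha>]) (fractions L D) (carrier L)" using dim3 by (simp add: numeral_3_eq_3)
    show "set [\<one>, \<alpha>, \<alpha> \<otimes> \<alpha>] \<subseteq> carrier L" using ac by auto
  next
    fix Ks assume Ks: "set Ks \<subseteq> D" "length Ks = length [\<one>, \<alpha>, \<alpha> \<otimes> \<alpha>]" "combine Ks [\<one>, \<alpha>, \<alpha> \<otimes> \<alpha>] = \<zero>"
    then obtain a b c where abc: "Ks = [a, b, c]" "a \<in> D" "b \<in> D" "c \<in> D"
      using list3[of Ks] by (auto simp: numeral_3_eq_3)
    show "set Ks \<subseteq> {\<zero>}" using comb_eq_zero[OF \<alpha> abc(2-4)] eq[OF abc(2-4)] Ks abc(1) by auto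
  qed
  then obtain n :: nat and Ks where Ks: "set Ks \<subseteq> D" "length Ks = 3" "t [^] n \<otimes> x = combine Ks [\<one>, \<alpha>, \<alpha> \<otimes> \<alpha>]"
    by (auto simp: numeral_3_eq_3)
  then obtain a b c where abc: "Ks = [a, b, c]" "a \<in> D" "b \<in> D" "c \<in> D"
    using list3[of Ks] by auto
  then show ?thesis using eq[OF abc(2-4)] Ks by metis
qed

lemma denom_A: "x \<in> carrier L \<Longrightarrow> \<exists>n::nat. t [^] n \<otimes> x \<in> A"
proof -
  assume x: "x \<in> carrier L"
  obtain \<alpha> where \<alpha>: "generator \<alpha>" using gen_ex unfolding generator_def by auto
  obtain n :: nat and a b c where "a \<in> D" "b \<in> D" "c \<in> D" "t [^] n \<otimes> x = comb \<alpha> a b c"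
    using span_tpow[OF \<alpha> x] by blast
  then have "t [^] n \<otimes> x \<in> A" using comb_A[OF \<alpha>] by simp
  then show ?thesis ..
qed

text \<open>Some t^n x lies in the \<open>D\<close>-span of 1, \<alpha>, \<alpha>^2. As it also lies
  in t^n A, its coordinates are divisible by t^n, and the denominator disappears.\<close>

lemma A_coords:
  assumes \<alpha>: "generator \<alpha>" and x: "x \<in> A"
  shows "\<exists>a\<in>D. \<exists>b\<in>D. \<exists>c\<in>D. x = comb \<alpha> a b c"
proof -
  obtain n :: nat and a b c where *: "a \<in> D" "b \<in> D" "c \<in> D" "t [^] n \<otimes> x = comb \<alpha> a b c"
    using span_tpow[OF \<alpha> A_carrier[OF x]] by blast
  then have "comb \<alpha> a b c \<in> t [^] n <# A" using x by (metis mem_l_coset)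
  then obtain a' b' c' where **: "a' \<in> D" "b' \<in> D" "c' \<in> D"
      "a = t [^] n \<otimes> a'" "b = t [^] n \<otimes> b'" "c = t [^] n \<otimes> c'"
    using coords_divisible[OF \<alpha> *(1-3)] unfolding mem_l_coset by metis
  have "t [^] n \<otimes> x = t [^] n \<otimes> comb \<alpha> a' b' c'" using * ** comb_scale[OF \<alpha> **(1-3)] by simp
  then have "x = comb \<alpha> a' b' c'" using tpow_cancel x A_carrier comb_A[OF \<alpha> **(1-3)] by blast
  then show ?thesis using ** by blast
qed

section \<open>The valuation and the units of \<open>A\<close>\<close>

lemma A_separated:
  assumes "x \<in> A" "\<And>n::nat. x \<in> t [^] n <# A"
  shows "x = \<zero>"
proof -
  obtain \<alpha> where \<alpha>: "generator \<alpha>" using gen_ex unfolding generator_def by auto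
  obtain a b c where *: "a \<in> D" "b \<in> D" "c \<in> D" "x = comb \<alpha> a b c" using A_coords[OF \<alpha> assms(1)] by blast
  then have "a = \<zero>" "b = \<zero>" "c = \<zero>"
    using coords_divisible[OF \<alpha> *(1-3)] D_separated assms(2) by metis+
  then show ?thesis using * A_carrier[OF generator_A[OF \<alpha>]] by (simp add: comb_def)
qed

text \<open>By separatedness a nonzero x leaves t^n A for some n; the least such n is positive, and
  its predecessor is the valuation of x.\<close>

lemma A_val:
  assumes "x \<in> A" "x \<noteq> \<zero>"
  shows "\<exists>n::nat. \<exists>y\<in>A. y \<notin> t <# A \<and> x = t [^] n \<otimes> y"
proof -
  have ex: "\<exists>n::nat. x \<notin> t [^] n <# A" using A_separated assms by auto
  define n where "n = (LEAST n::nat. x \<notin> t [^] n <# A)"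
  have n: "x \<notin> t [^] n <# A" using LeastI_ex[OF ex] unfolding n_def .
  have less: "x \<in> t [^] m <# A" if "m < n" for m using not_less_Least[OF that[unfolded n_def]] by blast
  have "x = t [^] (0::nat) \<otimes> x" using assms(1) A_carrier by simp
  then have "x \<in> t [^] (0::nat) <# A" using assms(1) unfolding mem_l_coset by blast
  then have "n \<noteq> 0" using n by metis
  then obtain m where m: "n = Suc m" using not0_implies_Suc by auto
  then obtain y where y: "y \<in> A" "x = t [^] m \<otimes> y" using less[of m] unfolding mem_l_coset by auto
  have "y \<notin> t <# A"
  proof
    assume "y \<in> t <# A"
    then obtain z where z: "z \<in> A" "y = t \<otimes> z" by (auto simp: mem_l_coset)
    then have "x = t [^] n \<otimes> z" using y m A_carrier tpow_add[of z m 1] by simp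
    then show False using n z unfolding mem_l_coset by blast
  qed
  then show ?thesis using y by blast
qed

text \<open>The least power of t that brings x into \<open>A\<close> is positive because x is
  outside \<open>A\<close>, and by leastness the result is not divisible by t. The
  \<open>Suc\<close> keeps the one factor t that both applications need.\<close>

lemma not_in_A:
  assumes "x \<in> carrier L" "x \<notin> A"
  shows "\<exists>n::nat. t [^] Suc n \<otimes> x \<in> A \<and> t [^] Suc n \<otimes> x \<notin> t <# A"
proof -
  define n where "n = (LEAST n::nat. t [^] n \<otimes> x \<in> A)"
  have n: "t [^] n \<otimes> x \<in> A" "\<And>m. m < n \<Longrightarrow> t [^] m \<otimes> x \<notin> A"
    using denom_A[OF assms(1)] unfolding n_def by (metis LeastI, metis not_less_Least)
  have "n \<noteq> 0" using n(1) assms by (metis l_one nat_pow_0)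
  then obtain m where m: "n = Suc m" using not0_implies_Suc by auto
  have "t [^] Suc m \<otimes> x \<notin> t <# A"
  proof
    assume "t [^] Suc m \<otimes> x \<in> t <# A"
    then obtain y where y: "y \<in> A" "t [^] Suc m \<otimes> x = t \<otimes> y" by (auto simp: mem_l_coset)
    then have "t [^] m \<otimes> x = y" using t_cancel[of "t [^] m \<otimes> x" y] assms A_carrier by (metis m_closed tpow_Suc tpow_carrier)
    then show False using n(2)[of m] m y by simp
  qed
  then show ?thesis using n m by auto
qed

text \<open>If the inverse of y were outside \<open>A\<close>, some t^(n+1) y^-1 would lie in
  \<open>A\<close> outside tA. Its product with y, which is also outside tA, equals t^(n+1),
  contrary to the primality of tA.\<close>

lemma A_unit:
  assumes y: "y \<in> A" "y \<notin> t <# A"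
  shows "y \<in> Units L" "inv y \<in> A"
proof -
  have "y \<noteq> \<zero>" using y A_props(2) by (auto simp: mem_l_coset)
  then show u: "y \<in> Units L" using y A_carrier by (auto simp: field_Units)
  show "inv y \<in> A"
  proof (rule ccontr)
    assume "inv y \<notin> A"
    then obtain n :: nat where n: "t [^] Suc n \<otimes> inv y \<in> A" "t [^] Suc n \<otimes> inv y \<notin> t <# A"
      using not_in_A[of "inv y"] u by auto
    have "t [^] Suc n \<otimes> inv y \<otimes> y = t \<otimes> t [^] n"
      using u y A_carrier tpow_Suc[of \<one> n] by (simp add: m_assoc del: nat_pow_Suc)
    then have "t [^] Suc n \<otimes> inv y \<otimes> y \<in> t <# A" using tpow_A by (auto simp: mem_l_coset)
    then show False using A_prime n y by blast
  qed
qed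

lemma Units_A: "Units (L\<lparr>carrier := A\<rparr>) = A - (t <# A)"
proof
  show "A - (t <# A) \<subseteq> Units (L\<lparr>carrier := A\<rparr>)"
  proof
    fix y assume "y \<in> A - (t <# A)"
    then have "y \<in> A" "inv y \<in> A" "y \<in> Units L" using A_unit by auto
    then show "y \<in> Units (L\<lparr>carrier := A\<rparr>)"
      unfolding Units_def[of "L\<lparr>carrier := A\<rparr>"]
      by (simp, intro bexI[of _ "inv y"]) simp_all
  qed
  show "Units (L\<lparr>carrier := A\<rparr>) \<subseteq> A - (t <# A)"
  proof
    fix y assume "y \<in> Units (L\<lparr>carrier := A\<rparr>)"
    then obtain z where z: "y \<in> A" "z \<in> A" "y \<otimes> z = \<one>" unfolding Units_def by auto
    moreover have "y \<notin> t <# A"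
    proof
      assume "y \<in> t <# A"
      then obtain w where w: "w \<in> A" "y = t \<otimes> w" by (auto simp: mem_l_coset)
      then have "\<one> = t \<otimes> (w \<otimes> z)" using z A_carrier by (simp add: m_assoc[symmetric])
      moreover have "w \<otimes> z \<in> A" using w z A_props(6) by simp
      ultimately show False using one_notin_tA unfolding mem_l_coset by blast
    qed
    ultimately show "y \<in> A - (t <# A)" by simp
  qed
qed

end

section \<open>Classification of the cubic rings\<close>

context nonramified_cubic
begin

text \<open>The normal form D + t^s \<alpha> D + t^l A. The ring C_r(\<alpha>) is the case s = r, l
  = 2r, and t^k C_r(\<alpha>) + D the case s = k + r, l = k + 2r.\<close>

definition order_set :: "'a \<Rightarrow> nat \<Rightarrow> nat \<Rightarrow> 'a set" where
  "order_set \<alpha> s l = {a \<oplus> t [^] s \<otimes> (b \<otimes> \<alpha>) \<oplus> t [^] l \<otimes> x | a b x. a \<in> D \<and> b \<in> D \<and> x \<in> A}"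

section \<open>Every cubic ring lies between some t^m A and \<open>A\<close>\<close>

lemma combine_denom_A:
  assumes "set Us \<subseteq> carrier L"
  shows "\<exists>N::nat. \<forall>Ks. set Ks \<subseteq> D \<longrightarrow> t [^] N \<otimes> combine Ks Us \<in> A"
  using assms
proof (induction Us)
  case Nil
  then show ?case using A_props(2) by simp
next
  case (Cons u Us)
  then obtain N :: nat where N: "\<And>Ks. set Ks \<subseteq> D \<Longrightarrow> t [^] N \<otimes> combine Ks Us \<in> A" by auto
  obtain n :: nat where n: "t [^] n \<otimes> u \<in> A" using denom_A[of u] Cons.prems by auto
  have "t [^] (n + N) \<otimes> combine Ks (u # Us) \<in> A" if Ks: "set Ks \<subseteq> D" for Ks
  proof (cases Ks)
    case Nil
    then show ?thesis using A_props(2) by simp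
  next
    case (Cons k Ks')
    define y where "y = combine Ks' Us"
    have c: "k \<in> carrier L" "u \<in> carrier L" "y \<in> carrier L" "t [^] n \<in> carrier L" "t [^] N \<in> carrier L"
      using Cons Ks Cons.prems D_carrier \<open>set (u # Us) \<subseteq> carrier L\<close> combine_in_carrier[of Ks' Us]
      unfolding y_def by auto
    have "t [^] (n + N) \<otimes> combine Ks (u # Us) = (t [^] n \<otimes> t [^] N) \<otimes> (k \<otimes> u \<oplus> y)"
      using Cons by (simp add: nat_pow_mult y_def)
    also have "\<dots> = (t [^] N \<otimes> k) \<otimes> (t [^] n \<otimes> u) \<oplus> t [^] n \<otimes> (t [^] N \<otimes> y)"
      using c by algebra
    also have "\<dots> \<in> A"
      using n N[of Ks'] Cons Ks tpow_A A_props D_in_A unfolding y_def by auto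
    finally show ?thesis .
  qed
  then show ?case by blast
qed

lemma pow_notin_tA: "\<lbrakk>w \<in> A; w \<notin> t <# A\<rbrakk> \<Longrightarrow> w [^] (k::nat) \<in> A \<and> w [^] k \<notin> t <# A"
proof (induction k)
  case 0
  then show ?case using A_props(3) one_notin_tA by simp
next
  case (Suc k)
  then show ?case using A_prime[of "w [^] k" w] A_props(6) by auto
qed

text \<open>A finite basis bounds denominators: t^N B is contained in \<open>A\<close> for one N.
  For x in \<open>B\<close> outside \<open>A\<close>, some t^(n+1) x lies in \<open>A\<close>
  outside tA, and so do all its powers by primality. The power with exponent N + 1, however, is
  divisible by t, because t^N already clears x^(N+1).\<close>

lemma cubic_ring_subset_A:
  assumes B: "cubic_ring L D B"
  shows "B \<subseteq> A"
proof (rule subsetI, rule ccontr)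
  fix x assume x: "x \<in> B" "x \<notin> A"
  have sB: "subring B L" using B by (simp add: cubic_ring_def)
  obtain Us where Us: "set Us \<subseteq> carrier L" and
      bij: "bij_betw (\<lambda>Ks. combine Ks Us) {Ks. set Ks \<subseteq> D \<and> length Ks = 3} B"
    using B by (auto simp: cubic_ring_def free_of_rank_def)
  obtain N :: nat where N: "\<And>Ks. set Ks \<subseteq> D \<Longrightarrow> t [^] N \<otimes> combine Ks Us \<in> A"
    using combine_denom_A[OF Us] by blast
  have NB: "t [^] N \<otimes> y \<in> A" if "y \<in> B" for y
    using that N bij unfolding bij_betw_def by auto
  have xc: "x \<in> carrier L" using x subringE(1)[OF sB] by auto
  obtain n :: nat where n: "t [^] Suc n \<otimes> x \<in> A" "t [^] Suc n \<otimes> x \<notin> t <# A"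
    using not_in_A[OF xc x(2)] by blast
  define y where "y = x [^] Suc N"
  have yB: "x [^] k \<in> B" for k :: nat
    by (induction k) (auto simp: subringE[OF sB] x)
  then have y: "y \<in> B" "y \<in> carrier L" unfolding y_def using xc yB[of "Suc N"] by (simp_all del: nat_pow_Suc)
  have "(t [^] Suc n \<otimes> x) [^] Suc N = t [^] (Suc n * Suc N) \<otimes> y"
    unfolding y_def using xc by (simp only: nat_pow_distrib nat_pow_pow tpow_carrier t_carrier)
  \<comment> \<open>The last N factors t bring x^(N+1) into \<open>A\<close>; the leading 1 is the
    factor t left over.\<close>
  also have "Suc n * Suc N = 1 + (n * Suc N) + N" by simp
  also have "t [^] (1 + (n * Suc N) + N) \<otimes> y = t [^] (1 + n * Suc N) \<otimes> (t [^] N \<otimes> y)"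
    using y(2) by (rule tpow_add)
  also have "\<dots> = t \<otimes> (t [^] (n * Suc N) \<otimes> (t [^] N \<otimes> y))"
    using tpow_Suc[of "t [^] N \<otimes> y" "n * Suc N"] y(2) by simp
  finally have "(t [^] Suc n \<otimes> x) [^] Suc N \<in> t <# A"
    using NB[OF y(1)] tpow_A A_props(6) unfolding mem_l_coset by blast
  then show False using pow_notin_tA[OF n] by blast
qed

text \<open>As 1, \<alpha>, \<alpha>^2 span \<open>A\<close> over \<open>D\<close>, three
  memberships suffice.\<close>

lemma tpow_ideal_subset:
  assumes \<alpha>: "generator \<alpha>" and sB: "subring B L" and DB: "D \<subseteq> B"
    and "t [^] (n::nat) \<in> B" "t [^] n \<otimes> \<alpha> \<in> B" "t [^] n \<otimes> (\<alpha> \<otimes> \<alpha>) \<in> B"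
  shows "t [^] n <# A \<subseteq> B"
proof
  fix x assume "x \<in> t [^] n <# A"
  then obtain y where y: "y \<in> A" "x = t [^] n \<otimes> y" by (auto simp: mem_l_coset)
  obtain a b c where *: "a \<in> D" "b \<in> D" "c \<in> D" "y = comb \<alpha> a b c" using A_coords[OF \<alpha> y(1)] by blast
  have c: "a \<in> carrier L" "b \<in> carrier L" "c \<in> carrier L" "\<alpha> \<in> carrier L" "t [^] n \<in> carrier L"
    using * D_carrier A_carrier generator_A[OF \<alpha>] by auto
  have "x = a \<otimes> t [^] n \<oplus> b \<otimes> (t [^] n \<otimes> \<alpha>) \<oplus> c \<otimes> (t [^] n \<otimes> (\<alpha> \<otimes> \<alpha>))"
    unfolding y(2) *(4) comb_def using c by algebra
  moreover have "a \<in> B" "b \<in> B" "c \<in> B" using * DB by auto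
  ultimately show "x \<in> B" using assms(4-6) subringE(6,7)[OF sB] by simp
qed

text \<open>The \<open>D\<close>-basis of \<open>B\<close> has length 3, so a power of t moves any
  given element of \<open>L\<close> into \<open>B\<close>. A common exponent for \<alpha> and
  \<alpha>^2 then works for all of \<open>A\<close>.\<close>

lemma cubic_ring_conductor:
  assumes B: "cubic_ring L D B"
  shows "\<exists>m::nat. t [^] m <# A \<subseteq> B"
proof -
  have sB: "subring B L" and DB: "D \<subseteq> B" using B by (auto simp: cubic_ring_def)
  note B_props = subringE[OF sB]
  obtain Us where Us: "set Us \<subseteq> carrier L" "length Us = 3" and
      bij: "bij_betw (\<lambda>Ks. combine Ks Us) {Ks. set Ks \<subseteq> D \<and> length Ks = 3} B"
    using B by (auto simp: cubic_ring_def free_of_rank_def)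
  have dense: "\<exists>n::nat. t [^] n \<otimes> x \<in> B" if x: "x \<in> carrier L" for x
  proof -
    have "\<exists>n::nat. \<exists>Ks. set Ks \<subseteq> D \<and> length Ks = length Us \<and> t [^] n \<otimes> x = combine Ks Us"
    proof (rule rank_dense[OF _ Us(1) _ x])
      show "dimension (length Us) (fractions L D) (carrier L)" using dim3 Us by simp
      fix Ks assume Ks: "set Ks \<subseteq> D" "length Ks = length Us" "combine Ks Us = \<zero>"
      have "combine (replicate 3 \<zero>) Us = \<zero>"
        using combine_replicate[OF Us(1)] Us by simp
      moreover have "set (replicate 3 \<zero>) \<subseteq> D" using D_props(2) by simp
      ultimately have "Ks = replicate 3 \<zero>"
        using inj_onD[OF bij_betw_imp_inj_on[OF bij], of Ks "replicate 3 \<zero>"] Ks Us by auto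
      then show "set Ks \<subseteq> {\<zero>}" by simp
    qed
    then obtain n :: nat and Ks where "set Ks \<subseteq> D" "length Ks = 3" "t [^] n \<otimes> x = combine Ks Us"
      using Us(2) by auto
    then have "t [^] n \<otimes> x \<in> B" using bij_betw_imp_surj_on[OF bij] by auto
    then show ?thesis ..
  qed
  obtain \<alpha> where \<alpha>: "generator \<alpha>" using gen_ex unfolding generator_def by auto
  have ac: "\<alpha> \<in> carrier L" using A_carrier generator_A[OF \<alpha>] by auto
  obtain n1 n2 :: nat where n: "t [^] n1 \<otimes> \<alpha> \<in> B" "t [^] n2 \<otimes> (\<alpha> \<otimes> \<alpha>) \<in> B"
    using dense[of \<alpha>] dense[of "\<alpha> \<otimes> \<alpha>"] ac by auto
  have tB: "t [^] (n::nat) \<in> B" for n using tpow_D DB by auto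
  have "t [^] (n1 + n2) \<otimes> \<alpha> \<in> B" using n(1) tB[of n2] ac B_props(6) tpow_add[of \<alpha> n2 n1] by (simp add: add.commute)
  moreover have "t [^] (n1 + n2) \<otimes> (\<alpha> \<otimes> \<alpha>) \<in> B"
    using n(2) tB[of n1] ac B_props(6) tpow_add[of "\<alpha> \<otimes> \<alpha>" n1 n2] by simp
  ultimately show ?thesis using tpow_ideal_subset[OF \<alpha> sB DB tB] by blast
qed

text \<open>The condition s \<le> l lets the \<alpha>-component of t^l A be absorbed into t^s
  \<alpha> D, which makes the coordinates independent of each other.\<close>

lemma order_set_coords:
  assumes \<alpha>: "generator \<alpha>" and sl: "s \<le> l"
  shows "x \<in> order_set \<alpha> s l \<longleftrightarrow> (\<exists>a\<in>D. \<exists>b\<in>D. \<exists>c\<in>D. x = comb \<alpha> a (t [^] s \<otimes> b) (t [^] l \<otimes> c))"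
proof
  have ac: "\<alpha> \<in> carrier L" using A_carrier generator_A[OF \<alpha>] by auto
  assume "x \<in> order_set \<alpha> s l"
  then obtain a b y where *: "a \<in> D" "b \<in> D" "y \<in> A" "x = a \<oplus> t [^] s \<otimes> (b \<otimes> \<alpha>) \<oplus> t [^] l \<otimes> y"
    unfolding order_set_def by blast
  obtain a' b' c' where **: "a' \<in> D" "b' \<in> D" "c' \<in> D" "y = comb \<alpha> a' b' c'" using A_coords[OF \<alpha> *(3)] by blast
  define S U where "S = t [^] s" and "U = t [^] (l - s)"
  have l: "t [^] l = S \<otimes> U" unfolding S_def U_def using sl by (simp add: nat_pow_mult)
  have c: "S \<in> carrier L" "U \<in> carrier L" "a \<in> carrier L" "b \<in> carrier L"
    "a' \<in> carrier L" "b' \<in> carrier L" "c' \<in> carrier L"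
    using * ** D_carrier by (auto simp: S_def U_def)
  have "x = comb \<alpha> (a \<oplus> t [^] l \<otimes> a') (t [^] s \<otimes> (b \<oplus> U \<otimes> b')) (t [^] l \<otimes> c')"
    unfolding *(4) **(4) comb_def l S_def[symmetric] using c ac by algebra
  moreover have "a \<oplus> t [^] l \<otimes> a' \<in> D" "b \<oplus> U \<otimes> b' \<in> D"
    using * ** D_props tpow_D by (auto simp: U_def)
  ultimately show "\<exists>a\<in>D. \<exists>b\<in>D. \<exists>c\<in>D. x = comb \<alpha> a (t [^] s \<otimes> b) (t [^] l \<otimes> c)" using **(3) by blast
next
  have ac: "\<alpha> \<in> carrier L" using A_carrier generator_A[OF \<alpha>] by auto
  assume "\<exists>a\<in>D. \<exists>b\<in>D. \<exists>c\<in>D. x = comb \<alpha> a (t [^] s \<otimes> b) (t [^] l \<otimes> c)"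
  then obtain a b c where *: "a \<in> D" "b \<in> D" "c \<in> D" "x = comb \<alpha> a (t [^] s \<otimes> b) (t [^] l \<otimes> c)" by blast
  have "x = a \<oplus> t [^] s \<otimes> (b \<otimes> \<alpha>) \<oplus> t [^] l \<otimes> (c \<otimes> (\<alpha> \<otimes> \<alpha>))"
    unfolding *(4) comb_def using * ac D_carrier by (simp add: m_assoc)
  moreover have "c \<otimes> (\<alpha> \<otimes> \<alpha>) \<in> A" using * D_in_A generator_A[OF \<alpha>] A_props(6) by simp
  ultimately show "x \<in> order_set \<alpha> s l" using * unfolding order_set_def by blast
qed

text \<open>Comparing coordinates at \<alpha> would give t^m in t^(m+1) D, hence 1 in tD.
  Consequently a ring containing t^m A is not contained in D + t^(m+1) A, which bounds s in the
  classification.\<close>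

lemma tpow_generator_notin:
  assumes \<alpha>: "generator \<alpha>"
  shows "t [^] (m::nat) \<otimes> \<alpha> \<notin> D <+>\<^bsub>L\<^esub> (t [^] Suc m <# A)"
proof
  assume "t [^] m \<otimes> \<alpha> \<in> D <+>\<^bsub>L\<^esub> (t [^] Suc m <# A)"
  then obtain d x where dx: "d \<in> D" "x \<in> A" "t [^] m \<otimes> \<alpha> = d \<oplus> t [^] Suc m \<otimes> x"
    by (auto simp: mem_set_add mem_l_coset)
  have c: "d \<in> carrier L" "t [^] Suc m \<otimes> x \<in> carrier L" "\<alpha> \<in> carrier L"
    using dx D_carrier A_carrier generator_A[OF \<alpha>] by (auto simp del: nat_pow_Suc)
  have "comb \<alpha> (\<ominus> d) (t [^] m) \<zero> = \<ominus> d \<oplus> t [^] m \<otimes> \<alpha>" using c by (simp add: comb_def)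
  also have "\<dots> = t [^] Suc m \<otimes> x" unfolding dx(3) using c by algebra
  finally have "comb \<alpha> (\<ominus> d) (t [^] m) \<zero> \<in> t [^] Suc m <# A" using dx(2) by (auto simp: mem_l_coset)
  then have "t [^] m \<in> t [^] Suc m <# D"
    using coords_divisible[OF \<alpha> D_props(5)[OF dx(1)] tpow_D D_props(2)] by blast
  then obtain e where e: "e \<in> D" "t [^] m = t [^] Suc m \<otimes> e" unfolding mem_l_coset by blast
  then have "t [^] m \<otimes> \<one> = t [^] m \<otimes> (t \<otimes> e)" using D_carrier by (simp add: m_assoc)
  from tpow_cancel[OF _ _ this] have "\<one> = t \<otimes> e" using e(1) D_carrier by simp
  then have "\<one> \<in> t <# D" using e(1) unfolding mem_l_coset by blast
  then show False using one_notin by blast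
qed

lemma D_tpowI: "\<lbrakk>d \<in> D; a \<in> A\<rbrakk> \<Longrightarrow> d \<oplus> t [^] (n::nat) \<otimes> a \<in> D <+>\<^bsub>L\<^esub> (t [^] n <# A)"
  by (rule set_addI[OF _ l_cosetI])

lemma D_tpowE:
  assumes "x \<in> D <+>\<^bsub>L\<^esub> (t [^] (n::nat) <# A)"
  obtains d a where "d \<in> D" "a \<in> A" "x = d \<oplus> t [^] n \<otimes> a"
  using assms that by (elim set_addE l_cosetE) simp

text \<open>The delicate inclusion is that of \<open>B\<close> in the normal form: removing from an
  element of \<open>B\<close> its components along 1 and t^s \<beta> leaves a multiple of \<beta>^2
  in \<open>B\<close>, and t^l has to divide it.\<close>

lemma classification:
  assumes sB: "subring B L" and DB: "D \<subseteq> B" and BA: "B \<subseteq> A" and mB: "t [^] (m::nat) <# A \<subseteq> B"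
  shows "\<exists>\<alpha> s l. generator \<alpha> \<and> s \<le> l \<and> l \<le> 2 * s \<and> l \<le> m \<and> B = order_set \<alpha> s l"
proof -
  note B_props = subringE[OF sB]
  have tB: "t [^] (n::nat) \<in> B" for n using tpow_D DB by auto
  define P where "P j \<longleftrightarrow> B \<subseteq> D <+>\<^bsub>L\<^esub> (t [^] j <# A)" for j :: nat
  obtain \<gamma> where \<gamma>: "generator \<gamma>" using gen_ex unfolding generator_def by auto
  have in_B: "t [^] j \<otimes> x \<in> B" if "t [^] j <# A \<subseteq> B" "x \<in> A" for j :: nat and x
    using that unfolding subset_iff mem_l_coset by blast
  have notP: "\<not> P (Suc j)" if j: "t [^] j <# A \<subseteq> B" for j
    using tpow_generator_notin[OF \<gamma>, of j] in_B[OF j generator_A[OF \<gamma>]] unfolding P_def by blast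
  \<comment> \<open>The first exponent at which the inclusion fails. It holds at 0 and fails at m +
    1, so s' is a successor and its predecessor is the wanted s.\<close>
  define s' where "s' = (LEAST j. \<not> P j)"
  have s': "\<not> P s'" "s' \<le> Suc m"
    using LeastI[of "\<lambda>j. \<not> P j"] Least_le[of "\<lambda>j. \<not> P j"] notP[OF mB] unfolding s'_def by blast+
  have "P 0"
    unfolding P_def
  proof
    fix x assume x: "x \<in> B"
    then have "x = \<zero> \<oplus> t [^] (0::nat) \<otimes> x" "x \<in> A" using B_props(1) BA by auto
    then show "x \<in> D <+>\<^bsub>L\<^esub> (t [^] (0::nat) <# A)"
      using D_tpowI[OF D_props(2), of x 0] by argo
  qed
  then obtain s where s: "s' = Suc s" using s'(1) not0_implies_Suc by metis
  have Ps: "P s" using not_less_Least[of s "\<lambda>j. \<not> P j"] s unfolding s'_def by auto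
  obtain b where b: "b \<in> B" "b \<notin> D <+>\<^bsub>L\<^esub> (t [^] Suc s <# A)" using s'(1) s unfolding P_def by blast
  obtain d \<beta> where d: "d \<in> D" "\<beta> \<in> A" "b = d \<oplus> t [^] s \<otimes> \<beta>"
    using Ps b(1) D_tpowE[of b s] unfolding P_def by blast
  have c: "d \<in> carrier L" "\<beta> \<in> carrier L" using d D_carrier A_carrier by auto
  \<comment> \<open>If the residue of \<beta> lay in k, the \<open>D\<close>-part of \<beta> could
    be moved into d, and b would belong to D + t^(s+1) A.\<close>
  have \<beta>: "generator \<beta>"
  proof (rule ccontr)
    assume "\<not> generator \<beta>"
    then have "\<beta> \<in> D <+>\<^bsub>L\<^esub> (t [^] (1::nat) <# A)" using d(2) unfolding generator_def by simp
    then obtain d' x where dx: "d' \<in> D" "x \<in> A" "\<beta> = d' \<oplus> t \<otimes> x" by (elim D_tpowE) simp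
    have c': "d' \<in> carrier L" "x \<in> carrier L" "t [^] s \<in> carrier L" using dx D_carrier A_carrier by auto
    have "b = (d \<oplus> t [^] s \<otimes> d') \<oplus> (t [^] s \<otimes> t) \<otimes> x"
      unfolding d(3) dx(3) using c(1) c' t_carrier by algebra
    then have "b = (d \<oplus> t [^] s \<otimes> d') \<oplus> t [^] Suc s \<otimes> x" by simp
    moreover have "d \<oplus> t [^] s \<otimes> d' \<in> D" using d dx D_props tpow_D by simp
    ultimately show False using b(2) D_tpowI[OF _ dx(2), of _ "Suc s"] by metis
  qed
  have \<beta>B: "t [^] s \<otimes> \<beta> \<in> B"
  proof -
    have "t [^] s \<otimes> \<beta> = \<ominus> d \<oplus> b" unfolding d(3) using c by (simp add: r_neg1)
    moreover have "d \<in> B" using d DB by auto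
    ultimately show ?thesis using b(1) B_props(5,7) by simp
  qed
  define l where "l = (LEAST j::nat. t [^] j <# A \<subseteq> B)"
  have lB: "t [^] l <# A \<subseteq> B" and lm: "l \<le> m" and l_le: "\<And>j. t [^] j <# A \<subseteq> B \<Longrightarrow> l \<le> j"
    unfolding l_def by (rule LeastI[of "\<lambda>j. t [^] j <# A \<subseteq> B", OF mB],
        rule Least_le[of "\<lambda>j. t [^] j <# A \<subseteq> B", OF mB], rule Least_le[of "\<lambda>j. t [^] j <# A \<subseteq> B"])
  have "l \<le> 2 * s"
  proof (rule l_le, rule tpow_ideal_subset[OF \<beta> sB DB tB])
    have "t [^] (2 * s) \<otimes> \<beta> = t [^] s \<otimes> (t [^] s \<otimes> \<beta>)" using tpow_add[of \<beta> s s] c by (simp add: mult_2)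
    then show "t [^] (2 * s) \<otimes> \<beta> \<in> B" using \<beta>B tB B_props(6) by simp
    have cS: "t [^] s \<in> carrier L" by simp
    have "t [^] (2 * s) \<otimes> (\<beta> \<otimes> \<beta>) = t [^] s \<otimes> (t [^] s \<otimes> (\<beta> \<otimes> \<beta>))"
      using tpow_add[of "\<beta> \<otimes> \<beta>" s s] c by (simp add: mult_2)
    also have "\<dots> = (t [^] s \<otimes> \<beta>) \<otimes> (t [^] s \<otimes> \<beta>)" using c cS by algebra
    finally show "t [^] (2 * s) \<otimes> (\<beta> \<otimes> \<beta>) \<in> B" using \<beta>B B_props(6) by simp
  qed
  \<comment> \<open>Otherwise l + 1 \<le> s, and \<open>B\<close> would lie in D + t^(l+1) A
    although it contains t^l \<gamma> for the generator \<gamma>.\<close>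
  moreover have "s \<le> l"
  proof (rule ccontr)
    assume "\<not> s \<le> l"
    then have "Suc l < s'" using s by simp
    then have "P (Suc l)" using not_less_Least[of "Suc l" "\<lambda>j. \<not> P j"] unfolding s'_def by blast
    then show False using notP[OF lB] by blast
  qed
  moreover have "B = order_set \<beta> s l"
  proof
    show "order_set \<beta> s l \<subseteq> B"
    proof
      fix x assume "x \<in> order_set \<beta> s l"
      then obtain a e y where *: "a \<in> D" "e \<in> D" "y \<in> A" "x = a \<oplus> t [^] s \<otimes> (e \<otimes> \<beta>) \<oplus> t [^] l \<otimes> y"
        unfolding order_set_def by blast
      have "t [^] s \<otimes> (e \<otimes> \<beta>) = e \<otimes> (t [^] s \<otimes> \<beta>)" using * c D_carrier by (simp add: m_lcomm)
      then have "t [^] s \<otimes> (e \<otimes> \<beta>) \<in> B" using \<beta>B * DB B_props(6) by auto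
      then show "x \<in> B" using * DB in_B[OF lB *(3)] B_props(7) by auto
    qed
    show "B \<subseteq> order_set \<beta> s l"
    proof
      fix x assume x: "x \<in> B"
      then obtain d' y where dy: "d' \<in> D" "y \<in> A" "x = d' \<oplus> t [^] s \<otimes> y"
        using Ps D_tpowE[of x s] unfolding P_def by blast
      obtain a e f where *: "a \<in> D" "e \<in> D" "f \<in> D" "y = comb \<beta> a e f" using A_coords[OF \<beta> dy(2)] by blast
      define S where "S = t [^] s"
      have cc: "d' \<in> carrier L" "S \<in> carrier L" "a \<in> carrier L" "e \<in> carrier L" "f \<in> carrier L" "x \<in> carrier L"
        using dy * D_carrier x B_props(1) by (auto simp: S_def)
      have xeq: "x = (d' \<oplus> S \<otimes> a) \<oplus> S \<otimes> (e \<otimes> \<beta>) \<oplus> S \<otimes> (f \<otimes> (\<beta> \<otimes> \<beta>))"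
        unfolding dy(3) *(4) comb_def S_def[symmetric] using cc c by algebra
      have D': "d' \<oplus> S \<otimes> a \<in> D" using dy * D_props tpow_D unfolding S_def by simp
      \<comment> \<open>With f = t^j u and u a unit of \<open>D\<close>, cancelling u leaves t^(s+j)
        \<beta>^2 in \<open>B\<close>. Together with t^(s+j) and t^(s+j) \<beta> this places t^(s+j)
        A inside \<open>B\<close>, and leastness gives l \<le> s + j.\<close>
      have ex: "\<exists>z\<in>A. S \<otimes> (f \<otimes> (\<beta> \<otimes> \<beta>)) = t [^] l \<otimes> z"
      proof (cases "f = \<zero>")
        case True
        then show ?thesis using A_props(2) c cc by (intro bexI[of _ \<zero>]) simp_all
      next
        case False
        then obtain j :: nat and u where u: "u \<in> D" "u \<notin> t <# D" "f = t [^] j \<otimes> u"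
          using D_val *(3) by blast
        have iu: "inv u \<in> D" using D_unit u by blast
        have uc: "u \<in> carrier L" "inv u \<in> carrier L" using u(1) iu D_carrier by auto
        have "u \<noteq> \<zero>" using False u(3) by auto
        then have uu: "inv u \<otimes> u = \<one>" using uc field_Units by simp
        have "S \<otimes> (f \<otimes> (\<beta> \<otimes> \<beta>)) = x \<oplus> \<ominus> (d' \<oplus> S \<otimes> a) \<oplus> \<ominus> (e \<otimes> (S \<otimes> \<beta>))"
          unfolding xeq using cc c by algebra
        also have "\<dots> \<in> B" using x D' DB * \<beta>B B_props(5,6,7) unfolding S_def by (auto simp: subset_iff)
        finally have fB: "S \<otimes> (f \<otimes> (\<beta> \<otimes> \<beta>)) \<in> B" .
        have T: "t [^] j \<in> carrier L" by simp
        have "t [^] (s + j) \<otimes> (\<beta> \<otimes> \<beta>) = (inv u \<otimes> u) \<otimes> (S \<otimes> (t [^] j \<otimes> (\<beta> \<otimes> \<beta>)))"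
          unfolding uu S_def using tpow_add[of "\<beta> \<otimes> \<beta>" s j] c by simp
        also have "\<dots> = inv u \<otimes> (S \<otimes> (f \<otimes> (\<beta> \<otimes> \<beta>)))"
          unfolding u(3) using uc cc(2) c(2) T by algebra
        also have "\<dots> \<in> B" using fB iu DB B_props(6) by auto
        finally have B2: "t [^] (s + j) \<otimes> (\<beta> \<otimes> \<beta>) \<in> B" .
        have "t [^] (s + j) \<otimes> \<beta> = t [^] j \<otimes> (t [^] s \<otimes> \<beta>)"
          using tpow_add[of \<beta> j s] c by (simp add: add.commute)
        also have "\<dots> \<in> B" using tB \<beta>B B_props(6) by simp
        finally have "l \<le> s + j" using l_le[OF tpow_ideal_subset[OF \<beta> sB DB tB _ B2]] by blast
        then obtain i where i: "s + j = l + i" using le_Suc_ex by blast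
        have "S \<otimes> (f \<otimes> (\<beta> \<otimes> \<beta>)) = t [^] (s + j) \<otimes> (u \<otimes> (\<beta> \<otimes> \<beta>))"
          unfolding u(3) S_def using tpow_add[of "u \<otimes> (\<beta> \<otimes> \<beta>)" s j] c uc by (simp add: m_assoc)
        also have "\<dots> = t [^] l \<otimes> (t [^] i \<otimes> (u \<otimes> (\<beta> \<otimes> \<beta>)))"
          unfolding i using tpow_add[of "u \<otimes> (\<beta> \<otimes> \<beta>)" l i] c uc by simp
        finally show ?thesis using tpow_A u(1) D_in_A d(2) A_props(6) by blast
      qed
      then obtain z where "z \<in> A" "x = (d' \<oplus> S \<otimes> a) \<oplus> t [^] s \<otimes> (e \<otimes> \<beta>) \<oplus> t [^] l \<otimes> z"
        using xeq unfolding S_def by metis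
      then show "x \<in> order_set \<beta> s l" using D' *(2) unfolding order_set_def by blast
    qed
  qed
  ultimately show ?thesis using \<beta> lm by blast
qed

section \<open>Comparison with the rings C_r(\<alpha>)\<close>

lemma C_ring_eq:
  assumes ac: "\<alpha> \<in> carrier L"
  shows "C_ring L D A t r \<alpha> = order_set \<alpha> r (2 * r)"
proof -
  have eq: "(t [^] r \<otimes> \<alpha>) \<otimes> b = t [^] r \<otimes> (b \<otimes> \<alpha>)" if "b \<in> D" for b
    using that D_carrier ac by (simp add: m_assoc m_comm[of \<alpha> b])
  show ?thesis
  proof
    show "C_ring L D A t r \<alpha> \<subseteq> order_set \<alpha> r (2 * r)"
    proof
      fix w assume "w \<in> C_ring L D A t r \<alpha>"
      then obtain v z where v: "v \<in> D <+>\<^bsub>L\<^esub> ((t [^] r \<otimes> \<alpha>) <#\<^bsub>L\<^esub> D)"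
        and z: "z \<in> t [^] (2 * r) <#\<^bsub>L\<^esub> A" "w = v \<oplus> z"
        unfolding C_ring_def by (rule set_addE)
      from v obtain a y where a: "a \<in> D" "y \<in> (t [^] r \<otimes> \<alpha>) <#\<^bsub>L\<^esub> D" "v = a \<oplus> y"
        by (rule set_addE)
      from a(2) obtain b where b: "b \<in> D" "y = (t [^] r \<otimes> \<alpha>) \<otimes> b" by (rule l_cosetE)
      from z(1) obtain x where x: "x \<in> A" "z = t [^] (2 * r) \<otimes> x" by (rule l_cosetE)
      have "w = a \<oplus> t [^] r \<otimes> (b \<otimes> \<alpha>) \<oplus> t [^] (2 * r) \<otimes> x" using z a b x eq by simp
      then show "w \<in> order_set \<alpha> r (2 * r)" using a(1) b(1) x(1) unfolding order_set_def by blast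
    qed
    show "order_set \<alpha> r (2 * r) \<subseteq> C_ring L D A t r \<alpha>"
    proof
      fix w assume "w \<in> order_set \<alpha> r (2 * r)"
      then obtain a b x where *: "a \<in> D" "b \<in> D" "x \<in> A"
          "w = a \<oplus> t [^] r \<otimes> (b \<otimes> \<alpha>) \<oplus> t [^] (2 * r) \<otimes> x"
        unfolding order_set_def by blast
      then show "w \<in> C_ring L D A t r \<alpha>"
        unfolding C_ring_def *(4) eq[OF *(2), symmetric]
        by (intro set_addI[OF set_addI] l_cosetI)
    qed
  qed
qed

text \<open>Adding \<open>D\<close> swallows t^k D, and the other two exponents grow by k. Solving s
  = k + r and l = k + 2r turns a normal form into the shape demanded by the theorem.\<close>

lemma scaled_C_ring_eq:
  assumes ac: "\<alpha> \<in> carrier L"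
  shows "(t [^] k <#\<^bsub>L\<^esub> C_ring L D A t r \<alpha>) <+>\<^bsub>L\<^esub> D = order_set \<alpha> (k + r) (k + 2 * r)"
proof
  have eq: "t [^] k \<otimes> (a \<oplus> t [^] r \<otimes> (b \<otimes> \<alpha>) \<oplus> t [^] (2 * r) \<otimes> x) \<oplus> d =
      (t [^] k \<otimes> a \<oplus> d) \<oplus> t [^] (k + r) \<otimes> (b \<otimes> \<alpha>) \<oplus> t [^] (k + 2 * r) \<otimes> x"
    if "a \<in> D" "b \<in> D" "x \<in> A" "d \<in> D" for a b x d
  proof -
    define y z T where "y = t [^] r \<otimes> (b \<otimes> \<alpha>)" and "z = t [^] (2 * r) \<otimes> x" and "T = t [^] k"
    have c: "a \<in> carrier L" "d \<in> carrier L" "y \<in> carrier L" "z \<in> carrier L" "T \<in> carrier L"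
      using that ac D_carrier A_carrier by (auto simp: y_def z_def T_def)
    have "t [^] (k + r) \<otimes> (b \<otimes> \<alpha>) = T \<otimes> y" "t [^] (k + 2 * r) \<otimes> x = T \<otimes> z"
      unfolding y_def z_def T_def using that ac D_carrier A_carrier by (simp_all add: tpow_add)
    moreover have "T \<otimes> (a \<oplus> y \<oplus> z) \<oplus> d = (T \<otimes> a \<oplus> d) \<oplus> T \<otimes> y \<oplus> T \<otimes> z" using c by algebra
    ultimately show ?thesis unfolding y_def[symmetric] z_def[symmetric] T_def[symmetric] by simp
  qed
  show "(t [^] k <#\<^bsub>L\<^esub> C_ring L D A t r \<alpha>) <+>\<^bsub>L\<^esub> D \<subseteq> order_set \<alpha> (k + r) (k + 2 * r)"
  proof
    fix w assume "w \<in> (t [^] k <#\<^bsub>L\<^esub> C_ring L D A t r \<alpha>) <+>\<^bsub>L\<^esub> D"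
    then obtain v d where v: "v \<in> order_set \<alpha> r (2 * r)" "d \<in> D" "w = t [^] k \<otimes> v \<oplus> d"
      unfolding C_ring_eq[OF ac] by (elim set_addE l_cosetE) simp
    then obtain a b x where *: "a \<in> D" "b \<in> D" "x \<in> A" "d \<in> D"
        "w = t [^] k \<otimes> (a \<oplus> t [^] r \<otimes> (b \<otimes> \<alpha>) \<oplus> t [^] (2 * r) \<otimes> x) \<oplus> d"
      unfolding order_set_def by blast
    then have "t [^] k \<otimes> a \<oplus> d \<in> D" using D_props tpow_D by simp
    then show "w \<in> order_set \<alpha> (k + r) (k + 2 * r)" using * eq[OF *(1-4)] unfolding order_set_def by blast
  qed
  show "order_set \<alpha> (k + r) (k + 2 * r) \<subseteq> (t [^] k <#\<^bsub>L\<^esub> C_ring L D A t r \<alpha>) <+>\<^bsub>L\<^esub> D"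
  proof
    fix w assume "w \<in> order_set \<alpha> (k + r) (k + 2 * r)"
    then obtain d b x where *: "d \<in> D" "b \<in> D" "x \<in> A"
        "w = d \<oplus> t [^] (k + r) \<otimes> (b \<otimes> \<alpha>) \<oplus> t [^] (k + 2 * r) \<otimes> x"
      unfolding order_set_def by blast
    \<comment> \<open>The summand \<open>D\<close> supplies the constant term, so the element of
      C_r(\<alpha>) is taken with constant term 0.\<close>
    then have w: "w = t [^] k \<otimes> (\<zero> \<oplus> t [^] r \<otimes> (b \<otimes> \<alpha>) \<oplus> t [^] (2 * r) \<otimes> x) \<oplus> d"
      using eq[of \<zero> b x d] D_props(2) D_carrier by simp
    have "\<zero> \<oplus> t [^] r \<otimes> (b \<otimes> \<alpha>) \<oplus> t [^] (2 * r) \<otimes> x \<in> C_ring L D A t r \<alpha>"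
      unfolding C_ring_eq[OF ac] order_set_def using * D_props(2) by blast
    then show "w \<in> (t [^] k <#\<^bsub>L\<^esub> C_ring L D A t r \<alpha>) <+>\<^bsub>L\<^esub> D"
      unfolding w using *(1) by (rule set_addI[OF l_cosetI])
  qed
qed

lemma generator_unit: "generator \<alpha> \<Longrightarrow> \<alpha> \<in> Units (L\<lparr>carrier := A\<rparr>)"
proof -
  assume \<alpha>: "generator \<alpha>"
  have "\<alpha> \<notin> t <# A"
  proof
    assume "\<alpha> \<in> t <# A"
    moreover have "\<alpha> = \<zero> \<oplus> \<alpha>" using A_carrier generator_A[OF \<alpha>] by simp
    ultimately show False using \<alpha> D_props(2) unfolding generator_def mem_set_add by blast
  qed
  then show ?thesis using Units_A generator_A[OF \<alpha>] by simp
qed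

lemma generator_notin_D: "generator \<alpha> \<Longrightarrow> \<alpha> \<notin> D"
proof
  assume \<alpha>: "generator \<alpha>" "\<alpha> \<in> D"
  moreover have "\<zero> \<in> t <# A" using A_props(2) by (force simp: mem_l_coset)
  moreover have "\<alpha> = \<alpha> \<oplus> \<zero>" using A_carrier generator_A[OF \<alpha>(1)] by simp
  ultimately show False unfolding generator_def mem_set_add by blast
qed

lemma over_rings_of_A_ring:
  assumes "over_ring L D (A_ring L D A t m) B"
  shows "\<exists>k r \<alpha>. \<alpha> \<in> Units (L\<lparr>carrier := A\<rparr>) - D \<and> 2 * r + k \<le> m \<and>
    B = (t [^] k <#\<^bsub>L\<^esub> C_ring L D A t r \<alpha>) <+>\<^bsub>L\<^esub> D"
proof -
  have B: "cubic_ring L D B" "A_ring L D A t m \<subseteq> B" using assms by (auto simp: over_ring_def)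
  have sB: "subring B L" "D \<subseteq> B" using B by (auto simp: cubic_ring_def)
  have "t [^] m <# A \<subseteq> B"
  proof
    fix x assume x: "x \<in> t [^] m <# A"
    then have "x \<in> carrier L" using A_carrier by (auto simp: mem_l_coset)
    then have "x = x \<oplus> \<zero>" by simp
    then have "x \<in> A_ring L D A t m" using x D_props(2) unfolding A_ring_def mem_set_add by blast
    then show "x \<in> B" using B by blast
  qed
  from classification[OF sB cubic_ring_subset_A[OF B(1)] this]
  obtain \<alpha> s l where *: "generator \<alpha>" "s \<le> l" "l \<le> 2 * s" "l \<le> m" "B = order_set \<alpha> s l" by blast
  \<comment> \<open>Here r = l - s and k = 2s - l; both natural subtractions are exact because s
    \<le> l \<le> 2s, and 2r + k = l \<le> m.\<close>
  have "(2 * s - l) + (l - s) = s" "(2 * s - l) + 2 * (l - s) = l" using * by auto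
  then have "B = (t [^] (2 * s - l) <#\<^bsub>L\<^esub> C_ring L D A t (l - s) \<alpha>) <+>\<^bsub>L\<^esub> D"
    using scaled_C_ring_eq[of \<alpha> "2 * s - l" "l - s"] A_carrier generator_A[OF *(1)] *(5) by simp
  moreover have "2 * (l - s) + (2 * s - l) \<le> m" using * by auto
  ultimately show ?thesis using generator_unit[OF *(1)] generator_notin_D[OF *(1)] by blast
qed

end

section \<open>A criterion for the embedding dimension\<close>

lemma local_ring_max_ideal:
  assumes "local_ring R" "maximalideal J R"
  shows "max_ideal R = J"
  using assms unfolding local_ring_def max_ideal_def by (metis the1_equality)

lemma (in ring) a_coset_eq_iff:
  assumes I: "ideal I R" and x: "x \<in> carrier R" "y \<in> carrier R"
  shows "I +> x = I +> y \<longleftrightarrow> x \<ominus> y \<in> I"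
proof
  interpret I: ideal I R by fact
  show "x \<ominus> y \<in> I" if "I +> x = I +> y"
    using that I.a_rcos_module_imp[of y x] I.a_rcos_self[of x] x by (auto simp: a_minus_def)
  show "I +> x = I +> y" if "x \<ominus> y \<in> I"
    using I.a_repr_independence'[of x y] I.a_rcos_module_rev[of y x] that x by (simp add: a_minus_def)
qed

context
  fixes R (structure) and J
  assumes cring: "cring R" and J: "maximalideal J R"
begin

interpretation cring R by (rule cring)
interpretation J: maximalideal J R by (rule J)
interpretation I: ideal "J \<cdot> J" R by (rule ideal_prod_is_ideal) (rule J.is_ideal)+

lemma cotangent_add:
  assumes "x \<in> carrier R" "y \<in> carrier R"
  shows "(J \<cdot> J +> x) \<oplus>\<^bsub>cotangent_space R J\<^esub> (J \<cdot> J +> y) = J \<cdot> J +> (x \<oplus> y)"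
  using I.a_rcos_sum[OF assms] by (simp add: cotangent_space_def)

text \<open>Passing to representatives j + a and i + y changes the product by j y + (j + a) i, which
  lies in J^2. Hence the union defining the scalar multiple is a single coset.\<close>

lemma cotangent_smult:
  assumes a: "a \<in> carrier R" and y: "y \<in> J"
  shows "(J +> a) \<odot>\<^bsub>cotangent_space R J\<^esub> (J \<cdot> J +> y) = J \<cdot> J +> (a \<otimes> y)"
proof -
  have yc: "y \<in> carrier R" using y J.Icarr by auto
  have eq: "J \<cdot> J +> (a' \<otimes> y') = J \<cdot> J +> (a \<otimes> y)" if m: "a' \<in> J +> a" "y' \<in> J \<cdot> J +> y" for a' y'
  proof -
    obtain j where j: "j \<in> J" "a' = j \<oplus> a" using m(1) by (auto simp: a_r_coset_def')
    obtain i where i: "i \<in> J \<cdot> J" "y' = i \<oplus> y" using m(2) by (auto simp: a_r_coset_def')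
    have c: "j \<in> carrier R" "i \<in> carrier R" using j i J.Icarr I.Icarr by auto
    have "a' \<otimes> y' \<ominus> a \<otimes> y = j \<otimes> y \<oplus> (j \<oplus> a) \<otimes> i" unfolding j i using c a yc by algebra
    moreover have "\<dots> \<in> J \<cdot> J"
      using I.I_l_closed[OF i(1), of "j \<oplus> a"] ideal_prod.prod[OF j(1) y] c a by (intro I.a_closed) auto
    ultimately show ?thesis
      using a_coset_eq_iff[OF I.is_ideal] a yc c j i by simp
  qed
  have "rcoset_mult R (J \<cdot> J) (J +> a) (J \<cdot> J +> y) =
      (\<Union>a'\<in>J +> a. \<Union>y'\<in>J \<cdot> J +> y. J \<cdot> J +> (a \<otimes> y))"
    unfolding rcoset_mult_def by (intro SUP_cong refl eq)
  moreover have "a \<in> J +> a" "y \<in> J \<cdot> J +> y" using a yc J.a_rcos_self I.a_rcos_self by auto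
  ultimately have "rcoset_mult R (J \<cdot> J) (J +> a) (J \<cdot> J +> y) = J \<cdot> J +> (a \<otimes> y)" by blast
  then show ?thesis by (simp add: cotangent_space_def)
qed

text \<open>The cosets of such a list form a basis of J/J^2: \<open>gen\<close> gives spanning, and
  \<open>ind\<close> gives independence because a coefficient in J is zero in R/J. Lists and
  \<open>combine\<close> keep the applications inside the ring, away from cosets.\<close>

lemma embedding_dim_eq_length:
  assumes local: "local_ring R" and Us: "set Us \<subseteq> J"
    and gen: "\<And>y. y \<in> J \<Longrightarrow> \<exists>Ks. set Ks \<subseteq> carrier R \<and> length Ks = length Us \<and> y \<ominus> combine Ks Us \<in> J \<cdot> J"
    and ind: "\<And>Ks. \<lbrakk>set Ks \<subseteq> carrier R; length Ks = length Us; combine Ks Us \<in> J \<cdot> J\<rbrakk> \<Longrightarrow> set Ks \<subseteq> J"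
  shows "embedding_dim R = length Us"
proof -
  let ?F = "R Quot J" and ?V = "cotangent_space R J"
  interpret V: vectorspace ?F ?V by (rule cotangent_space_vectorspace[OF cring J])
  define q where "q x = J \<cdot> J +> x" for x
  have Jc: "J \<subseteq> carrier R" using J.Icarr by auto
  have Usc: "set Us \<subseteq> carrier R" using Us Jc by auto
  have zF: "\<zero>\<^bsub>?F\<^esub> = J" by (simp add: FactRing_def)
  have zV: "\<zero>\<^bsub>?V\<^esub> = q \<zero>" using I.a_rcos_const[OF I.zero_closed] by (simp add: cotangent_space_def q_def)
  have cV: "carrier ?V = q ` J" by (simp add: cotangent_space_def q_def[abs_def])
  have cF: "carrier ?F = (\<lambda>a. J +> a) ` carrier R" by (auto simp: FactRing_def A_RCOSETS_def')
  have one: "\<one> \<notin> J" using J.one_imp_carrier J.I_notcarr by auto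
  have q_eq: "q x = q y \<longleftrightarrow> x \<ominus> y \<in> J \<cdot> J" if "x \<in> carrier R" "y \<in> carrier R" for x y
    unfolding q_def by (rule a_coset_eq_iff[OF I.is_ideal that])
  \<comment> \<open>The basis is a set, so coinciding cosets would be lost in the count. Two equal
    ones give a relation modulo J^2 with coefficients 1 and -1, and 1 is not in J.\<close>
  have dist: "distinct (map q Us)"
  proof (rule ccontr)
    assume "\<not> distinct (map q Us)"
    then obtain as bs cs y where "map q Us = as @ [y] @ bs @ [y] @ cs" using not_distinct_decomp by blast
    then obtain As u Bs v Cs where dec: "Us = As @ [u] @ Bs @ [v] @ Cs" "q u = q v"
      by (auto simp: map_eq_append_conv append_eq_map_conv map_eq_Cons_conv Cons_eq_map_conv)
    define Ks where "Ks = replicate (length As) \<zero> @ [\<one>] @ replicate (length Bs) \<zero> @ [\<ominus> \<one>] @ replicate (length Cs) \<zero>"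
    have sub: "set As \<subseteq> carrier R" "set Bs \<subseteq> carrier R" "set Cs \<subseteq> carrier R" "u \<in> carrier R" "v \<in> carrier R"
      using Usc dec by auto
    have pre: "combine (replicate (length Ws) \<zero> @ Ks) (Ws @ Vs) = combine Ks Vs"
      if "set Ws \<subseteq> carrier R" "combine Ks Vs \<in> carrier R" for Ws Vs Ks
      using that by (induction Ws) auto
    have "combine Ks Us = u \<ominus> v"
      unfolding Ks_def dec(1) using sub
      by (simp add: pre combine_replicate l_minus a_minus_def)
    then have "combine Ks Us \<in> J \<cdot> J" using q_eq[of u v] dec(2) sub by simp
    moreover have "set Ks \<subseteq> carrier R" "length Ks = length Us" unfolding Ks_def dec(1) by auto
    ultimately have "set Ks \<subseteq> J" using ind by blast
    then show False using one unfolding Ks_def by auto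
  qed
  let ?B = "q ` set Us"
  have B: "finite ?B" "?B \<subseteq> carrier ?V" using Us cV by auto
  \<comment> \<open>\<open>lincomb\<close> sums over a set and \<open>combine\<close> runs along a
    list; distinctness of the cosets lets the sum be peeled off one list entry at a time.\<close>
  have lincomb: "V.lincomb a (q ` set Vs) = q (combine Ks Vs)"
    if "distinct (map q Vs)" "set Vs \<subseteq> J" "length Ks = length Vs" "set Ks \<subseteq> carrier R"
      "map a (map q Vs) = map (\<lambda>k. J +> k) Ks" for a Ks Vs
    using that(3,1,2,4,5)
  proof (induction Ks Vs rule: list_induct2)
    case Nil
    then show ?case by (simp add: V.lincomb_def zV)
  next
    case (Cons k Ks v Vs)
    have IH: "V.lincomb a (q ` set Vs) = q (combine Ks Vs)" using Cons by simp
    have c: "set Vs \<subseteq> carrier R" "v \<in> carrier R" "k \<in> carrier R" "set Ks \<subseteq> carrier R" "v \<in> J"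
      using Cons.prems Jc by auto
    have al: "\<forall>x\<in>set (map q Vs). a x \<in> carrier ?F"
    proof
      fix x assume "x \<in> set (map q Vs)"
      then have "a x \<in> set (map a (map q Vs))" by auto
      also have "\<dots> = set (map (\<lambda>k. J +> k) Ks)" using Cons.prems(4) by simp
      finally show "a x \<in> carrier ?F" using c(4) cF by auto
    qed
    have av: "a (q v) = J +> k" using Cons.prems(4) by simp
    have "V.lincomb a (q ` set Vs \<union> {q v}) = a (q v) \<odot>\<^bsub>?V\<^esub> q v \<oplus>\<^bsub>?V\<^esub> V.lincomb a (q ` set Vs)"
      using Cons.prems cV al av c cF by (intro V.lincomb_insert) auto
    also have "\<dots> = q (k \<otimes> v \<oplus> combine Ks Vs)"
      unfolding IH av unfolding q_def using c combine_in_carrier[OF c(4,1)] by (simp add: cotangent_smult cotangent_add)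
    finally show ?case by simp
  qed
  have comb: "\<exists>Ks. length Ks = length Us \<and> set Ks \<subseteq> carrier R \<and> map a (map q Us) = map (\<lambda>k. J +> k) Ks"
    if a: "a \<in> ?B \<rightarrow> carrier ?F" for a
  proof -
    have "\<forall>x\<in>set Us. a (q x) \<in> (\<lambda>k. J +> k) ` carrier R" using a unfolding cF by auto
    then have "\<forall>x\<in>set Us. \<exists>k. k \<in> carrier R \<and> a (q x) = J +> k" by blast
    then obtain c where c: "\<forall>x\<in>set Us. c x \<in> carrier R \<and> a (q x) = J +> c x" by metis
    then show ?thesis by (intro exI[of _ "map c Us"]) auto
  qed
  have "V.lin_indpt ?B"
  proof (rule V.finite_lin_indpt2[OF B])
    fix a assume a: "a \<in> ?B \<rightarrow> carrier ?F" "V.lincomb a ?B = \<zero>\<^bsub>?V\<^esub>"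
    obtain Ks where Ks: "length Ks = length Us" "set Ks \<subseteq> carrier R" "map a (map q Us) = map (\<lambda>k. J +> k) Ks"
      using comb[OF a(1)] by blast
    have "q (combine Ks Us) = q \<zero>" using lincomb[OF dist Us Ks] a(2) zV by simp
    then have "combine Ks Us \<in> J \<cdot> J"
      using q_eq[of "combine Ks Us" \<zero>] combine_in_carrier[OF Ks(2) Usc] by (simp add: a_minus_def)
    then have KJ: "set Ks \<subseteq> J" using ind Ks by blast
    show "\<forall>v\<in>?B. a v = \<zero>\<^bsub>?F\<^esub>"
    proof
      fix v assume "v \<in> ?B"
      then have "a v \<in> set (map a (map q Us))" by auto
      then obtain k where "k \<in> set Ks" "a v = J +> k" unfolding Ks(3) by auto
      then show "a v = \<zero>\<^bsub>?F\<^esub>" using KJ J.a_rcos_const zF by auto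
    qed
  qed
  moreover have "V.gen_set ?B"
  proof
    show "V.span ?B \<subseteq> carrier ?V" by (rule V.span_is_subset2[OF B(2)])
    show "carrier ?V \<subseteq> V.span ?B"
    proof
      fix w assume "w \<in> carrier ?V"
      then obtain y where y: "y \<in> J" "w = q y" using cV by auto
      obtain Ks where Ks: "set Ks \<subseteq> carrier R" "length Ks = length Us" "y \<ominus> combine Ks Us \<in> J \<cdot> J"
        using gen[OF y(1)] by blast
      \<comment> \<open>A coefficient function on cosets is read off the list of coefficients by
        lookup, which is unambiguous because the cosets are distinct.\<close>
      define a where "a v = (J +> the (map_of (zip (map q Us) Ks) v))" for v
      have "map a (map q Us) = map (\<lambda>k. J +> k) Ks"
      proof (intro nth_equalityI)
        fix i assume i: "i < length (map a (map q Us))"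
        then have "map_of (zip (map q Us) Ks) (map q Us ! i) = Some (Ks ! i)"
          using Ks(2) dist by (intro map_of_zip_nth) auto
        then show "map a (map q Us) ! i = map (\<lambda>k. J +> k) Ks ! i" using i Ks(2) by (simp add: a_def)
      qed (use Ks(2) in simp)
      moreover from this have "a \<in> ?B \<rightarrow> carrier ?F"
      proof -
        have "a v \<in> carrier ?F" if "v \<in> ?B" for v
        proof -
          have "a v \<in> set (map a (map q Us))" using that by auto
          then show ?thesis unfolding \<open>map a (map q Us) = map (\<lambda>k. J +> k) Ks\<close> using Ks(1) cF by auto
        qed
        then show ?thesis by auto
      qed
      ultimately have "V.lincomb a ?B = w" "a \<in> ?B \<rightarrow> carrier ?F"
        using lincomb[OF dist Us Ks(2,1), of a] q_eq[of y "combine Ks Us"] y Ks Jc combine_in_carrier[OF Ks(1) Usc]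
        by auto
      then show "w \<in> V.span ?B" unfolding V.span_def using B(1) by blast
    qed
  qed
  ultimately have "V.basis ?B" using B(2) by (simp add: V.basis_def)
  then have "V.dim = card ?B" using V.dim_basis B(1) by blast
  also have "\<dots> = length Us" using distinct_card[OF dist] by simp
  finally show ?thesis
    unfolding embedding_dim_def local_ring_max_ideal[OF local J] .
qed

end

section \<open>The cubic rings are local\<close>

context nonramified_cubic
begin

lemma comb_inj:
  assumes "generator \<alpha>" "a \<in> D" "b \<in> D" "c \<in> D" "a' \<in> D" "b' \<in> D" "c' \<in> D"
    and eq: "comb \<alpha> a b c = comb \<alpha> a' b' c'"
  shows "a = a' \<and> b = b' \<and> c = c'"
proof -
  have ca: "a \<in> carrier L" "b \<in> carrier L" "c \<in> carrier L" "a' \<in> carrier L" "b' \<in> carrier L" "c' \<in> carrier L"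
      "\<alpha> \<in> carrier L"
    using assms D_carrier A_carrier generator_A by auto
  have "comb \<alpha> (a \<ominus> a') (b \<ominus> b') (c \<ominus> c') = comb \<alpha> a b c \<ominus> comb \<alpha> a' b' c'"
    unfolding comb_def using ca by algebra
  also have "\<dots> = \<zero>"
    unfolding eq using A_carrier[OF comb_A[OF assms(1,5-7)]] by (simp add: a_minus_def r_neg)
  finally have z: "comb \<alpha> (a \<ominus> a') (b \<ominus> b') (c \<ominus> c') = \<zero>" .
  have "a \<ominus> a' \<in> D" "b \<ominus> b' \<in> D" "c \<ominus> c' \<in> D" using assms D_props(5,7) by (simp_all add: a_minus_def)
  from comb_eq_zero[OF assms(1) this z] have "a \<ominus> a' = \<zero>" "b \<ominus> b' = \<zero>" "c \<ominus> c' = \<zero>" .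
  then show ?thesis using ca by simp
qed

lemma order_setI: "\<lbrakk>a \<in> D; b \<in> D; x \<in> A\<rbrakk> \<Longrightarrow>
    a \<oplus> t [^] s \<otimes> (b \<otimes> \<alpha>) \<oplus> t [^] l \<otimes> x \<in> order_set \<alpha> s l"
  unfolding order_set_def by blast

lemma order_setE:
  assumes "y \<in> order_set \<alpha> s l"
  obtains a b x where "a \<in> D" "b \<in> D" "x \<in> A" "y = a \<oplus> t [^] s \<otimes> (b \<otimes> \<alpha>) \<oplus> t [^] l \<otimes> x"
  using assms unfolding order_set_def by blast

end

text \<open>The two inequalities are those delivered by the classification: s \<le> l gives
  coordinates, l \<le> 2s gives closure under multiplication. \<open>J\<close> is the contraction of
  the maximal ideal tA of \<open>A\<close>.\<close>

locale cubic_order = nonramified_cubic +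
  fixes \<alpha> :: 'a and s l :: nat
  assumes \<alpha>: "generator \<alpha>" and s_le_l: "s \<le> l" and l_le: "l \<le> 2 * s"
begin

abbreviation "\<C> \<equiv> order_set \<alpha> s l"
abbreviation "\<R> \<equiv> L\<lparr>carrier := \<C>\<rparr>"
abbreviation "J \<equiv> \<C> \<inter> (t <# A)"

lemma \<alpha>_A: "\<alpha> \<in> A" using \<alpha> generator_A by auto
lemma \<alpha>_carrier: "\<alpha> \<in> carrier L" using \<alpha>_A A_carrier by auto

lemma D_subset_order: "D \<subseteq> \<C>"
proof
  fix d assume "d \<in> D"
  then show "d \<in> \<C>"
    using order_setI[of d \<zero> \<zero> s \<alpha> l] D_props(2) A_props(2) D_carrier \<alpha>_carrier by simp
qed

lemma order_subset_A: "\<C> \<subseteq> A"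
proof
  fix y assume "y \<in> \<C>"
  then show "y \<in> A" by (elim order_setE) (use \<alpha>_A D_in_A tpow_A A_props(6,7) in simp)
qed

lemma tpow_in_order: "x \<in> A \<Longrightarrow> t [^] l \<otimes> x \<in> \<C>"
  using order_setI[of \<zero> \<zero> x s \<alpha> l] D_props(2) D_carrier \<alpha>_carrier A_carrier by simp

lemma tpow_in_order': "\<lbrakk>x \<in> A; l \<le> n\<rbrakk> \<Longrightarrow> t [^] n \<otimes> x \<in> \<C>"
  using tpow_in_order[of "t [^] (n - l) \<otimes> x"] tpow_add[of x l "n - l"] A_carrier A_props(6) tpow_A by simp

text \<open>The only product that could leave the set is that of the two \<alpha>-terms, a multiple
  of t^(2s) \<alpha>^2; it lies in t^l A because l \<le> 2s.\<close>

lemma order_subring: "subring \<C> L"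
proof (rule subringI)
  show "\<C> \<subseteq> carrier L" using order_subset_A A_carrier by auto
  show "\<one> \<in> \<C>" using D_subset_order D_props(3) by auto
next
  fix y assume "y \<in> \<C>"
  then obtain a b x where *: "a \<in> D" "b \<in> D" "x \<in> A" "y = a \<oplus> t [^] s \<otimes> (b \<otimes> \<alpha>) \<oplus> t [^] l \<otimes> x"
    by (rule order_setE)
  define S T where "S = t [^] s" and "T = t [^] l"
  have c: "a \<in> carrier L" "b \<in> carrier L" "x \<in> carrier L" "S \<in> carrier L" "T \<in> carrier L"
    using * D_carrier A_carrier by (auto simp: S_def T_def)
  have "\<ominus> y = \<ominus> a \<oplus> S \<otimes> (\<ominus> b \<otimes> \<alpha>) \<oplus> T \<otimes> \<ominus> x"
    unfolding *(4) S_def[symmetric] T_def[symmetric] using c \<alpha>_carrier by algebra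
  then show "\<ominus> y \<in> \<C>" using order_setI[of "\<ominus> a" "\<ominus> b" "\<ominus> x" s \<alpha> l] * D_props(5) A_props(5)
    by (simp add: S_def T_def)
next
  fix y z assume "y \<in> \<C>" "z \<in> \<C>"
  then obtain a b x a' b' x' where *: "a \<in> D" "b \<in> D" "x \<in> A" "y = a \<oplus> t [^] s \<otimes> (b \<otimes> \<alpha>) \<oplus> t [^] l \<otimes> x"
    and **: "a' \<in> D" "b' \<in> D" "x' \<in> A" "z = a' \<oplus> t [^] s \<otimes> (b' \<otimes> \<alpha>) \<oplus> t [^] l \<otimes> x'"
    by (elim order_setE) blast
  define S T U where "S = t [^] s" and "T = t [^] l" and "U = t [^] (2 * s - l)"
  have c: "a \<in> carrier L" "b \<in> carrier L" "x \<in> carrier L" "S \<in> carrier L" "T \<in> carrier L" "U \<in> carrier L"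
      "a' \<in> carrier L" "b' \<in> carrier L" "x' \<in> carrier L"
    using * ** D_carrier A_carrier by (auto simp: S_def T_def U_def)
  have SS: "S \<otimes> S = T \<otimes> U" unfolding S_def T_def U_def using l_le by (simp add: nat_pow_mult mult_2)
  have STU_A: "S \<in> A" "T \<in> A" "U \<in> A" using tpow_A by (simp_all add: S_def T_def U_def)
  have "y \<oplus> z = (a \<oplus> a') \<oplus> S \<otimes> ((b \<oplus> b') \<otimes> \<alpha>) \<oplus> T \<otimes> (x \<oplus> x')"
    unfolding *(4) **(4) S_def[symmetric] T_def[symmetric] using c \<alpha>_carrier by algebra
  then show "y \<oplus> z \<in> \<C>"
    using order_setI[of "a \<oplus> a'" "b \<oplus> b'" "x \<oplus> x'" s \<alpha> l] * ** D_props(7) A_props(7)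
    by (simp add: S_def T_def)
  \<comment> \<open>The cofactor of t^l in the terms of the product that involve x or x'.\<close>
  define w where "w = a \<otimes> x' \<oplus> a' \<otimes> x \<oplus> S \<otimes> (b \<otimes> \<alpha> \<otimes> x' \<oplus> b' \<otimes> \<alpha> \<otimes> x) \<oplus> T \<otimes> (x \<otimes> x')"
  have wA: "U \<otimes> (b \<otimes> b' \<otimes> (\<alpha> \<otimes> \<alpha>)) \<oplus> w \<in> A"
    unfolding w_def using * ** D_in_A \<alpha>_A STU_A A_props(6,7) by simp
  have wc: "w \<in> carrier L" unfolding w_def using c \<alpha>_carrier by simp
  define q r q' r' where qr: "q = S \<otimes> (b \<otimes> \<alpha>)" "r = T \<otimes> x" "q' = S \<otimes> (b' \<otimes> \<alpha>)" "r' = T \<otimes> x'"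
  have qrc: "q \<in> carrier L" "r \<in> carrier L" "q' \<in> carrier L" "r' \<in> carrier L"
    using c \<alpha>_carrier by (simp_all add: qr)
  define g h where gh: "g = b \<otimes> b' \<otimes> (\<alpha> \<otimes> \<alpha>)" "h = a \<otimes> a' \<oplus> S \<otimes> ((a \<otimes> b' \<oplus> a' \<otimes> b) \<otimes> \<alpha>)"
  have ghc: "g \<in> carrier L" "h \<in> carrier L" using c \<alpha>_carrier by (simp_all add: gh)
  have "y \<otimes> z = (a \<otimes> a' \<oplus> (a \<otimes> q' \<oplus> a' \<otimes> q)) \<oplus> (q \<otimes> q' \<oplus>
      (a \<otimes> r' \<oplus> a' \<otimes> r \<oplus> (q \<otimes> r' \<oplus> q' \<otimes> r) \<oplus> r \<otimes> r'))"
    unfolding *(4) **(4) S_def[symmetric] T_def[symmetric] qr[symmetric] using c(1,7) qrc by algebra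
  moreover have "a \<otimes> a' \<oplus> (a \<otimes> q' \<oplus> a' \<otimes> q) = h" unfolding gh qr using c \<alpha>_carrier by algebra
  moreover have "q \<otimes> q' = (S \<otimes> S) \<otimes> g" unfolding gh qr using c \<alpha>_carrier by algebra
  moreover have "a \<otimes> r' \<oplus> a' \<otimes> r \<oplus> (q \<otimes> r' \<oplus> q' \<otimes> r) \<oplus> r \<otimes> r' = T \<otimes> w"
    unfolding qr w_def using c \<alpha>_carrier by algebra
  ultimately have "y \<otimes> z = h \<oplus> (T \<otimes> U \<otimes> g \<oplus> T \<otimes> w)" unfolding SS by simp
  also have "\<dots> = h \<oplus> T \<otimes> (U \<otimes> g \<oplus> w)" using c(5,6) wc ghc by algebra
  finally show "y \<otimes> z \<in> \<C>"
    using order_setI[OF _ _ wA, of "a \<otimes> a'" "a \<otimes> b' \<oplus> a' \<otimes> b" s \<alpha> l] * ** D_props(6,7)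
    by (simp add: S_def T_def gh)
qed

lemmas order_props = subringE[OF order_subring]

lemma order_carrier: "x \<in> \<C> \<Longrightarrow> x \<in> carrier L"
  using order_props(1) by auto

text \<open>The basis is 1, t^s \<alpha>, t^l \<alpha>^2. Uniqueness of coordinates is inherited
  from \<open>A\<close> by cancelling t^s and t^l.\<close>

lemma order_cubic: "cubic_ring L D \<C>"
proof -
  define Us where "Us = [\<one>, t [^] s \<otimes> \<alpha>, t [^] l \<otimes> (\<alpha> \<otimes> \<alpha>)]"
  have eq: "combine [a, b, c] Us = comb \<alpha> a (t [^] s \<otimes> b) (t [^] l \<otimes> c)"
    if "a \<in> D" "b \<in> D" "c \<in> D" for a b c
  proof -
    define S T where "S = t [^] s" and "T = t [^] l"
    have c: "a \<in> carrier L" "b \<in> carrier L" "c \<in> carrier L" "S \<in> carrier L" "T \<in> carrier L"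
      using that D_carrier by (auto simp: S_def T_def)
    show ?thesis unfolding Us_def combine3 comb_def S_def[symmetric] T_def[symmetric]
      using c \<alpha>_carrier by algebra
  qed
  have "bij_betw (\<lambda>Ks. combine Ks Us) {Ks. set Ks \<subseteq> D \<and> length Ks = 3} \<C>"
  proof (rule bij_betwI')
    fix Ks Ks' assume "Ks \<in> {Ks. set Ks \<subseteq> D \<and> length Ks = 3}" "Ks' \<in> {Ks. set Ks \<subseteq> D \<and> length Ks = 3}"
    then obtain a b c a' b' c' where K: "Ks = [a, b, c]" "a \<in> D" "b \<in> D" "c \<in> D"
      and K': "Ks' = [a', b', c']" "a' \<in> D" "b' \<in> D" "c' \<in> D"
      by (auto simp: list3)
    show "combine Ks Us = combine Ks' Us \<longleftrightarrow> Ks = Ks'"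
    proof
      assume "combine Ks Us = combine Ks' Us"
      then have e: "comb \<alpha> a (t [^] s \<otimes> b) (t [^] l \<otimes> c) = comb \<alpha> a' (t [^] s \<otimes> b') (t [^] l \<otimes> c')"
        using eq K K' by simp
      have "a = a' \<and> t [^] s \<otimes> b = t [^] s \<otimes> b' \<and> t [^] l \<otimes> c = t [^] l \<otimes> c'"
        by (rule comb_inj[OF \<alpha> _ _ _ _ _ _ e]) (simp_all add: K K' D_props(6) tpow_D)
      then have "a = a'" "b = b'" "c = c'"
        using tpow_cancel[of b b' s] tpow_cancel[of c c' l] K K' D_carrier by auto
      then show "Ks = Ks'" using K K' by simp
    qed simp
  next
    fix Ks assume "Ks \<in> {Ks. set Ks \<subseteq> D \<and> length Ks = 3}"
    then obtain a b c where K: "Ks = [a, b, c]" "a \<in> D" "b \<in> D" "c \<in> D" by (auto simp: list3)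
    then show "combine Ks Us \<in> \<C>"
      unfolding order_set_coords[OF \<alpha> s_le_l] using eq[OF K(2-4)] by blast
  next
    fix y assume "y \<in> \<C>"
    then obtain a b c where K: "a \<in> D" "b \<in> D" "c \<in> D" "y = comb \<alpha> a (t [^] s \<otimes> b) (t [^] l \<otimes> c)"
      unfolding order_set_coords[OF \<alpha> s_le_l] by blast
    then have "y = combine [a, b, c] Us" using eq by simp
    then show "\<exists>Ks\<in>{Ks. set Ks \<subseteq> D \<and> length Ks = 3}. y = combine Ks Us"
      using K by (intro bexI[of _ "[a, b, c]"]) auto
  qed
  moreover have "set Us \<subseteq> carrier L" "length Us = 3" using \<alpha>_carrier by (auto simp: Us_def)
  ultimately have "free_of_rank L D 3 \<C>" unfolding free_of_rank_def by blast
  then show ?thesis using order_subring D_subset_order by (simp add: cubic_ring_def)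
qed

text \<open>
  Two steps of the geometric series, \<open>v = 1 + y + y\<^sup>2v\<close>, suffice because \<open>y\<^sup>2 \<in> t\<^sup>2\<^sup>sA \<subseteq> t\<^sup>lA\<close>.
\<close>

lemma order_one_minus_inverse:
  assumes y: "y \<in> \<C>" "y \<in> t [^] s <# A" and v: "v \<in> A" "(\<one> \<ominus> y) \<otimes> v = \<one>"
  shows "v \<in> \<C>"
proof -
  obtain z where z: "z \<in> A" "y = t [^] s \<otimes> z" using y(2) by (rule l_cosetE)
  have c: "y \<in> carrier L" "z \<in> carrier L" "v \<in> carrier L" using y z v A_carrier order_carrier by auto
  define S where "S = t [^] s"
  have Sc: "S \<in> carrier L" by (simp add: S_def)
  have "y \<otimes> (y \<otimes> v) = (S \<otimes> S) \<otimes> (z \<otimes> z \<otimes> v)"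
    unfolding z(2) S_def[symmetric] using c Sc by algebra
  also have "S \<otimes> S = t [^] (2 * s)" by (simp add: S_def nat_pow_mult mult_2)
  finally have yyv: "y \<otimes> (y \<otimes> v) \<in> \<C>"
    using tpow_in_order'[of "z \<otimes> z \<otimes> v" "2 * s"] l_le z v A_props(6) by simp
  have v1: "v = \<one> \<oplus> y \<otimes> v" using v(2) c
  proof -
    have "v = (\<one> \<ominus> y) \<otimes> v \<oplus> y \<otimes> v" using c by algebra
    then show ?thesis using v(2) by simp
  qed
  have "v = \<one> \<oplus> y \<otimes> (\<one> \<oplus> y \<otimes> v)" using v1 by simp
  also have "\<dots> = \<one> \<oplus> y \<oplus> y \<otimes> (y \<otimes> v)" using c by algebra
  finally have "v = \<one> \<oplus> y \<oplus> y \<otimes> (y \<otimes> v)" .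
  moreover have "\<one> \<oplus> y \<oplus> y \<otimes> (y \<otimes> v) \<in> \<C>" using yyv y(1) order_props(3,7) by simp
  ultimately show ?thesis by metis
qed

text \<open>For s = 0 the order is \<open>A\<close>. Otherwise the constant term a of x is a unit of
  \<open>D\<close>, and a^-1 x = 1 - y with y in t^s A; the inverse a x^-1 of 1 - y is in the order
  by the preceding lemma.\<close>

lemma order_unit:
  assumes x: "x \<in> \<C>" "x \<notin> t <# A"
  shows "inv x \<in> \<C>"
proof (cases "s = 0")
  case True
  then have "x \<in> \<C>" if "x \<in> A" for x using tpow_in_order[OF that] that A_carrier l_le by simp
  then show ?thesis using A_unit(2) x order_subset_A by blast
next
  case False
  obtain a b w where *: "a \<in> D" "b \<in> D" "w \<in> A" "x = a \<oplus> t [^] s \<otimes> (b \<otimes> \<alpha>) \<oplus> t [^] l \<otimes> w"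
    using x(1) by (rule order_setE)
  define z where "z = b \<otimes> \<alpha> \<oplus> t [^] (l - s) \<otimes> w"
  have z: "z \<in> A" unfolding z_def using * D_in_A \<alpha>_A tpow_A A_props(6,7) by simp
  have c: "a \<in> carrier L" "z \<in> carrier L" "b \<in> carrier L" "w \<in> carrier L" "x \<in> carrier L"
    using * z D_carrier A_carrier x order_carrier by auto
  have xz: "x = a \<oplus> t [^] s \<otimes> z"
    unfolding *(4) z_def using c \<alpha>_carrier s_le_l tpow_add[of w s "l - s"] by (simp add: r_distr a_assoc)
  \<comment> \<open>As s > 0, the elements x and a agree modulo tA.\<close>
  have "a \<notin> t <# D"
  proof
    assume "a \<in> t <# D"
    then obtain d where d: "d \<in> D" "a = t \<otimes> d" by (rule l_cosetE)
    have "x = t \<otimes> (d \<oplus> t [^] (s - 1) \<otimes> z)"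
      unfolding xz d(2) using False d c D_carrier tpow_Suc[of z "s - 1"] by (simp add: r_distr)
    moreover have "d \<oplus> t [^] (s - 1) \<otimes> z \<in> A" using d z D_in_A tpow_A A_props(6,7) by simp
    ultimately show False using x(2) l_cosetI[of _ A L t] by metis
  qed
  then have ia: "inv a \<in> D" using D_unit * by blast
  have "a \<noteq> \<zero>" using \<open>a \<notin> t <# D\<close> D_props(2) l_cosetI[of \<zero> D L t] by auto
  then have ua: "a \<in> Units L" using c field_Units by simp
  then have ca: "inv a \<in> carrier L" "a \<otimes> inv a = \<one>" by auto
  have ux: "x \<in> Units L" "inv x \<in> A" using A_unit x order_subset_A by blast+
  then have cx: "inv x \<in> carrier L" "x \<otimes> inv x = \<one>" by auto
  define y v where "y = \<one> \<ominus> inv a \<otimes> x" and "v = a \<otimes> inv x"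
  have yO: "y \<in> \<C>" unfolding y_def a_minus_def
    using x ia D_subset_order order_props(3,5,6,7) by (simp add: subset_iff)
  have "inv a \<otimes> x = a \<otimes> inv a \<oplus> t [^] s \<otimes> (inv a \<otimes> z)"
    unfolding xz using c ca tpow_carrier[of s] by algebra
  then have "y = t [^] s \<otimes> (\<ominus> (inv a \<otimes> z))"
    unfolding y_def ca(2) using c ca(1) tpow_carrier[of s] by algebra
  moreover have "\<ominus> (inv a \<otimes> z) \<in> A" using ia z D_in_A A_props(5,6) by simp
  ultimately have ys: "y \<in> t [^] s <# A" using l_cosetI[of _ A L "t [^] s"] by metis
  have "(\<one> \<ominus> y) \<otimes> v = (a \<otimes> inv a) \<otimes> (x \<otimes> inv x)"
    unfolding y_def v_def using c ca(1) cx(1) by algebra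
  then have "(\<one> \<ominus> y) \<otimes> v = \<one>" using ca cx by simp
  moreover have "v \<in> A" unfolding v_def using * D_in_A ux A_props(6) by simp
  ultimately have "v \<in> \<C>" using order_one_minus_inverse yO ys by blast
  moreover have "inv x = inv a \<otimes> v"
  proof -
    have "inv a \<otimes> v = (a \<otimes> inv a) \<otimes> inv x" unfolding v_def using c ca(1) cx(1) by algebra
    then show ?thesis using ca cx by simp
  qed
  ultimately show ?thesis using ia D_subset_order order_props(6) by (simp add: subset_iff)
qed

lemma order_cring: "cring \<R>"
  using subcring_iff[OF order_props(1)] subcringI'[OF order_subring] by blast

lemma t_in_order: "t \<in> \<C>"
  using t_D D_subset_order by auto

lemma J_ideal: "ideal J \<R>"
proof (rule ideal.intro)
  interpret O: cring \<R> by (rule order_cring)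
  show "ring \<R>" ..
  show "additive_subgroup J \<R>"
  proof (rule additive_subgroup.intro, rule subgroup.intro)
    show "J \<subseteq> carrier (add_monoid \<R>)" by auto
    have "\<zero> = t \<otimes> \<zero>" by simp
    then show "\<one>\<^bsub>add_monoid \<R>\<^esub> \<in> J" using order_props(2) l_cosetI[OF A_props(2), of L t] by simp
  next
    fix x y assume xy: "x \<in> J" "y \<in> J"
    obtain x' where x': "x' \<in> A" "x = t \<otimes> x'" using xy by (auto elim: l_cosetE)
    obtain y' where y': "y' \<in> A" "y = t \<otimes> y'" using xy by (auto elim: l_cosetE)
    have "x \<oplus> y = t \<otimes> (x' \<oplus> y')" using x' y' A_carrier by (simp add: r_distr)
    then have "x \<oplus> y \<in> t <# A" using l_cosetI[OF A_props(7)[OF x'(1) y'(1)], of L t] by simp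
    moreover have "x \<oplus> y \<in> \<C>" using xy order_props(7) by simp
    ultimately show "x \<otimes>\<^bsub>add_monoid \<R>\<^esub> y \<in> J" by simp
  next
    fix x assume xy: "x \<in> J"
    obtain x' where x': "x' \<in> A" "x = t \<otimes> x'" using xy by (auto elim: l_cosetE)
    have "\<ominus> x = t \<otimes> \<ominus> x'" using x' A_carrier by (simp add: r_minus)
    then have "\<ominus> x \<in> t <# A" using l_cosetI[OF A_props(5)[OF x'(1)], of L t] by simp
    moreover have "\<ominus> x \<in> \<C>" using xy order_props(5) by simp
    ultimately have mx: "\<ominus> x \<in> J" by simp
    have "\<ominus>\<^bsub>\<R>\<^esub> x = \<ominus> x"
      using xy mx order_carrier by (intro O.minus_equality) (auto simp: l_neg)
    then show "inv\<^bsub>add_monoid \<R>\<^esub> x \<in> J" using mx by (simp add: a_inv_def)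
  qed
next
  have "x \<otimes> a \<in> J \<and> a \<otimes> x \<in> J" if ax: "a \<in> J" "x \<in> \<C>" for a x
  proof -
    obtain a' where a': "a' \<in> A" "a = t \<otimes> a'" using ax by (auto elim: l_cosetE)
    have xA: "x \<in> A" using ax order_subset_A by auto
    have "x \<otimes> a = t \<otimes> (a' \<otimes> x)" "a \<otimes> x = t \<otimes> (a' \<otimes> x)"
      using a' xA A_carrier by (auto simp: m_assoc m_comm m_lcomm)
    then have "x \<otimes> a \<in> t <# A" "a \<otimes> x \<in> t <# A"
      using l_cosetI[OF A_props(6)[OF a'(1) xA], of L t] by simp_all
    moreover have "x \<otimes> a \<in> \<C>" "a \<otimes> x \<in> \<C>" using ax order_props(6) by simp_all
    ultimately show ?thesis by simp
  qed
  then show "ideal_axioms J \<R>" by (simp add: ideal_axioms_def)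
qed

text \<open>Elements outside \<open>J\<close> are invertible in the order, so every proper ideal is
  contained in \<open>J\<close>; maximality and uniqueness follow together.\<close>

lemma J_maximal: "maximalideal J \<R>"
  and order_local: "local_ring \<R>"
proof -
  interpret O: cring \<R> by (rule order_cring)
  have sub: "I \<subseteq> J" if I: "ideal I \<R>" "I \<noteq> \<C>" for I
  proof
    interpret I: ideal I \<R> by (rule I(1))
    fix x assume x: "x \<in> I"
    have xO: "x \<in> \<C>" using I.Icarr[OF x] by simp
    have "x \<in> t <# A"
    proof (rule ccontr)
      assume n: "x \<notin> t <# A"
      have "inv x \<otimes>\<^bsub>\<R>\<^esub> x \<in> I" using I.I_l_closed[OF x] order_unit[OF xO n] by simp
      then have "\<one>\<^bsub>\<R>\<^esub> \<in> I" using A_unit(1)[OF _ n] xO order_subset_A by auto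
      then have "I = carrier \<R>" by (rule I.one_imp_carrier)
      then show False using I(2) by simp
    qed
    then show "x \<in> J" using xO by simp
  qed
  have J_neq: "J \<noteq> \<C>" using one_notin_tA order_props(3) by blast
  show max: "maximalideal J \<R>"
  proof (rule maximalidealI[OF J_ideal])
    show "carrier \<R> \<noteq> J" using J_neq by simp
    fix I assume "ideal I \<R>" "J \<subseteq> I" "I \<subseteq> carrier \<R>"
    then show "I = J \<or> I = carrier \<R>" using sub[of I] by auto
  qed
  have "I = J" if "maximalideal I \<R>" for I
  proof -
    interpret I: maximalideal I \<R> by (rule that)
    have "I \<subseteq> J" using sub[OF I.is_ideal] I.I_notcarr by auto
    then show ?thesis using I.I_maximal[OF J_ideal] J_neq by auto
  qed
  then show "local_ring \<R>" unfolding local_ring_def using order_cring max by blast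
qed

end

section \<open>The cubic rings are noetherian of dimension one\<close>

lemma (in primeideal) prime_power:
  "\<lbrakk>x \<in> carrier R; x [^] (n::nat) \<in> I\<rbrakk> \<Longrightarrow> x \<in> I"
proof (induction n)
  case 0
  then show ?case using one_imp_carrier I_notcarr by auto
next
  case (Suc n)
  then show ?case using I_prime[of "x [^] n" x] by auto
qed

text \<open>The chain from the zero ideal to J has length 1. In a chain of length 2 the upper two
  primes are nonzero, hence both equal to J, against strictness.\<close>

lemma krull_dim_eq_oneI:
  fixes R (structure)
  assumes "domain R" "primeideal J R" "J \<noteq> {\<zero>}"
    and primes: "\<And>P. \<lbrakk>primeideal P R; P \<noteq> {\<zero>}\<rbrakk> \<Longrightarrow> P = J"
  shows "krull_dim R = 1"
proof -
  interpret domain R by fact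
  have zero: "primeideal {\<zero>} R" using zeroprimeideal .
  let ?S = "{enat n | n. \<exists>P. (\<forall>i\<le>n. primeideal (P i) R) \<and> (\<forall>i<n. P i \<subset> P (Suc i))}"
  have zP: "\<zero> \<in> P" if "primeideal P R" for P
    using that additive_subgroup.zero_closed[of P R] by (simp add: primeideal_def ideal_def)
  have bound: "n \<le> 1" if P: "\<forall>i\<le>n. primeideal (P i) R" "\<forall>i<n. P i \<subset> P (Suc i)" for n :: nat and P
  proof (rule ccontr)
    assume "\<not> n \<le> 1"
    then have n: "0 < n" "1 < n" by auto
    have pr: "primeideal (P 0) R" "primeideal (P 1) R" "primeideal (P 2) R" using P(1) n by auto
    have lt: "P 0 \<subset> P 1" "P 1 \<subset> P 2" using P(2) n by (auto simp: numeral_2_eq_2)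
    have "P 1 \<noteq> {\<zero>}" using lt(1) zP[OF pr(1)] by auto
    moreover have "P 2 \<noteq> {\<zero>}" using lt(2) zP[OF pr(2)] zP[OF pr(1)] lt(1) zP by auto
    ultimately have "P 1 = P 2" using primes[OF pr(2)] primes[OF pr(3)] by metis
    then show False using lt(2) by simp
  qed
  have "enat 1 \<in> ?S"
  proof -
    have "{\<zero>} \<subset> J" using zP[OF assms(2)] assms(3) by auto
    then have chain: "(\<forall>i\<le>1::nat. primeideal (if i = 0 then {\<zero>} else J) R) \<and>
        (\<forall>i<1. (if i = 0 then {\<zero>} else J) \<subset> (if Suc i = 0 then {\<zero>} else J))"
      using zero assms(2) by auto
    show ?thesis
      by (intro CollectI exI[of _ "1::nat"] conjI refl exI[of _ "\<lambda>i::nat. if i = 0 then {\<zero>} else J"])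
        (use chain in blast)+
  qed
  moreover have "x \<le> enat 1" if "x \<in> ?S" for x
    using that bound by auto
  ultimately have "Sup ?S = enat 1" by (intro antisym Sup_least Sup_upper)
  then show ?thesis unfolding krull_dim_def by (simp add: one_enat_def)
qed

section \<open>Submodules of finitely generated modules over \<open>D\<close>\<close>

context dvr_in_field
begin

text \<open>Each nonzero element is a unit times a power of t, and that power lies in
  \<open>I\<close> as well; the least power of t in \<open>I\<close> is a generator.\<close>

lemma D_ideal_principal:
  assumes I: "I \<subseteq> D" "\<zero> \<in> I" and mult: "\<And>d x. \<lbrakk>d \<in> D; x \<in> I\<rbrakk> \<Longrightarrow> d \<otimes> x \<in> I"
  shows "\<exists>g\<in>I. I \<subseteq> g <# D"
proof (cases "I = {\<zero>}")
  case True
  then show ?thesis using l_cosetI[OF D_props(2), of L \<zero>] by auto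
next
  case False
  have tn: "\<exists>n u. u \<in> D \<and> x = t [^] (n::nat) \<otimes> u \<and> t [^] n \<in> I" if x: "x \<in> I" "x \<noteq> \<zero>" for x
  proof -
    obtain n :: nat and u where u: "u \<in> D" "u \<notin> t <# D" "x = t [^] n \<otimes> u" using D_val x I by blast
    have iu: "inv u \<in> D" using D_unit u by blast
    have uc: "u \<in> carrier L" "inv u \<in> carrier L" using u(1) iu D_carrier by auto
    have "u \<noteq> \<zero>" using u x by auto
    then have uu: "inv u \<otimes> u = \<one>" using uc field_Units by simp
    have "inv u \<otimes> x = (inv u \<otimes> u) \<otimes> t [^] n" unfolding u(3) using uc tpow_carrier[of n] by algebra
    then have "t [^] n = inv u \<otimes> x" using uu by simp
    then have "t [^] n \<in> I" using mult[OF iu x(1)] by simp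
    then show ?thesis using u by blast
  qed
  define n where "n = (LEAST n::nat. t [^] n \<in> I)"
  have ex: "\<exists>n::nat. t [^] n \<in> I" using False I(2) tn by blast
  have nI: "t [^] n \<in> I" using LeastI_ex[OF ex] unfolding n_def .
  have "I \<subseteq> t [^] n <# D"
  proof
    fix x assume x: "x \<in> I"
    show "x \<in> t [^] n <# D"
    proof (cases "x = \<zero>")
      case True
      then have "x = t [^] n \<otimes> \<zero>" by simp
      then show ?thesis using l_cosetI[OF D_props(2), of L "t [^] n"] by simp
    next
      case False
      obtain m :: nat and u where u: "u \<in> D" "x = t [^] m \<otimes> u" "t [^] m \<in> I" using tn[OF x False] by blast
      have "n \<le> m" using Least_le[of "\<lambda>n. t [^] n \<in> I", OF u(3)] unfolding n_def .
      then have "x = t [^] n \<otimes> (t [^] (m - n) \<otimes> u)" using u tpow_add[of u n "m - n"] D_carrier by simp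
      then show ?thesis using l_cosetI[OF D_props(6)[OF tpow_D u(1)], of L "t [^] n"] by simp
    qed
  qed
  then show ?thesis using nI by blast
qed

lemma combine_closed:
  "\<lbrakk>\<And>x y. \<lbrakk>x \<in> M; y \<in> M\<rbrakk> \<Longrightarrow> x \<oplus> y \<in> M; \<And>d x. \<lbrakk>d \<in> D; x \<in> M\<rbrakk> \<Longrightarrow> d \<otimes> x \<in> M; \<zero> \<in> M;
    set Ks \<subseteq> D; set Us \<subseteq> M\<rbrakk> \<Longrightarrow> combine Ks Us \<in> M"
  by (induction Ks Us rule: combine.induct) auto

text \<open>Induction on the number of generators of the ambient module. The coefficients at u of
  elements of \<open>M\<close> form a principal ideal; an element of \<open>M\<close> realising its
  generator, together with generators of the part of \<open>M\<close> in the span of the other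
  vectors, generates \<open>M\<close>.\<close>

lemma submodule_finitely_generated:
  assumes "set Us \<subseteq> carrier L"
    and "\<zero> \<in> M" "\<And>x y. \<lbrakk>x \<in> M; y \<in> M\<rbrakk> \<Longrightarrow> x \<oplus> y \<in> M" "\<And>d x. \<lbrakk>d \<in> D; x \<in> M\<rbrakk> \<Longrightarrow> d \<otimes> x \<in> M"
    and "\<And>x. x \<in> M \<Longrightarrow> \<exists>Ks. set Ks \<subseteq> D \<and> x = combine Ks Us"
  shows "\<exists>Vs. set Vs \<subseteq> M \<and> (\<forall>x\<in>M. \<exists>Ks. set Ks \<subseteq> D \<and> x = combine Ks Vs)"
  using assms
proof (induction Us arbitrary: M)
  case Nil
  then have "x = \<zero>" if "x \<in> M" for x using that by auto
  then have "\<forall>x\<in>M. \<exists>Ks. set Ks \<subseteq> D \<and> x = combine Ks []" by (auto intro!: exI[of _ "[]"])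
  then show ?case by (intro exI[of _ "[]"]) auto
next
  case (Cons u Us)
  note zM = Cons.prems(2) and aM = Cons.prems(3) and mM = Cons.prems(4)
  have uc: "u \<in> carrier L" "set Us \<subseteq> carrier L" using Cons.prems(1) by auto
  have cU: "combine Ks Us \<in> carrier L" if "set Ks \<subseteq> D" for Ks
    using that uc D_carrier by (intro combine_in_carrier) auto
  define S where "S = {combine Ks Us | Ks. set Ks \<subseteq> D}"
  have Sc: "y \<in> carrier L" if "y \<in> S" for y using that cU unfolding S_def by auto
  have zS: "\<zero> \<in> S" unfolding S_def by (auto intro!: exI[of _ "[]"])
  have mS: "d \<otimes> y \<in> S" if dy: "d \<in> D" "y \<in> S" for d y
  proof -
    obtain Ks where Ks: "set Ks \<subseteq> D" "y = combine Ks Us" using dy unfolding S_def by auto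
    have "set Ks \<subseteq> carrier L" using Ks D_carrier by auto
    then have "d \<otimes> y = combine (map (\<lambda>k. d \<otimes> k) Ks) Us"
      unfolding Ks(2) using combine_scale[of d Ks Us] dy D_carrier uc by simp
    moreover have "set (map (\<lambda>k. d \<otimes> k) Ks) \<subseteq> D" using dy Ks D_props(6) by auto
    ultimately show ?thesis unfolding S_def by blast
  qed
  have aS: "y \<oplus> z \<in> S" if yz: "y \<in> S" "z \<in> S" for y z
  proof -
    have *: "\<exists>Ks. set Ks \<subseteq> D \<and> length Ks = length Us \<and> y = combine Ks Us" if y: "y \<in> S" for y
    proof -
      obtain Ks where Ks: "set Ks \<subseteq> D" "y = combine Ks Us" using y unfolding S_def by auto
      \<comment> \<open>Coefficient lists are brought to the length of \<open>Us\<close> so that two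
        of them can be added entry by entry.\<close>
      define Ks' where "Ks' = take (length Us) (Ks @ replicate (length Us) \<zero>)"
      have "set Ks' \<subseteq> D" using Ks D_props(2) set_take_subset[of "length Us" "Ks @ replicate (length Us) \<zero>"]
        unfolding Ks'_def by fastforce
      moreover have "combine Ks' Us = y"
        unfolding Ks'_def combine_take combine_append_replicate[OF uc(2)] using Ks by simp
      moreover have "length Ks' = length Us" by (simp add: Ks'_def)
      ultimately show ?thesis by blast
    qed
    have add: "combine Ks Vs \<oplus> combine Ks' Vs \<in> {combine Ks Vs | Ks. set Ks \<subseteq> D}"
      if "length Ks = length Vs" "length Ks' = length Vs" "set Ks \<subseteq> D" "set Ks' \<subseteq> D" "set Vs \<subseteq> carrier L" for Ks Ks' Vs
      using that
    proof (induction Ks Vs arbitrary: Ks' rule: list_induct2)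
      case Nil
      then show ?case by (auto intro!: exI[of _ "[]"])
    next
      case (Cons k Ks v Vs)
      obtain k' Ks'' where K: "Ks' = k' # Ks''" using Cons.prems(1) by (cases Ks') auto
      obtain Ls where Ls: "set Ls \<subseteq> D" "combine Ks Vs \<oplus> combine Ks'' Vs = combine Ls Vs"
        using Cons.IH[of Ks''] Cons.prems K by auto
      define p q where "p = combine Ks Vs" and "q = combine Ks'' Vs"
      have c: "k \<in> carrier L" "k' \<in> carrier L" "v \<in> carrier L" "p \<in> carrier L" "q \<in> carrier L"
        using Cons.prems K D_carrier unfolding p_def q_def by (auto intro!: combine_in_carrier)
      have "(k \<otimes> v \<oplus> p) \<oplus> (k' \<otimes> v \<oplus> q) = (k \<oplus> k') \<otimes> v \<oplus> (p \<oplus> q)" using c by algebra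
      then have "combine (k # Ks) (v # Vs) \<oplus> combine Ks' (v # Vs) = combine ((k \<oplus> k') # Ls) (v # Vs)"
        using K Ls by (simp add: p_def q_def)
      moreover have "set ((k \<oplus> k') # Ls) \<subseteq> D" using Ls Cons.prems K D_props(7) by auto
      ultimately show ?case by blast
    qed
    obtain Ks Ks' where "set Ks \<subseteq> D" "length Ks = length Us" "y = combine Ks Us"
        "set Ks' \<subseteq> D" "length Ks' = length Us" "z = combine Ks' Us"
      using *[OF yz(1)] *[OF yz(2)] by blast
    then show ?thesis using add[of Ks Us Ks'] uc unfolding S_def by auto
  qed
  have MS: "\<exists>d\<in>D. \<exists>y\<in>S. x = d \<otimes> u \<oplus> y" if x: "x \<in> M" for x
  proof -
    obtain Ks where Ks: "set Ks \<subseteq> D" "x = combine Ks (u # Us)" using Cons.prems(5)[OF x] by blast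
    show ?thesis
    proof (cases Ks)
      case Nil
      then have "x = \<zero> \<otimes> u \<oplus> \<zero>" using Ks uc by simp
      then show ?thesis using D_props(2) zS by blast
    next
      case (Cons k Ks')
      then have "x = k \<otimes> u \<oplus> combine Ks' Us" "k \<in> D" "combine Ks' Us \<in> S"
        using Ks unfolding S_def by auto
      then show ?thesis by blast
    qed
  qed
  \<comment> \<open>The ideal of leading coefficients, that is, of coefficients at u.\<close>
  define I where "I = {d \<in> D. \<exists>y\<in>S. d \<otimes> u \<oplus> y \<in> M}"
  have "\<exists>g\<in>I. I \<subseteq> g <# D"
  proof (rule D_ideal_principal)
    show "I \<subseteq> D" by (auto simp: I_def)
    have "\<zero> \<otimes> u \<oplus> \<zero> \<in> M" using uc zM by simp
    then show "\<zero> \<in> I" using D_props(2) zS unfolding I_def by blast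
    fix d x assume d: "d \<in> D" "x \<in> I"
    obtain y where y: "y \<in> S" "x \<otimes> u \<oplus> y \<in> M" "x \<in> D" using d unfolding I_def by blast
    have "d \<otimes> (x \<otimes> u \<oplus> y) \<in> M" using mM d y by blast
    moreover have "d \<otimes> (x \<otimes> u \<oplus> y) = (d \<otimes> x) \<otimes> u \<oplus> d \<otimes> y"
      using d y uc Sc D_carrier by (simp add: r_distr m_assoc)
    ultimately show "d \<otimes> x \<in> I" using mS[OF d(1) y(1)] D_props(6)[OF d(1) y(3)] unfolding I_def by auto
  qed
  then obtain g where g: "g \<in> I" "I \<subseteq> g <# D" by blast
  obtain y where y: "y \<in> S" "g \<otimes> u \<oplus> y \<in> M" "g \<in> D" using g(1) unfolding I_def by blast
  define v where "v = g \<otimes> u \<oplus> y"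
  have vc: "v \<in> carrier L" "v \<in> M" using y uc Sc D_carrier by (auto simp: v_def)
  have "\<exists>Vs. set Vs \<subseteq> M \<inter> S \<and> (\<forall>x\<in>M \<inter> S. \<exists>Ks. set Ks \<subseteq> D \<and> x = combine Ks Vs)"
    using zM zS aM aS mM mS by (intro Cons.IH[OF uc(2)]) (auto simp: S_def)
  then obtain Vs where Vs: "set Vs \<subseteq> M \<inter> S" "\<And>x. x \<in> M \<inter> S \<Longrightarrow> \<exists>Ks. set Ks \<subseteq> D \<and> x = combine Ks Vs" by blast
  have "\<exists>Ks. set Ks \<subseteq> D \<and> x = combine Ks (v # Vs)" if x: "x \<in> M" for x
  proof -
    obtain d z where dz: "d \<in> D" "z \<in> S" "x = d \<otimes> u \<oplus> z" using MS[OF x] by blast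
    then have "d \<in> I" using x unfolding I_def by auto
    then obtain e where e: "e \<in> D" "d = g \<otimes> e" using g(2) by (auto elim: l_cosetE)
    have c: "d \<in> carrier L" "z \<in> carrier L" "e \<in> carrier L" "g \<in> carrier L" "y \<in> carrier L"
      using dz e y Sc D_carrier by auto
    have me: "\<ominus> e \<in> D" using e D_props(5) by simp
    \<comment> \<open>Subtracting e v from x kills the coefficient at u; the two sides of this
      equation show that the difference lies in \<open>S\<close> and in \<open>M\<close>.\<close>
    have "z \<oplus> (\<ominus> e) \<otimes> y = x \<oplus> (\<ominus> e) \<otimes> v"
      unfolding dz(3) v_def e(2) using c uc by algebra
    moreover have "z \<oplus> (\<ominus> e) \<otimes> y \<in> S" by (rule aS[OF dz(2) mS[OF me y(1)]])
    moreover have "x \<oplus> (\<ominus> e) \<otimes> v \<in> M" by (rule aM[OF x mM[OF me vc(2)]])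
    ultimately obtain Ks where Ks: "set Ks \<subseteq> D" "x \<oplus> (\<ominus> e) \<otimes> v = combine Ks Vs" using Vs(2) by auto
    have xc: "x \<in> carrier L" using dz c uc by simp
    have "x = e \<otimes> v \<oplus> (x \<oplus> (\<ominus> e) \<otimes> v)" using c vc xc by algebra
    then have "x = combine (e # Ks) (v # Vs)" using Ks by simp
    then show ?thesis using Ks e by (intro exI[of _ "e # Ks"]) auto
  qed
  moreover have "set (v # Vs) \<subseteq> M" using vc Vs by auto
  ultimately show ?case by blast
qed

end

section \<open>Noetherian property and Krull dimension of the orders\<close>

context cubic_order
begin

text \<open>An ideal is a \<open>D\<close>-submodule of \<open>A\<close>, which 1, \<alpha>,
  \<alpha>^2 span; since \<open>D\<close> is contained in the order, generators over
  \<open>D\<close> also generate it as an ideal.\<close>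

lemma order_noetherian: "noetherian_ring \<R>"
proof -
  interpret O: cring \<R> by (rule order_cring)
  show ?thesis
  proof (rule O.noetherian_ringI)
    fix I assume I: "ideal I \<R>"
    interpret I: ideal I \<R> by (rule I)
    have IO: "I \<subseteq> \<C>" using I.Icarr by auto
    let ?Us = "[\<one>, \<alpha>, \<alpha> \<otimes> \<alpha>]"
    have "\<exists>Vs. set Vs \<subseteq> I \<and> (\<forall>x\<in>I. \<exists>Ks. set Ks \<subseteq> D \<and> x = combine Ks Vs)"
    proof (rule submodule_finitely_generated[of ?Us])
      show "set ?Us \<subseteq> carrier L" using \<alpha>_carrier by simp
      show "\<zero> \<in> I" using I.zero_closed by simp
      show "x \<oplus> y \<in> I" if "x \<in> I" "y \<in> I" for x y using I.a_closed[OF that] by simp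
      show "d \<otimes> x \<in> I" if "d \<in> D" "x \<in> I" for d x
        using I.I_l_closed[OF that(2), of d] that(1) D_subset_order by auto
      fix x assume x: "x \<in> I"
      then obtain a b c where abc: "a \<in> D" "b \<in> D" "c \<in> D" "x = comb \<alpha> a b c"
        using IO order_subset_A A_coords[OF \<alpha>] by blast
      then have "x = combine [a, b, c] ?Us"
        using D_carrier \<alpha>_carrier by (simp add: comb_def a_assoc)
      then show "\<exists>Ks. set Ks \<subseteq> D \<and> x = combine Ks ?Us"
        using abc by (intro exI[of _ "[a, b, c]"]) simp
    qed
    then obtain Vs where Vs: "set Vs \<subseteq> I" "\<And>x. x \<in> I \<Longrightarrow> \<exists>Ks. set Ks \<subseteq> D \<and> x = combine Ks Vs" by blast
    have VO: "set Vs \<subseteq> carrier \<R>" using Vs IO by auto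
    interpret G: ideal "Idl\<^bsub>\<R>\<^esub> (set Vs)" \<R> by (rule O.genideal_ideal[OF VO])
    have "I \<subseteq> Idl\<^bsub>\<R>\<^esub> (set Vs)"
    proof
      fix x assume "x \<in> I"
      then obtain Ks where Ks: "set Ks \<subseteq> D" "x = combine Ks Vs" using Vs by blast
      show "x \<in> Idl\<^bsub>\<R>\<^esub> (set Vs)"
        unfolding Ks(2)
      proof (rule combine_closed[OF _ _ _ Ks(1)])
        show "\<zero> \<in> Idl\<^bsub>\<R>\<^esub> (set Vs)" using G.zero_closed by simp
        show "set Vs \<subseteq> Idl\<^bsub>\<R>\<^esub> (set Vs)" by (rule O.genideal_self[OF VO])
        show "x \<oplus> y \<in> Idl\<^bsub>\<R>\<^esub> (set Vs)" if "x \<in> Idl\<^bsub>\<R>\<^esub> (set Vs)" "y \<in> Idl\<^bsub>\<R>\<^esub> (set Vs)" for x y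
          using G.a_closed[OF that] by simp
        show "d \<otimes> x \<in> Idl\<^bsub>\<R>\<^esub> (set Vs)" if "d \<in> D" "x \<in> Idl\<^bsub>\<R>\<^esub> (set Vs)" for d x
          using G.I_l_closed[OF that(2), of d] that(1) D_subset_order by auto
      qed
    qed
    moreover have "Idl\<^bsub>\<R>\<^esub> (set Vs) \<subseteq> I" by (rule O.genideal_minimal[OF I Vs(1)])
    ultimately show "\<exists>A\<subseteq>carrier \<R>. finite A \<and> I = Idl\<^bsub>\<R>\<^esub> A"
      using VO by (intro exI[of _ "set Vs"]) auto
  qed
qed

lemma order_pow: "x [^]\<^bsub>\<R>\<^esub> (n::nat) = x [^] n"
  by (induction n) simp_all

text \<open>A nonzero prime contains a power of t, hence t, and then every element of
  \<open>J\<close> by a power argument. As \<open>J\<close> is maximal, it is the only nonzero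
  prime.\<close>

lemma order_krull_dim: "krull_dim \<R> = 1"
proof (rule krull_dim_eq_oneI)
  interpret O: cring \<R> by (rule order_cring)
  show dom: "domain \<R>" by (rule subring_is_domain[OF order_subring])
  show Jprime: "primeideal J \<R>" by (rule O.maximalideal_prime[OF J_maximal])
  have tJ: "t \<in> J" using t_in_order l_cosetI[OF A_props(3), of L t] by simp
  then show "J \<noteq> {\<zero>\<^bsub>\<R>\<^esub>}" using t_nonzero by auto
  fix P assume P: "primeideal P \<R>" "P \<noteq> {\<zero>\<^bsub>\<R>\<^esub>}"
  interpret P: primeideal P \<R> by (rule P(1))
  obtain x where x: "x \<in> P" "x \<noteq> \<zero>" using P(2) P.zero_closed by auto
  have xO: "x \<in> \<C>" using P.Icarr[OF x(1)] by simp
  obtain n :: nat and w where w: "w \<in> A" "w \<notin> t <# A" "x = t [^] n \<otimes> w"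
    using A_val[of x] xO order_subset_A x(2) by blast
  have wu: "w \<in> Units L" "inv w \<in> A" using A_unit w by auto
  have wc: "w \<in> carrier L" "inv w \<in> carrier L" "w \<otimes> inv w = \<one>" using wu by auto
  \<comment> \<open>The inverse of w lies in \<open>A\<close> and perhaps not in the order; the
    factor t^l brings it there.\<close>
  have "(t [^] l \<otimes> inv w) \<otimes> x \<in> P"
    using P.I_l_closed[OF x(1), of "t [^] l \<otimes> inv w"] tpow_in_order[OF wu(2)] by simp
  also have "(t [^] l \<otimes> inv w) \<otimes> x = t [^] l \<otimes> t [^] n \<otimes> (w \<otimes> inv w)"
    unfolding w(3) using wc(1,2) tpow_carrier[of l] tpow_carrier[of n] by algebra
  finally have "t [^] (l + n) \<in> P" using wc(3) by (simp add: nat_pow_mult)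
  then have tP: "t \<in> P" using P.prime_power[of t "l + n"] t_in_order by (simp add: order_pow)
  have JP: "J \<subseteq> P"
  proof
    fix y assume y: "y \<in> J"
    then obtain z where z: "z \<in> A" "y = t \<otimes> z" by (auto elim: l_cosetE)
    have zp: "z [^] k \<in> A" for k :: nat by (induction k) (auto simp: A_props z)
    \<comment> \<open>Of the l + 1 factors t, l bring z^(l+1) into the order and the last one is the
      element of \<open>P\<close>.\<close>
    have "y [^] Suc l = t [^] Suc l \<otimes> z [^] Suc l"
      unfolding z(2) using A_carrier[OF z(1)] by (simp only: nat_pow_distrib t_carrier)
    also have "\<dots> = (t [^] l \<otimes> z [^] Suc l) \<otimes> t"
      using A_carrier[OF zp[of "Suc l"]] by (simp add: m_assoc m_comm m_lcomm)
    also have "\<dots> \<in> P" using P.I_l_closed[OF tP, of "t [^] l \<otimes> z [^] Suc l"] tpow_in_order[OF zp[of "Suc l"]]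
      by (simp del: nat_pow_Suc)
    finally show "y \<in> P" using P.prime_power[of y "Suc l"] y by (simp add: order_pow del: nat_pow_Suc)
  qed
  show "P = J"
    using maximalideal.I_maximal[OF J_maximal P.is_ideal JP] P.I_notcarr P.Icarr by auto
qed

end

section \<open>Embedding dimension of the cubic rings\<close>

context cubic_order
begin

lemma order_combine: "ring.combine \<R> Ks Us = combine Ks Us"
proof -
  interpret O: cring \<R> by (rule order_cring)
  show ?thesis by (induction Ks Us rule: combine.induct) simp_all
qed

lemma order_minus: "\<lbrakk>x \<in> \<C>; y \<in> \<C>\<rbrakk> \<Longrightarrow> x \<ominus>\<^bsub>\<R>\<^esub> y = x \<ominus> y"
proof -
  interpret O: cring \<R> by (rule order_cring)
  assume xy: "x \<in> \<C>" "y \<in> \<C>"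
  have "\<ominus>\<^bsub>\<R>\<^esub> y = \<ominus> y"
    using xy order_props(5) order_carrier by (intro O.minus_equality) (auto simp: l_neg)
  then show ?thesis by (simp add: a_minus_def)
qed

lemma order_minus_self: "y \<in> \<C> \<Longrightarrow> y \<ominus>\<^bsub>\<R>\<^esub> y = \<zero>"
proof -
  assume y: "y \<in> \<C>"
  then have "y \<ominus> y = \<zero>" using order_carrier by (simp add: a_minus_def r_neg)
  then show ?thesis using order_minus y by simp
qed

lemma t_J: "t \<in> J"
  using t_in_order l_cosetI[OF A_props(3), of L t] by simp

text \<open>With s = 0 also l = 0, so the order is \<open>A\<close>, whose maximal ideal is
  generated by t; if k t lies in t^2 A, then k lies in tA.\<close>

lemma embedding_dim_zero: "s = 0 \<Longrightarrow> embedding_dim \<R> = 1"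
proof -
  interpret O: cring \<R> by (rule order_cring)
  assume s: "s = 0"
  have OA: "\<C> = A"
    using tpow_in_order order_subset_A s l_le A_carrier by auto
  have JJ: "x \<in> J \<cdot>\<^bsub>\<R>\<^esub> J \<Longrightarrow> \<exists>a\<in>A. x = t \<otimes> (t \<otimes> a)" for x
  proof (induction rule: ideal_prod.induct)
    case (prod i j)
    obtain a b where ab: "a \<in> A" "i = t \<otimes> a" "b \<in> A" "j = t \<otimes> b" using prod by (auto elim!: l_cosetE)
    have c: "a \<in> carrier L" "b \<in> carrier L" using ab A_carrier by auto
    have "i \<otimes> j = t \<otimes> (t \<otimes> (a \<otimes> b))" unfolding ab using c t_carrier by algebra
    then show ?case using ab A_props(6) by auto
  next
    case (sum x y)
    obtain a where a: "a \<in> A" "x = t \<otimes> (t \<otimes> a)" using sum by blast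
    obtain b where b: "b \<in> A" "y = t \<otimes> (t \<otimes> b)" using sum by blast
    have "x \<oplus> y = t \<otimes> (t \<otimes> (a \<oplus> b))" unfolding a b using a b A_carrier by (simp add: r_distr)
    then show ?case using a b A_props(7) by auto
  qed
  have "embedding_dim \<R> = length [t]"
  proof (rule embedding_dim_eq_length[OF order_cring J_maximal order_local], unfold order_combine)
    show "set [t] \<subseteq> J" using t_J by simp
    fix y assume y: "y \<in> J"
    then obtain a where a: "a \<in> A" "y = t \<otimes> a" by (auto elim: l_cosetE)
    have "y = combine [a] [t]" using a A_carrier by (simp add: m_comm)
    moreover have "y \<ominus>\<^bsub>\<R>\<^esub> y \<in> J \<cdot>\<^bsub>\<R>\<^esub> J"
    proof -
      have "\<zero> \<otimes>\<^bsub>\<R>\<^esub> \<zero> \<in> J \<cdot>\<^bsub>\<R>\<^esub> J"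
        using ideal.axioms(1)[OF J_ideal] additive_subgroup.zero_closed[of J \<R>] by (intro ideal_prod.prod) auto
      then show ?thesis using y order_carrier by (simp add: order_minus_self)
    qed
    ultimately show "\<exists>Ks. set Ks \<subseteq> carrier \<R> \<and> length Ks = length [t] \<and> y \<ominus>\<^bsub>\<R>\<^esub> combine Ks [t] \<in> J \<cdot>\<^bsub>\<R>\<^esub> J"
      using a OA by (intro exI[of _ "[a]"]) simp
  next
    fix Ks assume Ks: "set Ks \<subseteq> carrier \<R>" "length Ks = length [t]" "combine Ks [t] \<in> J \<cdot>\<^bsub>\<R>\<^esub> J"
    then obtain k where k: "Ks = [k]" "k \<in> A" using OA by (cases Ks) auto
    obtain a where a: "a \<in> A" "combine Ks [t] = t \<otimes> (t \<otimes> a)" using JJ Ks(3) by blast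
    then have "t \<otimes> k = t \<otimes> (t \<otimes> a)" using k A_carrier by (simp add: m_comm)
    then have "k = t \<otimes> a" using t_cancel k a A_carrier by simp
    then show "set Ks \<subseteq> J" using k OA a l_cosetI[OF a(1), of L t] by simp
  qed
  then show ?thesis by simp
qed

text \<open>
  For \<open>e = min (l + 1) (2s)\<close> this contains \<open>J\<^sup>2\<close>. As \<open>e > l\<close> unless \<open>l = 2s\<close>, the generator \<open>t\<^sup>l\<alpha>\<^sup>2\<close> of \<open>J\<close>
  then survives in \<open>J/J\<^sup>2\<close>.
\<close>

definition square_bound :: "nat \<Rightarrow> 'a set" where
  "square_bound e = {t \<otimes> (t \<otimes> a) \<oplus> t [^] Suc s \<otimes> (b \<otimes> \<alpha>) \<oplus> t [^] e \<otimes> x | a b x. a \<in> D \<and> b \<in> D \<and> x \<in> A}"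

lemma square_boundI: "\<lbrakk>a \<in> D; b \<in> D; x \<in> A\<rbrakk> \<Longrightarrow>
    t \<otimes> (t \<otimes> a) \<oplus> t [^] Suc s \<otimes> (b \<otimes> \<alpha>) \<oplus> t [^] e \<otimes> x \<in> square_bound e"
  unfolding square_bound_def by blast

lemma square_boundE:
  assumes "y \<in> square_bound e"
  obtains a b x where "a \<in> D" "b \<in> D" "x \<in> A"
    "y = t \<otimes> (t \<otimes> a) \<oplus> t [^] Suc s \<otimes> (b \<otimes> \<alpha>) \<oplus> t [^] e \<otimes> x"
  using assms unfolding square_bound_def by blast

lemma square_bound_add: "\<lbrakk>y \<in> square_bound e; z \<in> square_bound e\<rbrakk> \<Longrightarrow> y \<oplus> z \<in> square_bound e"
proof -
  assume "y \<in> square_bound e" "z \<in> square_bound e"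
  then obtain a b x a' b' x' where *: "a \<in> D" "b \<in> D" "x \<in> A"
      "y = t \<otimes> (t \<otimes> a) \<oplus> t [^] Suc s \<otimes> (b \<otimes> \<alpha>) \<oplus> t [^] e \<otimes> x"
    and **: "a' \<in> D" "b' \<in> D" "x' \<in> A"
      "z = t \<otimes> (t \<otimes> a') \<oplus> t [^] Suc s \<otimes> (b' \<otimes> \<alpha>) \<oplus> t [^] e \<otimes> x'"
    by (elim square_boundE) blast
  define S T where "S = t [^] Suc s" and "T = t [^] e"
  have c: "a \<in> carrier L" "b \<in> carrier L" "x \<in> carrier L" "S \<in> carrier L" "T \<in> carrier L"
      "a' \<in> carrier L" "b' \<in> carrier L" "x' \<in> carrier L"
    using * ** D_carrier A_carrier by (auto simp: S_def T_def simp del: nat_pow_Suc)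
  have "y \<oplus> z = t \<otimes> (t \<otimes> (a \<oplus> a')) \<oplus> S \<otimes> ((b \<oplus> b') \<otimes> \<alpha>) \<oplus> T \<otimes> (x \<oplus> x')"
    unfolding *(4) **(4) S_def[symmetric] T_def[symmetric] using c \<alpha>_carrier t_carrier by algebra
  then show ?thesis
    using square_boundI[of "a \<oplus> a'" "b \<oplus> b'" "x \<oplus> x'" e] * ** D_props(7) A_props(7) by (simp add: S_def T_def)
qed

text \<open>For an element of tA independence modulo t makes the coordinate at 1 divisible by t, so
  t replaces 1 in the basis of the order.\<close>

lemma J_generators:
  assumes s: "1 \<le> s" and y: "y \<in> J"
  obtains a b c where "a \<in> D" "b \<in> D" "c \<in> D"
    "y = a \<otimes> t \<oplus> b \<otimes> (t [^] s \<otimes> \<alpha>) \<oplus> c \<otimes> (t [^] l \<otimes> (\<alpha> \<otimes> \<alpha>))"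
proof -
  obtain a b c where *: "a \<in> D" "b \<in> D" "c \<in> D" "y = comb \<alpha> a (t [^] s \<otimes> b) (t [^] l \<otimes> c)"
    using y order_set_coords[OF \<alpha> s_le_l] by blast
  have "a \<in> t <# D"
    using indepD(1)[OF \<alpha>, of a "t [^] s \<otimes> b" "t [^] l \<otimes> c"] * y D_props(6) tpow_D by simp
  then obtain d where d: "d \<in> D" "a = t \<otimes> d" by (rule l_cosetE)
  have c: "d \<in> carrier L" "b \<in> carrier L" "c \<in> carrier L" using d * D_carrier by auto
  have "y = d \<otimes> t \<oplus> b \<otimes> (t [^] s \<otimes> \<alpha>) \<oplus> c \<otimes> (t [^] l \<otimes> (\<alpha> \<otimes> \<alpha>))"
    unfolding *(4) comb_def d(2) using c \<alpha>_carrier tpow_carrier[of s] tpow_carrier[of l] t_carrier by algebra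
  then show thesis using that * d by blast
qed

lemma J_form:
  assumes s: "1 \<le> s" and y: "y \<in> J"
  obtains a b x where "a \<in> D" "b \<in> D" "x \<in> A" "y = t \<otimes> a \<oplus> t [^] s \<otimes> (b \<otimes> \<alpha>) \<oplus> t [^] l \<otimes> x"
proof -
  obtain a b c where *: "a \<in> D" "b \<in> D" "c \<in> D"
    "y = a \<otimes> t \<oplus> b \<otimes> (t [^] s \<otimes> \<alpha>) \<oplus> c \<otimes> (t [^] l \<otimes> (\<alpha> \<otimes> \<alpha>))"
    using J_generators[OF s y] by blast
  have "y = t \<otimes> a \<oplus> t [^] s \<otimes> (b \<otimes> \<alpha>) \<oplus> t [^] l \<otimes> (c \<otimes> (\<alpha> \<otimes> \<alpha>))"
    unfolding *(4) using * D_carrier \<alpha>_carrier by (simp add: m_ac)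
  moreover have "c \<otimes> (\<alpha> \<otimes> \<alpha>) \<in> A" using * D_in_A \<alpha>_A A_props(6) by simp
  ultimately show thesis using that * by blast
qed

lemma tpow_split: "e \<le> n \<Longrightarrow> t [^] (n::nat) = t [^] (e::nat) \<otimes> t [^] (n - e)"
  by (simp add: nat_pow_mult)

text \<open>Multiplying two elements of \<open>J\<close> gives a term with t^2, a term with t^(s+1)
  \<alpha>, and a remainder in which every term carries t^(2s) or t^(l+1); both are divisible by
  t^e.\<close>

lemma JJ_subset_square_bound:
  assumes s: "1 \<le> s" and e: "e \<le> Suc l" "e \<le> 2 * s"
  shows "x \<in> J \<cdot>\<^bsub>\<R>\<^esub> J \<Longrightarrow> x \<in> square_bound e"
proof (induction rule: ideal_prod.induct)
  case (sum x y)
  then show ?case using square_bound_add by simp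
next
  case (prod i j)
  obtain a b x where *: "a \<in> D" "b \<in> D" "x \<in> A" "i = t \<otimes> a \<oplus> t [^] s \<otimes> (b \<otimes> \<alpha>) \<oplus> t [^] l \<otimes> x"
    using J_form[OF s prod(1)] by blast
  obtain a' b' x' where **: "a' \<in> D" "b' \<in> D" "x' \<in> A" "j = t \<otimes> a' \<oplus> t [^] s \<otimes> (b' \<otimes> \<alpha>) \<oplus> t [^] l \<otimes> x'"
    using J_form[OF s prod(2)] by blast
  define S T E where "S = t [^] s" and "T = t [^] l" and "E = t [^] e"
  \<comment> \<open>\<open>U\<close> and \<open>V\<close> are the cofactors of t^e in t^(2s) and
    t^(l+1), which is where the two bounds on e enter. \<open>W\<close> splits one factor t off
    t^s.\<close>
  define U V W where "U = t [^] (2 * s - e)" and "V = t [^] (Suc l - e)" and "W = t [^] (s - 1)"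
  have c: "a \<in> carrier L" "b \<in> carrier L" "x \<in> carrier L" "a' \<in> carrier L" "b' \<in> carrier L" "x' \<in> carrier L"
    using * ** D_carrier A_carrier by auto
  have cc: "S \<in> carrier L" "T \<in> carrier L" "E \<in> carrier L" "U \<in> carrier L" "V \<in> carrier L" "W \<in> carrier L"
    unfolding S_def T_def E_def U_def V_def W_def by auto
  have AA: "S \<in> A" "T \<in> A" "E \<in> A" "U \<in> A" "V \<in> A" "W \<in> A"
    unfolding S_def T_def E_def U_def V_def W_def by (rule tpow_A)+
  have SS: "S \<otimes> S = E \<otimes> U"
    unfolding S_def E_def U_def using tpow_split[OF e(2)] by (simp add: nat_pow_mult mult_2)
  have tT: "T \<otimes> t = E \<otimes> V"
    unfolding T_def E_def V_def using tpow_split[OF e(1)] by simp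
  have S1: "S = t \<otimes> W" unfolding S_def W_def using tpow_split[of 1 s] s by simp
  have l1: "T = t \<otimes> t [^] (l - 1)" unfolding T_def using tpow_split[of 1 l] s s_le_l by simp
  define Y where "Y = t [^] (l - 1)"
  have Y: "Y \<in> carrier L" "Y \<in> A" "T = t \<otimes> Y" using tpow_A l1 by (auto simp: Y_def)
  define p p' q q' where pq: "p = b \<otimes> \<alpha>" "p' = b' \<otimes> \<alpha>" "q = t \<otimes> a" "q' = t \<otimes> a'"
  have pqc: "p \<in> carrier L" "p' \<in> carrier L" "q \<in> carrier L" "q' \<in> carrier L"
    using c \<alpha>_carrier by (simp_all add: pq)
  have pA: "p \<in> A" "p' \<in> A" "a \<in> A" "a' \<in> A" using * ** D_in_A \<alpha>_A A_props(6) by (simp_all add: pq)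
  define w where "w = U \<otimes> (p \<otimes> p') \<oplus> V \<otimes> (a \<otimes> x' \<oplus> a' \<otimes> x \<oplus> W \<otimes> (p \<otimes> x' \<oplus> p' \<otimes> x) \<oplus> Y \<otimes> (x \<otimes> x'))"
  have wA: "w \<in> A" unfolding w_def using * ** AA Y pA A_props(6,7) by simp
  define z where "z = a \<otimes> x' \<oplus> a' \<otimes> x \<oplus> W \<otimes> (p \<otimes> x' \<oplus> p' \<otimes> x) \<oplus> Y \<otimes> (x \<otimes> x')"
  have zc: "z \<in> carrier L" unfolding z_def using c cc Y pqc by simp
  have "i \<otimes> j = (q \<oplus> S \<otimes> p \<oplus> T \<otimes> x) \<otimes> (q' \<oplus> S \<otimes> p' \<oplus> T \<otimes> x')"
    unfolding *(4) **(4) S_def T_def pq by simp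
  also have "\<dots> = q \<otimes> q' \<oplus> S \<otimes> (q \<otimes> p' \<oplus> q' \<otimes> p) \<oplus> ((S \<otimes> S) \<otimes> (p \<otimes> p') \<oplus>
      T \<otimes> (q \<otimes> x' \<oplus> q' \<otimes> x \<oplus> S \<otimes> (p \<otimes> x' \<oplus> p' \<otimes> x) \<oplus> T \<otimes> (x \<otimes> x')))"
    using c(3,6) cc(1,2) pqc by algebra
  also have "T \<otimes> (q \<otimes> x' \<oplus> q' \<otimes> x \<oplus> S \<otimes> (p \<otimes> x' \<oplus> p' \<otimes> x) \<oplus> T \<otimes> (x \<otimes> x')) = (T \<otimes> t) \<otimes> z"
  proof -
    have "q \<otimes> x' \<oplus> q' \<otimes> x \<oplus> S \<otimes> (p \<otimes> x' \<oplus> p' \<otimes> x) \<oplus> T \<otimes> (x \<otimes> x') = t \<otimes> z"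
      unfolding pq(3,4) S1 Y(3) z_def using c cc(6) Y(1) pqc(1,2) t_carrier by algebra
    then show ?thesis using cc zc by (simp add: m_assoc)
  qed
  also have "(S \<otimes> S) \<otimes> (p \<otimes> p') \<oplus> (T \<otimes> t) \<otimes> z = E \<otimes> w"
    unfolding SS tT w_def z_def[symmetric] using cc pqc zc by algebra
  also have "q \<otimes> q' = t \<otimes> (t \<otimes> (a \<otimes> a'))" unfolding pq using c t_carrier by algebra
  also have "S \<otimes> (q \<otimes> p' \<oplus> q' \<otimes> p) = t [^] Suc s \<otimes> ((a \<otimes> b' \<oplus> a' \<otimes> b) \<otimes> \<alpha>)"
  proof -
    have e: "t [^] Suc s = S \<otimes> t" by (simp add: S_def)
    show ?thesis unfolding pq e using c cc(1) t_carrier \<alpha>_carrier by algebra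
  qed
  finally have "i \<otimes> j = t \<otimes> (t \<otimes> (a \<otimes> a')) \<oplus> t [^] Suc s \<otimes> ((a \<otimes> b' \<oplus> a' \<otimes> b) \<otimes> \<alpha>) \<oplus> t [^] e \<otimes> w"
    by (simp add: E_def)
  then have "i \<otimes> j \<in> square_bound e" using square_boundI[OF _ _ wA, of "a \<otimes> a'" "a \<otimes> b' \<oplus> a' \<otimes> b" e] * ** D_props(6,7) by simp
  then show ?case by simp
qed

lemma tpow_Suc_cancel:
  assumes "t [^] (n::nat) \<otimes> a = t [^] Suc n \<otimes> b" "a \<in> D" "b \<in> D"
  shows "a \<in> t <# D"
proof -
  have "t [^] n \<otimes> a = t [^] n \<otimes> (t \<otimes> b)" using assms D_carrier by (simp add: m_assoc)
  then have "a = t \<otimes> b" using tpow_cancel[of a "t \<otimes> b" n] assms D_carrier by simp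
  then show ?thesis using l_cosetI[OF assms(3), of L t] by simp
qed

text \<open>Coordinates at 1, \<alpha>, \<alpha>^2 are compared. As e \<ge> 2 and e \<ge> s + 1, the
  part from t^e A does not disturb the divisibility of the first two; the third gains a factor t
  when e = l + 1.\<close>

lemma square_bound_coords:
  assumes e: "2 \<le> e" "Suc s \<le> e"
    and a: "a1 \<in> D" "a2 \<in> D" "a3 \<in> D"
    and Q: "t \<otimes> a1 \<oplus> t [^] s \<otimes> (a2 \<otimes> \<alpha>) \<oplus> t [^] l \<otimes> (a3 \<otimes> (\<alpha> \<otimes> \<alpha>)) \<in> square_bound e"
  shows "a1 \<in> t <# D" "a2 \<in> t <# D" "e = Suc l \<Longrightarrow> a3 \<in> t <# D"
proof -
  obtain b c x where *: "b \<in> D" "c \<in> D" "x \<in> A"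
    "t \<otimes> a1 \<oplus> t [^] s \<otimes> (a2 \<otimes> \<alpha>) \<oplus> t [^] l \<otimes> (a3 \<otimes> (\<alpha> \<otimes> \<alpha>)) =
      t \<otimes> (t \<otimes> b) \<oplus> t [^] Suc s \<otimes> (c \<otimes> \<alpha>) \<oplus> t [^] e \<otimes> x"
    using Q by (rule square_boundE)
  obtain x0 x1 x2 where x: "x0 \<in> D" "x1 \<in> D" "x2 \<in> D" "x = comb \<alpha> x0 x1 x2" using A_coords[OF \<alpha> *(3)] by blast
  define S T E S' where "S = t [^] s" and "T = t [^] l" and "E = t [^] e" and "S' = t [^] Suc s"
  have cc: "S \<in> carrier L" "T \<in> carrier L" "E \<in> carrier L" "S' \<in> carrier L"
    unfolding S_def T_def E_def S'_def by (auto simp del: nat_pow_Suc)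
  have c: "a1 \<in> carrier L" "a2 \<in> carrier L" "a3 \<in> carrier L" "b \<in> carrier L" "c \<in> carrier L"
    "x0 \<in> carrier L" "x1 \<in> carrier L" "x2 \<in> carrier L"
    using a * x D_carrier by auto
  have "comb \<alpha> (t \<otimes> a1) (S \<otimes> a2) (T \<otimes> a3) =
      comb \<alpha> (t \<otimes> (t \<otimes> b) \<oplus> E \<otimes> x0) (S' \<otimes> c \<oplus> E \<otimes> x1) (E \<otimes> x2)"
  proof -
    have "comb \<alpha> (t \<otimes> a1) (S \<otimes> a2) (T \<otimes> a3) =
        t \<otimes> a1 \<oplus> S \<otimes> (a2 \<otimes> \<alpha>) \<oplus> T \<otimes> (a3 \<otimes> (\<alpha> \<otimes> \<alpha>))"
      unfolding comb_def using c cc \<alpha>_carrier by (simp add: m_assoc)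
    also have "\<dots> = t \<otimes> (t \<otimes> b) \<oplus> S' \<otimes> (c \<otimes> \<alpha>) \<oplus> E \<otimes> x"
      using *(4) unfolding S_def T_def E_def S'_def .
    also have "\<dots> = comb \<alpha> (t \<otimes> (t \<otimes> b) \<oplus> E \<otimes> x0) (S' \<otimes> c \<oplus> E \<otimes> x1) (E \<otimes> x2)"
      unfolding x(4) comb_def using c(4-8) cc(3,4) \<alpha>_carrier t_carrier by algebra
    finally show ?thesis .
  qed
  then have eqs: "t \<otimes> a1 = t \<otimes> (t \<otimes> b) \<oplus> E \<otimes> x0 \<and> S \<otimes> a2 = S' \<otimes> c \<oplus> E \<otimes> x1 \<and> T \<otimes> a3 = E \<otimes> x2"
    by (intro comb_inj[OF \<alpha>])
      (simp_all add: a * x D_props(6,7) tpow_D t_D S_def T_def E_def S'_def del: nat_pow_Suc)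
  define F where "F = t [^] (e - 2)"
  have F: "F \<in> D" "E = t \<otimes> (t \<otimes> F)"
  proof -
    have "Suc (Suc (e - 2)) = e" using e by simp
    then show "E = t \<otimes> (t \<otimes> F)"
      unfolding E_def F_def using tpow_Suc[of \<one> "Suc (e - 2)"] tpow_Suc[of \<one> "e - 2"] by (simp del: nat_pow_Suc)
  qed (simp add: F_def tpow_D)
  have Fc: "F \<in> carrier L" using F D_carrier by simp
  have "t \<otimes> a1 = t \<otimes> (t \<otimes> (b \<oplus> F \<otimes> x0))"
    using eqs unfolding F(2) using c Fc by (simp add: r_distr m_assoc)
  then have "a1 = t \<otimes> (b \<oplus> F \<otimes> x0)" using t_cancel c Fc by simp
  moreover have "b \<oplus> F \<otimes> x0 \<in> D" using * x F D_props(6,7) by simp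
  ultimately show "a1 \<in> t <# D" using l_cosetI[of _ D L t] by metis
  define G where "G = t [^] (e - Suc s)"
  have G: "G \<in> D" "G \<in> carrier L" "E = S' \<otimes> G"
    unfolding E_def S'_def G_def using tpow_split[OF e(2)] tpow_D by (simp_all del: nat_pow_Suc)
  have "S \<otimes> a2 = S' \<otimes> (c \<oplus> G \<otimes> x1)" using eqs unfolding G(3) using c cc G by (simp add: r_distr m_assoc)
  moreover have "c \<oplus> G \<otimes> x1 \<in> D" using * x G D_props(6,7) by simp
  ultimately show "a2 \<in> t <# D" using tpow_Suc_cancel[of s a2] a unfolding S_def S'_def by blast
  show "a3 \<in> t <# D" if "e = Suc l"
    using eqs tpow_Suc_cancel[of l a3 x2] a x that unfolding T_def E_def by blast
qed

text \<open>For s \<ge> 1 everything beyond the constant term is divisible by t in \<open>A\<close>.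
  So the residue field of the order is that of \<open>D\<close>, and scalars modulo \<open>J\<close>
  can be taken from \<open>D\<close>.\<close>

lemma order_decomp:
  assumes s: "1 \<le> s" and y: "y \<in> \<C>"
  obtains d j where "d \<in> D" "j \<in> J" "y = d \<oplus> j"
proof -
  obtain a b x where *: "a \<in> D" "b \<in> D" "x \<in> A" "y = a \<oplus> t [^] s \<otimes> (b \<otimes> \<alpha>) \<oplus> t [^] l \<otimes> x"
    using y by (rule order_setE)
  define j where "j = t [^] s \<otimes> (b \<otimes> \<alpha>) \<oplus> t [^] l \<otimes> x"
  have c: "b \<otimes> \<alpha> \<in> carrier L" "x \<in> carrier L" "a \<in> carrier L" using * D_carrier A_carrier \<alpha>_carrier by auto
  have "j = \<zero> \<oplus> t [^] s \<otimes> (b \<otimes> \<alpha>) \<oplus> t [^] l \<otimes> x" unfolding j_def using c by simp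
  then have "j \<in> \<C>" using order_setI[OF D_props(2) *(2,3)] by metis
  moreover have "j \<in> t <# A"
  proof -
    have "j = t \<otimes> (t [^] (s - 1) \<otimes> (b \<otimes> \<alpha>) \<oplus> t [^] (l - 1) \<otimes> x)"
      unfolding j_def using s s_le_l c tpow_Suc[of "b \<otimes> \<alpha>" "s - 1"] tpow_Suc[of x "l - 1"] by (simp add: r_distr)
    moreover have "t [^] (s - 1) \<otimes> (b \<otimes> \<alpha>) \<oplus> t [^] (l - 1) \<otimes> x \<in> A"
      using * D_in_A \<alpha>_A tpow_A A_props(6,7) by simp
    ultimately show ?thesis using l_cosetI[of _ A L t] by metis
  qed
  moreover have "y = a \<oplus> j" unfolding *(4) j_def using c by (simp add: a_assoc)
  ultimately show thesis using that *(1) by blast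
qed

lemma D_tD_in_J: "d \<in> t <# D \<Longrightarrow> d \<in> J"
proof -
  assume "d \<in> t <# D"
  then obtain a where a: "a \<in> D" "d = t \<otimes> a" by (rule l_cosetE)
  have "d \<in> D" using a D_props(6) t_D by simp
  then show "d \<in> J" using a l_cosetI[OF D_in_A[OF a(1)], of L t] D_subset_order by auto
qed

lemma J_add: "\<lbrakk>x \<in> J; y \<in> J\<rbrakk> \<Longrightarrow> x \<oplus> y \<in> J"
  using additive_subgroup.a_closed[OF ideal.axioms(1)[OF J_ideal]] by simp

lemma JJ_ideal: "ideal (J \<cdot>\<^bsub>\<R>\<^esub> J) \<R>"
proof -
  interpret O: cring \<R> by (rule order_cring)
  show ?thesis by (rule O.ideal_prod_is_ideal[OF J_ideal J_ideal])
qed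

lemma JJ_prod: "\<lbrakk>x \<in> J; y \<in> J\<rbrakk> \<Longrightarrow> x \<otimes> y \<in> J \<cdot>\<^bsub>\<R>\<^esub> J"
  using ideal_prod.prod[of x J y J \<R>] by simp

lemma JJ_add: "\<lbrakk>x \<in> J \<cdot>\<^bsub>\<R>\<^esub> J; y \<in> J \<cdot>\<^bsub>\<R>\<^esub> J\<rbrakk> \<Longrightarrow> x \<oplus> y \<in> J \<cdot>\<^bsub>\<R>\<^esub> J"
  using ideal_prod.sum[of x \<R> J J y] by simp

lemma JJ_zero: "\<zero> \<in> J \<cdot>\<^bsub>\<R>\<^esub> J"
  using additive_subgroup.zero_closed[OF ideal.axioms(1)[OF JJ_ideal]] by simp

lemma JJ_uminus: "x \<in> J \<cdot>\<^bsub>\<R>\<^esub> J \<Longrightarrow> \<ominus> x \<in> J \<cdot>\<^bsub>\<R>\<^esub> J"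
proof -
  assume x: "x \<in> J \<cdot>\<^bsub>\<R>\<^esub> J"
  have xO: "x \<in> \<C>" using ideal.Icarr[OF JJ_ideal x] by simp
  have "\<ominus> \<one> \<otimes>\<^bsub>\<R>\<^esub> x \<in> J \<cdot>\<^bsub>\<R>\<^esub> J"
    using ideal.I_l_closed[OF JJ_ideal x, of "\<ominus> \<one>"] order_props(3,5) by simp
  then show ?thesis using order_carrier[OF xO] by (simp add: l_minus)
qed

lemma u_J: "1 \<le> s \<Longrightarrow> t [^] s \<otimes> \<alpha> \<in> J"
proof -
  assume s: "1 \<le> s"
  have "t [^] s \<otimes> \<alpha> = \<zero> \<oplus> t [^] s \<otimes> (\<one> \<otimes> \<alpha>) \<oplus> t [^] l \<otimes> \<zero>" using \<alpha>_carrier by simp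
  then have "t [^] s \<otimes> \<alpha> \<in> \<C>" using order_setI[OF D_props(2,3) A_props(2)] by metis
  moreover have "t [^] s \<otimes> \<alpha> = t \<otimes> (t [^] (s - 1) \<otimes> \<alpha>)" using tpow_Suc[of \<alpha> "s - 1"] \<alpha>_carrier s by simp
  then have "t [^] s \<otimes> \<alpha> \<in> t <# A" using l_cosetI[OF A_props(6)[OF tpow_A \<alpha>_A], of L t] by metis
  ultimately show ?thesis by simp
qed

lemma v_J: "1 \<le> s \<Longrightarrow> x \<in> A \<Longrightarrow> t [^] l \<otimes> x \<in> J"
proof -
  assume s: "1 \<le> s" and x: "x \<in> A"
  have "t [^] l \<otimes> x = t \<otimes> (t [^] (l - 1) \<otimes> x)" using tpow_Suc[of x "l - 1"] A_carrier x s s_le_l by simp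
  then have "t [^] l \<otimes> x \<in> t <# A" using l_cosetI[OF A_props(6)[OF tpow_A x], of L t] by metis
  then show ?thesis using tpow_in_order[OF x] by simp
qed

text \<open>Replacing coefficients by their \<open>D\<close>-parts changes the combination by sums
  of products of two elements of \<open>J\<close>. Relations modulo J^2 can thus be tested in
  \<open>D\<close>-coordinates.\<close>

lemma combination_reduce:
  assumes s: "1 \<le> s" and k: "k1 \<in> \<C>" "k2 \<in> \<C>" "k3 \<in> \<C>"
    and m: "x1 \<in> J" "x2 \<in> J" "x3 \<in> J"
    and JJ: "k1 \<otimes> x1 \<oplus> k2 \<otimes> x2 \<oplus> k3 \<otimes> x3 \<in> J \<cdot>\<^bsub>\<R>\<^esub> J"
  obtains d1 d2 d3 j1 j2 j3 where "d1 \<in> D" "d2 \<in> D" "d3 \<in> D" "j1 \<in> J" "j2 \<in> J" "j3 \<in> J"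
    "k1 = d1 \<oplus> j1" "k2 = d2 \<oplus> j2" "k3 = d3 \<oplus> j3" "d1 \<otimes> x1 \<oplus> d2 \<otimes> x2 \<oplus> d3 \<otimes> x3 \<in> J \<cdot>\<^bsub>\<R>\<^esub> J"
proof -
  obtain d1 j1 where 1: "d1 \<in> D" "j1 \<in> J" "k1 = d1 \<oplus> j1" using order_decomp[OF s k(1)] by blast
  obtain d2 j2 where 2: "d2 \<in> D" "j2 \<in> J" "k2 = d2 \<oplus> j2" using order_decomp[OF s k(2)] by blast
  obtain d3 j3 where 3: "d3 \<in> D" "j3 \<in> J" "k3 = d3 \<oplus> j3" using order_decomp[OF s k(3)] by blast
  have c: "d1 \<in> carrier L" "d2 \<in> carrier L" "d3 \<in> carrier L" "j1 \<in> carrier L" "j2 \<in> carrier L" "j3 \<in> carrier L"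
    "x1 \<in> carrier L" "x2 \<in> carrier L" "x3 \<in> carrier L"
    using 1 2 3 m D_carrier order_carrier by auto
  define w where "w = j1 \<otimes> x1 \<oplus> j2 \<otimes> x2 \<oplus> j3 \<otimes> x3"
  have w: "w \<in> J \<cdot>\<^bsub>\<R>\<^esub> J" unfolding w_def by (intro JJ_add JJ_prod 1 2 3 m)
  have "d1 \<otimes> x1 \<oplus> d2 \<otimes> x2 \<oplus> d3 \<otimes> x3 = (k1 \<otimes> x1 \<oplus> k2 \<otimes> x2 \<oplus> k3 \<otimes> x3) \<oplus> \<ominus> w"
    unfolding 1(3) 2(3) 3(3) w_def using c by algebra
  then have "d1 \<otimes> x1 \<oplus> d2 \<otimes> x2 \<oplus> d3 \<otimes> x3 \<in> J \<cdot>\<^bsub>\<R>\<^esub> J" using JJ_add[OF JJ JJ_uminus[OF w]] by simp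
  then show thesis using that 1 2 3 by blast
qed

text \<open>Here t^l \<alpha>^2 is the square of t^s \<alpha>, so t and t^s \<alpha> generate
  \<open>J\<close> modulo J^2. Independence is read off from the bound with e = l = 2s.\<close>

lemma embedding_dim_two:
  assumes s: "1 \<le> s" and l: "l = 2 * s"
  shows "embedding_dim \<R> = 2"
proof -
  interpret O: cring \<R> by (rule order_cring)
  let ?u = "t [^] s \<otimes> \<alpha>"
  have uc: "?u \<in> carrier L" using \<alpha>_carrier by simp
  have "embedding_dim \<R> = length [t, ?u]"
  proof (rule embedding_dim_eq_length[OF order_cring J_maximal order_local], unfold order_combine)
    show "set [t, ?u] \<subseteq> J" using t_J u_J[OF s] by simp
    fix y assume y: "y \<in> J"
    then obtain a b c where *: "a \<in> D" "b \<in> D" "c \<in> D"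
        "y = a \<otimes> t \<oplus> b \<otimes> ?u \<oplus> c \<otimes> (t [^] l \<otimes> (\<alpha> \<otimes> \<alpha>))"
      using J_generators[OF s] by blast
    have c: "a \<in> carrier L" "b \<in> carrier L" "c \<in> carrier L" using * D_carrier by auto
    have "t [^] l = t [^] s \<otimes> t [^] s" unfolding l by (simp add: nat_pow_mult mult_2)
    then have uu: "t [^] l \<otimes> (\<alpha> \<otimes> \<alpha>) = ?u \<otimes> ?u"
      using \<alpha>_carrier by (simp add: m_ac)
    have cu: "(c \<otimes> ?u) \<otimes> ?u \<in> J \<cdot>\<^bsub>\<R>\<^esub> J"
    proof (rule JJ_prod[OF _ u_J[OF s]])
      show "c \<otimes> ?u \<in> J" using ideal.I_l_closed[OF J_ideal u_J[OF s], of c] * D_subset_order by auto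
    qed
    have comb: "combine [a, b] [t, ?u] = a \<otimes> t \<oplus> b \<otimes> ?u" using c uc by simp
    have combO: "a \<otimes> t \<oplus> b \<otimes> ?u \<in> \<C>"
      using * D_subset_order t_in_order u_J[OF s] order_props(6,7) by (simp add: subset_iff)
    have "y \<ominus>\<^bsub>\<R>\<^esub> combine [a, b] [t, ?u] = y \<ominus> (a \<otimes> t \<oplus> b \<otimes> ?u)"
      unfolding comb using y combO by (simp add: order_minus)
    also have "\<dots> = (c \<otimes> ?u) \<otimes> ?u"
      unfolding *(4) uu using c uc t_carrier by algebra
    finally show "\<exists>Ks. set Ks \<subseteq> carrier \<R> \<and> length Ks = length [t, ?u] \<and> y \<ominus>\<^bsub>\<R>\<^esub> combine Ks [t, ?u] \<in> J \<cdot>\<^bsub>\<R>\<^esub> J"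
      using * D_subset_order cu by (intro exI[of _ "[a, b]"]) auto
  next
    fix Ks assume Ks: "set Ks \<subseteq> carrier \<R>" "length Ks = length [t, ?u]" "combine Ks [t, ?u] \<in> J \<cdot>\<^bsub>\<R>\<^esub> J"
    then obtain k1 k2 where k: "Ks = [k1, k2]" "k1 \<in> \<C>" "k2 \<in> \<C>"
      by (auto simp: length_Suc_conv)
    \<comment> \<open>A dummy third term with coefficient 0 and vector t^s \<alpha> fits the
      three-term reduction.\<close>
    have "k1 \<otimes> t \<oplus> k2 \<otimes> ?u \<oplus> \<zero> \<otimes> ?u \<in> J \<cdot>\<^bsub>\<R>\<^esub> J"
      using Ks(3) k order_carrier uc by simp
    then obtain d1 d2 d3 j1 j2 j3 where d: "d1 \<in> D" "d2 \<in> D" "d3 \<in> D" "j1 \<in> J" "j2 \<in> J" "j3 \<in> J"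
      "k1 = d1 \<oplus> j1" "k2 = d2 \<oplus> j2" "\<zero> = d3 \<oplus> j3" "d1 \<otimes> t \<oplus> d2 \<otimes> ?u \<oplus> d3 \<otimes> ?u \<in> J \<cdot>\<^bsub>\<R>\<^esub> J"
      using combination_reduce[OF s k(2,3) order_props(2) t_J u_J[OF s] u_J[OF s]] by blast
    have c: "d1 \<in> carrier L" "d2 \<in> carrier L" "d3 \<in> carrier L" "j3 \<in> carrier L" using d D_carrier order_carrier by auto
    have "d1 \<otimes> t \<oplus> d2 \<otimes> ?u \<oplus> d3 \<otimes> ?u =
        t \<otimes> d1 \<oplus> t [^] s \<otimes> ((d2 \<oplus> d3) \<otimes> \<alpha>) \<oplus> t [^] l \<otimes> (\<zero> \<otimes> (\<alpha> \<otimes> \<alpha>))"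
      using c \<alpha>_carrier tpow_carrier[of s] tpow_carrier[of l] t_carrier by algebra
    then have Q: "t \<otimes> d1 \<oplus> t [^] s \<otimes> ((d2 \<oplus> d3) \<otimes> \<alpha>) \<oplus> t [^] l \<otimes> (\<zero> \<otimes> (\<alpha> \<otimes> \<alpha>)) \<in> square_bound l"
      using JJ_subset_square_bound[OF s, of l] d(10) l by simp
    have "d1 \<in> t <# D" "d2 \<oplus> d3 \<in> t <# D"
      using square_bound_coords(1,2)[OF _ _ d(1) D_props(7)[OF d(2,3)] D_props(2) Q] s l by simp_all
    then have dJ: "d1 \<in> J" "d2 \<oplus> d3 \<in> J" using D_tD_in_J by blast+
    \<comment> \<open>The decomposition 0 = d3 + j3 of the dummy coefficient need not be trivial, so
      d3 joins d2 and is compensated by j3.\<close>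
    have "k2 = (d2 \<oplus> d3) \<oplus> (j2 \<oplus> j3)"
    proof -
      have "(d2 \<oplus> d3) \<oplus> (j2 \<oplus> j3) = (d2 \<oplus> j2) \<oplus> (d3 \<oplus> j3)"
        using c d(5) order_carrier by (simp add: a_ac)
      also have "\<dots> = k2" unfolding d(9)[symmetric] d(8)[symmetric] using k order_carrier by simp
      finally show ?thesis by simp
    qed
    then have "k2 \<in> J" using J_add[OF dJ(2) J_add[OF d(5,6)]] by simp
    moreover have "k1 \<in> J" using J_add[OF dJ(1) d(4)] d(7) by simp
    ultimately show "set Ks \<subseteq> J" using k by simp
  qed
  then show ?thesis by simp
qed

lemma embedding_dim_three:
  assumes s: "1 \<le> s" and l: "l < 2 * s"
  shows "embedding_dim \<R> = 3"
proof -
  interpret O: cring \<R> by (rule order_cring)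
  let ?u = "t [^] s \<otimes> \<alpha>" and ?v = "t [^] l \<otimes> (\<alpha> \<otimes> \<alpha>)"
  have uc: "?u \<in> carrier L" "?v \<in> carrier L" using \<alpha>_carrier by simp_all
  have vJ: "?v \<in> J" using v_J[OF s] \<alpha>_A A_props(6) by simp
  have "embedding_dim \<R> = length [t, ?u, ?v]"
  proof (rule embedding_dim_eq_length[OF order_cring J_maximal order_local], unfold order_combine)
    show "set [t, ?u, ?v] \<subseteq> J" using t_J u_J[OF s] vJ by simp
    fix y assume y: "y \<in> J"
    then obtain a b c where *: "a \<in> D" "b \<in> D" "c \<in> D"
        "y = a \<otimes> t \<oplus> b \<otimes> ?u \<oplus> c \<otimes> ?v"
      using J_generators[OF s] by blast
    have c: "a \<in> carrier L" "b \<in> carrier L" "c \<in> carrier L" using * D_carrier by auto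
    have "combine [a, b, c] [t, ?u, ?v] = y" using c uc *(4) by (simp add: a_assoc)
    moreover have "y \<ominus>\<^bsub>\<R>\<^esub> y \<in> J \<cdot>\<^bsub>\<R>\<^esub> J"
      using y order_carrier JJ_zero by (simp add: order_minus_self)
    ultimately show "\<exists>Ks. set Ks \<subseteq> carrier \<R> \<and> length Ks = length [t, ?u, ?v] \<and>
        y \<ominus>\<^bsub>\<R>\<^esub> combine Ks [t, ?u, ?v] \<in> J \<cdot>\<^bsub>\<R>\<^esub> J"
      using * D_subset_order by (intro exI[of _ "[a, b, c]"]) auto
  next
    fix Ks assume Ks: "set Ks \<subseteq> carrier \<R>" "length Ks = length [t, ?u, ?v]"
      "combine Ks [t, ?u, ?v] \<in> J \<cdot>\<^bsub>\<R>\<^esub> J"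
    then obtain k1 k2 k3 where k: "Ks = [k1, k2, k3]" "k1 \<in> \<C>" "k2 \<in> \<C>" "k3 \<in> \<C>"
      by (auto simp: length_Suc_conv)
    have "k1 \<otimes> t \<oplus> k2 \<otimes> ?u \<oplus> k3 \<otimes> ?v \<in> J \<cdot>\<^bsub>\<R>\<^esub> J"
      using Ks(3) k order_carrier uc by (simp add: a_assoc)
    then obtain d1 d2 d3 j1 j2 j3 where d: "d1 \<in> D" "d2 \<in> D" "d3 \<in> D" "j1 \<in> J" "j2 \<in> J" "j3 \<in> J"
      "k1 = d1 \<oplus> j1" "k2 = d2 \<oplus> j2" "k3 = d3 \<oplus> j3" "d1 \<otimes> t \<oplus> d2 \<otimes> ?u \<oplus> d3 \<otimes> ?v \<in> J \<cdot>\<^bsub>\<R>\<^esub> J"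
      using combination_reduce[OF s k(2,3,4) t_J u_J[OF s] vJ] by blast
    have c: "d1 \<in> carrier L" "d2 \<in> carrier L" "d3 \<in> carrier L" using d D_carrier by auto
    have "d1 \<otimes> t \<oplus> d2 \<otimes> ?u \<oplus> d3 \<otimes> ?v =
        t \<otimes> d1 \<oplus> t [^] s \<otimes> (d2 \<otimes> \<alpha>) \<oplus> t [^] l \<otimes> (d3 \<otimes> (\<alpha> \<otimes> \<alpha>))"
      using c \<alpha>_carrier tpow_carrier[of s] tpow_carrier[of l] t_carrier by algebra
    \<comment> \<open>The strict inequality l < 2s permits e = l + 1, the exponent at which the
      coefficient of t^l \<alpha>^2 is controlled too.\<close>
    then have Q: "t \<otimes> d1 \<oplus> t [^] s \<otimes> (d2 \<otimes> \<alpha>) \<oplus> t [^] l \<otimes> (d3 \<otimes> (\<alpha> \<otimes> \<alpha>)) \<in> square_bound (Suc l)"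
      using JJ_subset_square_bound[OF s, of "Suc l"] d(10) l by simp
    have "d1 \<in> t <# D" "d2 \<in> t <# D" "d3 \<in> t <# D"
      using square_bound_coords[OF _ _ d(1-3) Q] s s_le_l by simp_all
    then have "d1 \<in> J" "d2 \<in> J" "d3 \<in> J" using D_tD_in_J by blast+
    then have "k1 \<in> J" "k2 \<in> J" "k3 \<in> J" using J_add d(4-9) by simp_all
    then show "set Ks \<subseteq> J" using k by simp
  qed
  then show ?thesis by simp
qed

lemma order_plane_curve: "plane_curve_singularity \<R> \<longleftrightarrow> 1 \<le> s \<and> l = 2 * s"
proof -
  have "s = 0 \<or> (1 \<le> s \<and> l = 2 * s) \<or> (1 \<le> s \<and> l < 2 * s)" using l_le by linarith
  then show ?thesis
    unfolding plane_curve_singularity_def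
    using order_local order_noetherian order_krull_dim embedding_dim_zero embedding_dim_two embedding_dim_three by auto
qed

end

section \<open>Passage to the residue field\<close>

text \<open>The degree of x over \<open>K\<close> divides 3 by the tower formula and is not 1
  because x lies outside \<open>K\<close>. Hence it is 3, and 1, x, x^2 are independent.\<close>

lemma (in field) degree_three_powers_independent:
  assumes K: "subfield K R" and dim: "dimension 3 K (carrier R)"
    and x: "x \<in> carrier R" "x \<notin> K"
    and abc: "a \<in> K" "b \<in> K" "c \<in> K" and eq: "a \<oplus> b \<otimes> x \<oplus> c \<otimes> (x \<otimes> x) = \<zero>"
  shows "a = \<zero>" "b = \<zero>" "c = \<zero>"
proof -
  have Kc: "K \<subseteq> carrier R" using subfieldE(3)[OF K] .
  have alg: "(algebraic over K) x"
    using finite_dimension_imp_algebraic[OF K carrier_is_subring finite_dimensionI[OF dim] x(1)] .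
  let ?E = "simple_extension K x" and ?n = "degree (Irr K x)"
  have E: "subfield ?E R" using simple_extension_is_subfield[OF K x(1)] alg by simp
  have KE: "K \<subseteq> ?E" by (rule simple_extension_incl[OF Kc x(1)])
  have dimE: "dimension ?n K ?E" by (rule dimension_simple_extension[OF K x(1) alg])
  obtain Us where Us: "set Us \<subseteq> carrier R" "Span K Us = carrier R"
    using exists_base[OF K dim] by blast
  \<comment> \<open>A list spanning over \<open>K\<close> spans over K(x) as well; the tower formula
    needs this finite dimension.\<close>
  have "carrier R \<subseteq> Span ?E Us"
  proof
    fix y assume "y \<in> carrier R"
    then obtain Ks where "set Ks \<subseteq> K" "y = combine Ks Us"
      using Us Span_eq_combine_set[OF K Us(1)] by auto
    then show "y \<in> Span ?E Us" using KE Span_eq_combine_set[OF E Us(1)] by auto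
  qed
  then have "Span ?E Us = carrier R" using Span_in_carrier[OF subfieldE(3)[OF E] Us(1)] by blast
  then have "finite_dimension ?E (carrier R)" using Span_finite_dimension[OF E Us(1)] by simp
  then obtain m where m: "dimension m ?E (carrier R)" by auto
  have nm: "?n * m = 3"
    using dimension_is_inj[OF K telescopic_base[OF K E dimE m] dim] .
  have "?n \<noteq> 1"
  proof
    assume "?n = 1"
    then have d1: "dimension 1 K ?E" using dimE by simp
    have one: "\<one> \<in> K" using subringE(3)[OF subfieldE(1)[OF K]] .
    have "independent K [\<one>]" using li_Cons[OF one_closed, of K "[]"] by simp
    then have "Span K [\<one>] = ?E"
      using independent_length_eq_dimension[OF K d1, of "[\<one>]"] one KE by auto
    moreover have "Span K [\<one>] \<subseteq> K"
    proof
      fix u assume "u \<in> Span K [\<one>]"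
      then obtain k where "k \<in> K" "u = k \<otimes> \<one> \<oplus> \<zero>" using line_extension_mem_iff[of u K \<one> "{\<zero>}"] by auto
      then show "u \<in> K" using Kc by (simp add: subset_iff)
    qed
    ultimately show False using x(2) simple_extension_mem[OF subfieldE(1)[OF K] x(1)] by auto
  qed
  moreover have "?n = 1 \<or> ?n = 3"
  proof -
    have "?n \<le> 3" using nm by (metis dvd_imp_le dvd_triv_left zero_less_numeral)
    moreover have "?n \<noteq> 0" using nm by auto
    moreover have "?n \<noteq> 2"
    proof
      assume "?n = 2"
      then have "2 * m = 3" using nm by simp
      then show False by presburger
    qed
    ultimately show ?thesis by linarith
  qed
  ultimately have n: "?n = 3" by simp
  \<comment> \<open>\<open>exp_base\<close> lists the powers in decreasing order, so the
    coefficients c, b, a appear reversed below.\<close>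
  have "exp_base x 3 = [x [^] (2::nat), x [^] (1::nat), x [^] (0::nat)]"
    by (simp add: exp_base_def numeral_3_eq_3 numeral_2_eq_2)
  then have base: "exp_base x 3 = [x \<otimes> x, x, \<one>]" using x(1) by (simp add: numeral_2_eq_2)
  have ind: "independent K [x \<otimes> x, x, \<one>]"
    using exp_base_independent[OF K x(1) alg] unfolding n base .
  have carr: "a \<in> carrier R" "b \<in> carrier R" "c \<in> carrier R" using abc Kc by auto
  have "combine [c, b, a] [x \<otimes> x, x, \<one>] = a \<oplus> b \<otimes> x \<oplus> c \<otimes> (x \<otimes> x)"
    using carr x(1) by (simp add: a_ac)
  then have "set (take (length [x \<otimes> x, x, \<one>]) [c, b, a]) \<subseteq> {\<zero>}"
    using independent_imp_trivial_combine[OF K ind, of "[c, b, a]"] eq abc by simp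
  then show "a = \<zero>" "b = \<zero>" "c = \<zero>" by simp_all
qed

section \<open>From the assumptions of the theorem to the locales\<close>

lemma local_ring_maximalideal:
  assumes "local_ring R"
  shows "maximalideal (max_ideal R) R"
  using assms theI'[of "\<lambda>J. maximalideal J R"] unfolding local_ring_def max_ideal_def by blast

text \<open>An irreducible element generates the unique maximal ideal tD, so an element outside tD
  has no irreducible divisor and is a unit. The valuation exists because no nonzero element is
  divisible by all powers of t, which is shown with one well-chosen principal ideal.\<close>

lemma discrete_valuation_ring_in_field:
  fixes L (structure)
  assumes L: "field L" and D: "subring D L" and dvr: "discrete_valuation_ring (L\<lparr>carrier := D\<rparr>)"
    and t: "t \<in> D" and max: "max_ideal (L\<lparr>carrier := D\<rparr>) = t <#\<^bsub>L\<^esub> D"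
  shows "dvr_in_field L D t"
proof -
  interpret L: field L by fact
  let ?R = "L\<lparr>carrier := D\<rparr>"
  interpret R: principal_domain ?R using dvr by (simp add: discrete_valuation_ring_def)
  note D_props = subringE[OF D]
  have Dc: "d \<in> carrier L" if "d \<in> D" for d using that D_props(1) by auto
  have tc: "t \<in> carrier L" using Dc t by simp
  have J: "maximalideal (t <#\<^bsub>L\<^esub> D) ?R"
    using local_ring_maximalideal[of ?R] dvr max by (simp add: discrete_valuation_ring_def)
  interpret J: maximalideal "t <#\<^bsub>L\<^esub> D" ?R by (rule J)
  have one: "\<one> \<notin> t <#\<^bsub>L\<^esub> D"
    using J.one_imp_carrier J.I_notcarr by auto
  have t0: "t \<noteq> \<zero>"
  proof
    assume "t = \<zero>"
    then have "t <#\<^bsub>L\<^esub> D = {\<zero>}" using D_props(2) Dc by (auto simp: l_coset_def)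
    then have "field ?R" using R.zeromaximalideal_fieldI J by simp
    then show False using dvr by (simp add: discrete_valuation_ring_def)
  qed
  have uniq: "I = t <#\<^bsub>L\<^esub> D" if "maximalideal I ?R" for I
    using that J dvr unfolding discrete_valuation_ring_def local_ring_def by blast
  have unit: "inv d \<in> D" if d: "d \<in> D" "d \<notin> t <#\<^bsub>L\<^esub> D" for d
  proof -
    have "d \<noteq> \<zero>" using d J.zero_closed by auto
    have "d \<in> Units ?R"
    proof (rule ccontr)
      assume nu: "d \<notin> Units ?R"
      have dc: "d \<in> carrier ?R - {\<zero>\<^bsub>?R\<^esub>}" using d \<open>d \<noteq> \<zero>\<close> by simp
      obtain p where p: "p \<in> carrier ?R" "ring_irreducible\<^bsub>?R\<^esub> p" "p divides\<^bsub>?R\<^esub> d"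
        by (rule R.exists_irreducible_divisor[OF dc nu])
      have "PIdl\<^bsub>?R\<^esub> p = t <#\<^bsub>L\<^esub> D" using uniq R.irreducible_imp_maximalideal[OF p(1,2)] by simp
      then have pJ: "p \<in> t <#\<^bsub>L\<^esub> D" using R.cgenideal_self[OF p(1)] by simp
      obtain e where "e \<in> D" "d = p \<otimes> e" using p(3) by (auto simp: factor_def)
      then show False using d(2) J.I_r_closed[OF pJ, of e] by simp
    qed
    then obtain e where e: "e \<in> D" "d \<otimes> e = \<one>" by (auto simp: Units_def)
    then have "inv d = e" using L.comm_inv_char[of d e] Dc d(1) by simp
    then show ?thesis using e by simp
  qed
  have val: "\<exists>n::nat. \<exists>u\<in>D. u \<notin> t <#\<^bsub>L\<^esub> D \<and> d = t [^] n \<otimes> u" if d: "d \<in> D" "d \<noteq> \<zero>" for d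
  proof (rule ccontr)
    assume no: "\<not> ?thesis"
    have ex: "\<exists>u\<in>D. d = t [^] n \<otimes> u" for n :: nat
    proof (induction n)
      case 0
      then show ?case using d Dc by (auto intro!: bexI[of _ d])
    next
      case (Suc n)
      then obtain u where u: "u \<in> D" "d = t [^] n \<otimes> u" by blast
      then have "u \<in> t <#\<^bsub>L\<^esub> D" using no by blast
      then obtain v where v: "v \<in> D" "u = t \<otimes> v" by (rule l_cosetE)
      then have "d = t [^] Suc n \<otimes> v" using u tc Dc by (simp add: L.m_assoc)
      then show ?case using v by blast
    qed
    have tn: "t [^] n \<in> D" for n :: nat by (induction n) (auto simp: D_props t)
    have tn0: "t [^] n \<noteq> \<zero>" for n :: nat by (induction n) (simp_all add: t0 tc L.integral_iff)
    \<comment> \<open>The increasing union of the ideals t^(-n) d D, each contained in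
      \<open>D\<close> because every power of t divides d. A single generator stops the
      growth.\<close>
    define I where "I = {x \<in> D. \<exists>n::nat. \<exists>e\<in>D. t [^] n \<otimes> x = d \<otimes> e}"
    have "ideal I ?R"
    proof (rule idealI)
      show "ring ?R" ..
      show "subgroup I (add_monoid ?R)"
      proof (rule subgroup.intro)
        show "I \<subseteq> carrier (add_monoid ?R)" by (auto simp: I_def)
        show "\<one>\<^bsub>add_monoid ?R\<^esub> \<in> I"
          using D_props(2) d Dc tc by (auto simp: I_def intro!: exI[of _ "0::nat"] bexI[of _ \<zero>])
      next
        fix x y assume "x \<in> I" "y \<in> I"
        then obtain n m :: nat and e f where *: "x \<in> D" "e \<in> D" "t [^] n \<otimes> x = d \<otimes> e"
          "y \<in> D" "f \<in> D" "t [^] m \<otimes> y = d \<otimes> f" unfolding I_def by blast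
        have c: "x \<in> carrier L" "y \<in> carrier L" "e \<in> carrier L" "f \<in> carrier L" "d \<in> carrier L"
          "t [^] n \<in> carrier L" "t [^] m \<in> carrier L" using * d Dc tc by auto
        have "t [^] (n + m) \<otimes> (x \<oplus> y) = t [^] m \<otimes> (t [^] n \<otimes> x) \<oplus> t [^] n \<otimes> (t [^] m \<otimes> y)"
          using c tc by (simp add: L.nat_pow_mult[symmetric] L.r_distr L.m_ac)
        also have "\<dots> = d \<otimes> (t [^] m \<otimes> e \<oplus> t [^] n \<otimes> f)"
          unfolding *(3) *(6) using c by (simp add: L.r_distr L.m_ac)
        finally have "t [^] (n + m) \<otimes> (x \<oplus> y) = d \<otimes> (t [^] m \<otimes> e \<oplus> t [^] n \<otimes> f)" .
        moreover have "t [^] m \<otimes> e \<oplus> t [^] n \<otimes> f \<in> D" using * tn D_props(6,7) by simp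
        moreover have "x \<oplus> y \<in> D" using * D_props(7) by simp
        ultimately have "x \<oplus> y \<in> I" unfolding I_def by blast
        then show "x \<otimes>\<^bsub>add_monoid ?R\<^esub> y \<in> I" by simp
      next
        fix x assume "x \<in> I"
        then obtain n :: nat and e where *: "x \<in> D" "e \<in> D" "t [^] n \<otimes> x = d \<otimes> e" unfolding I_def by blast
        have c: "x \<in> carrier L" "e \<in> carrier L" "d \<in> carrier L" "t [^] n \<in> carrier L" using * d Dc tc by auto
        have "t [^] n \<otimes> (\<ominus> x) = d \<otimes> (\<ominus> e)" using *(3) c by (simp add: L.r_minus)
        then have mI: "\<ominus> x \<in> I" using * D_props(5) unfolding I_def by blast
        have "\<ominus>\<^bsub>?R\<^esub> x = \<ominus> x" using * D_props(5) c by (intro R.minus_equality) (auto simp: L.l_neg)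
        then show "inv\<^bsub>add_monoid ?R\<^esub> x \<in> I" using mI by (simp add: a_inv_def)
      qed
    next
      have mult: "y \<otimes> x \<in> I" if xI: "x \<in> I" and y: "y \<in> D" for x y
      proof -
        obtain n :: nat and e where *: "x \<in> D" "e \<in> D" "t [^] n \<otimes> x = d \<otimes> e" using xI unfolding I_def by blast
        have c: "x \<in> carrier L" "y \<in> carrier L" "e \<in> carrier L" "d \<in> carrier L" "t [^] n \<in> carrier L"
          using * d y Dc tc by auto
        have "t [^] n \<otimes> (y \<otimes> x) = y \<otimes> (t [^] n \<otimes> x)" using c by (simp add: L.m_ac)
        also have "\<dots> = d \<otimes> (y \<otimes> e)" unfolding *(3) using c by (simp add: L.m_ac)
        finally have "t [^] n \<otimes> (y \<otimes> x) = d \<otimes> (y \<otimes> e)" .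
        then show ?thesis using * y D_props(6) unfolding I_def by blast
      qed
      have comm: "x \<otimes> y = y \<otimes> x" if "x \<in> I" "y \<in> D" for x y
        using that Dc unfolding I_def by (intro L.m_comm) auto
      show "x \<otimes>\<^bsub>?R\<^esub> a \<in> I" "a \<otimes>\<^bsub>?R\<^esub> x \<in> I" if ax: "a \<in> I" "x \<in> carrier ?R" for a x
        using ax mult[of a x] comm[of a x] by simp_all
    qed
    then obtain g where g: "g \<in> D" "I = PIdl\<^bsub>?R\<^esub> g" using R.exists_gen by auto
    have "g \<in> I" using g R.cgenideal_self[of g] by simp
    then obtain n :: nat and e where e: "e \<in> D" "t [^] n \<otimes> g = d \<otimes> e" unfolding I_def by blast
    \<comment> \<open>One power of t more than the generator g uses: f is a multiple of g while t^n
      g is a multiple of d, so d = d t e h and t would be invertible.\<close>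
    obtain f where f: "f \<in> D" "d = t [^] Suc n \<otimes> f" using ex by blast
    have "t [^] Suc n \<otimes> f = d \<otimes> \<one>" using f(2) d Dc by simp
    then have "f \<in> I" using f(1) D_props(3) unfolding I_def by blast
    then obtain h where h: "h \<in> D" "f = h \<otimes> g" using g unfolding cgenideal_def by auto
    have c: "e \<in> carrier L" "h \<in> carrier L" "g \<in> carrier L" "t [^] n \<in> carrier L" using e h g Dc tc by auto
    have "d \<otimes> \<one> = (t [^] n \<otimes> g) \<otimes> (t \<otimes> h)" unfolding f(2) h(2) using c d Dc tc by (simp add: L.m_ac)
    also have "\<dots> = d \<otimes> (t \<otimes> (e \<otimes> h))" unfolding e(2) using c d Dc tc by (simp add: L.m_ac)
    finally have "\<one> = t \<otimes> (e \<otimes> h)" using L.m_lcancel[of d \<one> "t \<otimes> (e \<otimes> h)"] d c tc Dc by simp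
    then show False using one l_cosetI[OF D_props(6)[OF e(1) h(1)], of L t] by simp
  qed
  show ?thesis
    using L D t t0 unit val one by (intro dvr_in_field.intro dvr_in_field_axioms.intro) auto
qed

text \<open>Everything passes through q : A \<rightarrow> A/tA, with kernel tA and q(D) = k. The
  preimage of k is D + tA, and D \<inter> tA = tD; these facts turn independence over k into the
  statement about \<open>D\<close>.\<close>

lemma nonramified_cubic_intro:
  fixes L (structure)
  assumes dvr: "dvr_in_field L D t"
    and dim: "ring.dimension L 3 (fractions L D) (carrier L)"
    and A: "A = integral_closure L D"
    and nonram: "one_branch_nonramified L D A t"
  shows "nonramified_cubic L D t A"
proof -
  interpret dvr_in_field L D t by (rule dvr)
  let ?R = "L\<lparr>carrier := A\<rparr>" and ?I = "t <# A"
  have local: "local_ring ?R" and max: "max_ideal ?R = ?I"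
    using nonram by (auto simp: one_branch_nonramified_def)
  interpret R: cring ?R using local by (simp add: local_ring_def)
  have Ac: "A \<subseteq> carrier L" unfolding A integral_closure_def by auto
  have A_sub: "subring A L" using subring_iff[OF Ac] R.ring_axioms by simp
  note A_props = subringE[OF A_sub]
  have A_carrier: "x \<in> carrier L" if "x \<in> A" for x using that Ac by auto
  have J: "maximalideal ?I ?R" using local_ring_maximalideal[OF local] max by simp
  interpret J: maximalideal ?I ?R by (rule J)
  have DA: "D \<subseteq> A"
  proof
    fix x assume x: "x \<in> D"
    then have xc: "x \<in> carrier L" using D_carrier by simp
    \<comment> \<open>The monic polynomial X - x, leading coefficient listed first.\<close>
    have "[\<one>, \<ominus> x] \<in> carrier (univ_poly L D)"
      using D_props x unfolding univ_poly_def polynomial_def by auto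
    moreover have "eval [\<one>, \<ominus> x] x = \<zero>" using xc by (auto simp: r_neg)
    ultimately show "x \<in> A"
      unfolding A integral_closure_def using xc by (intro CollectI conjI bexI[of _ "[\<one>, \<ominus> x]"]) auto
  qed
  have one_tA: "\<one> \<notin> ?I" using J.one_imp_carrier J.I_notcarr by auto
  \<comment> \<open>Outside tD the element d is a unit of \<open>D\<close>, hence of
    \<open>A\<close>, and cannot lie in the proper ideal tA.\<close>
  have D_tA: "d \<in> t <# D" if d: "d \<in> D" "d \<in> ?I" for d
  proof (rule ccontr)
    assume "d \<notin> t <# D"
    then have i: "inv d \<in> D" using D_unit d by blast
    have "d \<noteq> \<zero>" using \<open>d \<notin> t <# D\<close> D_props(2) l_cosetI[of \<zero> D L t] by auto
    then have "d \<in> Units L" using d D_carrier by (simp add: field_Units)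
    then have "inv d \<otimes> d = \<one>" by simp
    moreover have "inv d \<otimes> d \<in> ?I" using J.I_l_closed[OF d(2), of "inv d"] i DA by auto
    ultimately show False using one_tA by simp
  qed
  let ?F = "?R Quot ?I" and ?k = "residue_image L D A ?I"
  define q where "q x = ?I +>\<^bsub>?R\<^esub> x" for x
  have k_eq: "?k = q ` D" by (simp add: residue_image_def q_def[abs_def])
  have dimF: "ring.dimension ?F 3 ?k (carrier ?F)"
    using nonram unfolding one_branch_nonramified_def by (simp add: Let_def)
  interpret F: field ?F by (rule J.quotient_is_field[OF R.is_cring])
  interpret q: ring_hom_ring ?R ?F q unfolding q_def[abs_def] by (rule J.rcos_ring_hom_ring)
  have q_zero: "q x = \<zero>\<^bsub>?F\<^esub> \<longleftrightarrow> x \<in> ?I" if "x \<in> A" for x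
    using that J.a_rcos_const[of x] J.a_rcos_self[of x] unfolding q_def by (auto simp: FactRing_def)
  have q_carrier: "carrier ?F = q ` A" unfolding q_def by (auto simp: FactRing_def A_RCOSETS_def')
  have D_subR: "subring D ?R"
  proof (rule R.subringI)
    fix x assume x: "x \<in> D"
    have "\<ominus>\<^bsub>?R\<^esub> x = \<ominus> x"
      using x DA D_props(5) D_carrier by (intro R.minus_equality) (auto simp: l_neg)
    then show "\<ominus>\<^bsub>?R\<^esub> x \<in> D" using x D_props(5) by simp
  qed (use D_props DA in auto)
  have sub_k: "subfield ?k ?F"
  proof (rule F.subfieldI')
    show "subring ?k ?F" unfolding k_eq using q.img_is_subring[OF D_subR] .
    fix y assume y: "y \<in> ?k - {\<zero>\<^bsub>?F\<^esub>}"
    then obtain d where d: "d \<in> D" "y = q d" unfolding k_eq by auto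
    have dA: "d \<in> A" using d DA by auto
    have dI: "d \<notin> ?I" using q_zero[OF dA] y d by simp
    have "d \<notin> t <# D" using dI DA by (auto simp: l_coset_def)
    then have i: "inv d \<in> D" using D_unit d by blast
    have "d \<noteq> \<zero>" using dI J.zero_closed by auto
    then have "d \<in> Units L" using d D_carrier by (simp add: field_Units)
    then have "d \<otimes> inv d = \<one>" by simp
    moreover have "q (d \<otimes> inv d) = q d \<otimes>\<^bsub>?F\<^esub> q (inv d)" using q.hom_mult[of d "inv d"] dA i DA by auto
    ultimately have "q d \<otimes>\<^bsub>?F\<^esub> q (inv d) = \<one>\<^bsub>?F\<^esub>" using q.hom_one by simp
    then have "inv\<^bsub>?F\<^esub> (q d) = q (inv d)"
      using F.comm_inv_char[of "q d" "q (inv d)"] dA i DA q_carrier by auto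
    then show "inv\<^bsub>?F\<^esub> y \<in> ?k" using i d unfolding k_eq by auto
  qed
  have q_k: "\<alpha> \<in> D <+>\<^bsub>L\<^esub> ?I" if \<alpha>: "\<alpha> \<in> A" "q \<alpha> \<in> ?k" for \<alpha>
  proof -
    obtain d where d: "d \<in> D" "q \<alpha> = q d" using \<alpha>(2) unfolding k_eq by auto
    have "\<alpha> \<in> ?I +>\<^bsub>?R\<^esub> d" using d(2) J.a_rcos_self[of \<alpha>] \<alpha>(1) unfolding q_def by simp
    then obtain i where i: "i \<in> ?I" "\<alpha> = i \<oplus> d" by (auto simp: a_r_coset_def')
    then have "\<alpha> = d \<oplus> i" using d(1) D_carrier J.Icarr[OF i(1)] A_carrier by (simp add: a_comm)
    then show ?thesis using set_addI[OF d(1) i(1), of L] by simp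
  qed
  show ?thesis
  proof (intro nonramified_cubic.intro nonramified_cubic_axioms.intro)
    show "dvr_in_field L D t" by (rule dvr)
    show "ring.dimension L 3 (fractions L D) (carrier L)" by (rule dim)
    show "subring A L" by (rule A_sub)
    show "D \<subseteq> A" by (rule DA)
    show "x \<in> ?I \<or> y \<in> ?I" if "x \<in> A" "y \<in> A" "x \<otimes> y \<in> ?I" for x y
      using primeideal.I_prime[OF R.maximalideal_prime[OF J], of x y] that by simp
    \<comment> \<open>If D + tA were all of \<open>A\<close>, then \<open>A/tA\<close> would equal k
      and have dimension 1 over k.\<close>
    show "\<exists>\<alpha>\<in>A. \<alpha> \<notin> D <+>\<^bsub>L\<^esub> ?I"
    proof (rule ccontr)
      assume no: "\<not> ?thesis"
      have "carrier ?F \<subseteq> ?k"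
      proof
        fix y assume "y \<in> carrier ?F"
        then obtain a where a: "a \<in> A" "y = q a" unfolding q_carrier by auto
        then have "a \<in> D <+>\<^bsub>L\<^esub> ?I" using no by blast
        then obtain d i where di: "d \<in> D" "i \<in> ?I" "a = d \<oplus> i" by (rule set_addE)
        have "q a = q d \<oplus>\<^bsub>?F\<^esub> q i" unfolding di(3) using q.hom_add[of d i] di DA J.Icarr by auto
        also have "q i = \<zero>\<^bsub>?F\<^esub>" using q_zero[of i] di J.Icarr by auto
        finally have "q a = q d" using q_carrier di DA by auto
        then show "y \<in> ?k" using a di unfolding k_eq by auto
      qed
      then have "carrier ?F = ?k" using subfieldE(3)[OF sub_k] by auto
      then have "F.dimension 3 ?k ?k" using dimF by simp
      then show False using F.dimension_is_inj[OF sub_k _ F.dimension_one[OF sub_k]] by fastforce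
    qed
    fix \<alpha> a b c
    assume \<alpha>: "\<alpha> \<in> A" "\<alpha> \<notin> D <+>\<^bsub>L\<^esub> ?I" and abc: "a \<in> D" "b \<in> D" "c \<in> D"
      and eq: "a \<oplus> b \<otimes> \<alpha> \<oplus> c \<otimes> (\<alpha> \<otimes> \<alpha>) \<in> ?I"
    have abcA: "a \<in> A" "b \<in> A" "c \<in> A" using abc DA by auto
    have "q (a \<oplus> b \<otimes> \<alpha> \<oplus> c \<otimes> (\<alpha> \<otimes> \<alpha>)) = \<zero>\<^bsub>?F\<^esub>"
      using q_zero eq abcA \<alpha>(1) A_props(6,7) by simp
    moreover have "q (a \<oplus> b \<otimes> \<alpha> \<oplus> c \<otimes> (\<alpha> \<otimes> \<alpha>)) =
        q a \<oplus>\<^bsub>?F\<^esub> q b \<otimes>\<^bsub>?F\<^esub> q \<alpha> \<oplus>\<^bsub>?F\<^esub> q c \<otimes>\<^bsub>?F\<^esub> (q \<alpha> \<otimes>\<^bsub>?F\<^esub> q \<alpha>)"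
    proof -
      have m: "q (x \<otimes> y) = q x \<otimes>\<^bsub>?F\<^esub> q y" "q (x \<oplus> y) = q x \<oplus>\<^bsub>?F\<^esub> q y" if "x \<in> A" "y \<in> A" for x y
        using q.hom_mult[of x y] q.hom_add[of x y] that by simp_all
      show ?thesis using abcA \<alpha>(1) A_props(6,7) by (simp add: m)
    qed
    moreover have "q \<alpha> \<in> carrier ?F" "q \<alpha> \<notin> ?k" using \<alpha> q_carrier q_k by auto
    moreover have "q a \<in> ?k" "q b \<in> ?k" "q c \<in> ?k" using abc unfolding k_eq by auto
    ultimately have "q a = \<zero>\<^bsub>?F\<^esub>" "q b = \<zero>\<^bsub>?F\<^esub>" "q c = \<zero>\<^bsub>?F\<^esub>"
      using F.degree_three_powers_independent[OF sub_k dimF, of "q \<alpha>" "q a" "q b" "q c"] by simp_all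
    then show "a \<in> t <# D \<and> b \<in> t <# D \<and> c \<in> t <# D"
      using q_zero abcA D_tA abc by simp
  qed
qed

text \<open>A normal form is a plane curve singularity exactly when s \<ge> 1 and l = 2s, and then
  it is C_s(\<alpha>). Units of \<open>A\<close> outside D + tA are the same as generators, so both
  inclusions run through the same locale.\<close>

lemma (in nonramified_cubic) plane_curve_cubic_rings:
  "{C. cubic_ring L D C \<and> plane_curve_singularity (L\<lparr>carrier := C\<rparr>)} =
   {C_ring L D A t r \<alpha> | r \<alpha>. r \<ge> 1 \<and>
      \<alpha> \<in> Units (L\<lparr>carrier := A\<rparr>) - (D <+>\<^bsub>L\<^esub> (t <#\<^bsub>L\<^esub> A))}"
proof (intro subset_antisym subsetI)
  fix C assume "C \<in> {C. cubic_ring L D C \<and> plane_curve_singularity (L\<lparr>carrier := C\<rparr>)}"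
  then have C: "cubic_ring L D C" "plane_curve_singularity (L\<lparr>carrier := C\<rparr>)" by auto
  have sub: "subring C L" "D \<subseteq> C" using C(1) by (auto simp: cubic_ring_def)
  obtain m :: nat where "t [^] m <# A \<subseteq> C" using cubic_ring_conductor[OF C(1)] by blast
  from classification[OF sub cubic_ring_subset_A[OF C(1)] this]
  obtain \<alpha> s l where *: "generator \<alpha>" "s \<le> l" "l \<le> 2 * s" "C = order_set \<alpha> s l" by blast
  interpret cubic_order L D t A \<alpha> s l using * by unfold_locales
  have sl: "1 \<le> s" "l = 2 * s" using C(2) order_plane_curve *(4) by auto
  then have "C = C_ring L D A t s \<alpha>" using C_ring_eq[OF \<alpha>_carrier, of s] *(4) by simp
  moreover have "\<alpha> \<in> Units (L\<lparr>carrier := A\<rparr>) - (D <+>\<^bsub>L\<^esub> (t <#\<^bsub>L\<^esub> A))"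
    using generator_unit[OF *(1)] *(1) by (simp add: generator_def)
  ultimately show "C \<in> {C_ring L D A t r \<alpha> | r \<alpha>. r \<ge> 1 \<and>
      \<alpha> \<in> Units (L\<lparr>carrier := A\<rparr>) - (D <+>\<^bsub>L\<^esub> (t <#\<^bsub>L\<^esub> A))}" using sl(1) by blast
next
  fix C assume "C \<in> {C_ring L D A t r \<alpha> | r \<alpha>. r \<ge> 1 \<and>
      \<alpha> \<in> Units (L\<lparr>carrier := A\<rparr>) - (D <+>\<^bsub>L\<^esub> (t <#\<^bsub>L\<^esub> A))}"
  then obtain r \<alpha> where *: "C = C_ring L D A t r \<alpha>" "1 \<le> r"
      "\<alpha> \<in> Units (L\<lparr>carrier := A\<rparr>)" "\<alpha> \<notin> D <+>\<^bsub>L\<^esub> (t <#\<^bsub>L\<^esub> A)" by blast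
  have \<alpha>: "generator \<alpha>" using *(3,4) Units_A by (simp add: generator_def)
  interpret cubic_order L D t A \<alpha> r "2 * r" using \<alpha> by unfold_locales auto
  have "C = order_set \<alpha> r (2 * r)" using C_ring_eq[OF \<alpha>_carrier] *(1) by simp
  then show "C \<in> {C. cubic_ring L D C \<and> plane_curve_singularity (L\<lparr>carrier := C\<rparr>)}"
    using order_cubic order_plane_curve *(2) by simp
qed

theorem theorem2p2:
  fixes L :: "('a, 'm) ring_scheme" and K D A :: "'a set" and t :: 'a
  assumes "field L"
    and "subring D L"
    and "discrete_valuation_ring (L\<lparr>carrier := D\<rparr>)"
    and "t \<in> D" and "max_ideal (L\<lparr>carrier := D\<rparr>) = t <#\<^bsub>L\<^esub> D"
    and "adically_complete (L\<lparr>carrier := D\<rparr>) t"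
    and "K = fractions L D"
    and "ring.dimension L 3 K (carrier L)"
    and "A = integral_closure L D"
    and "fin_gen_module L D A"
    and "one_branch_nonramified L D A t"
  shows
    "(\<forall>m B. over_ring L D (A_ring L D A t m) B \<longrightarrow>
        (\<exists>k r \<alpha>. \<alpha> \<in> Units (L\<lparr>carrier := A\<rparr>) - D \<and> 2 * r + k \<le> m \<and>
           B = ((t [^]\<^bsub>L\<^esub> k) <#\<^bsub>L\<^esub> C_ring L D A t r \<alpha>) <+>\<^bsub>L\<^esub> D)) \<and>
     {C. cubic_ring L D C \<and> plane_curve_singularity (L\<lparr>carrier := C\<rparr>)} =
     {C_ring L D A t r \<alpha> | r \<alpha>. r \<ge> 1 \<and>
        \<alpha> \<in> Units (L\<lparr>carrier := A\<rparr>) - (D <+>\<^bsub>L\<^esub> (t <#\<^bsub>L\<^esub> A))}"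
proof -
  have "dvr_in_field L D t"
    by (rule discrete_valuation_ring_in_field[OF assms(1-5)])
  then interpret nonramified_cubic L D t A
    by (rule nonramified_cubic_intro[OF _ assms(8)[unfolded assms(7)] assms(9,11)])
  show ?thesis
    by (intro conjI allI impI over_rings_of_A_ring plane_curve_cubic_rings)
qed

end
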